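(* Let $M$ be a compact locally conformally Kähler (LCK) manifold with vanishing Bott–Chern class, i.e. $M$ is a compact complex manifold carrying an LCK-form $\omega$ with Lee form $\theta$ such that $[\omega]=0$ in $H^{1,1}_{\partial_\theta\bar\partial_\theta}(M)$. Then $M$ (with the same complex structure) admits an LCK-structure $\omega'$, with Lee form $\theta'$, such that the Bott–Chern class $[\omega']\in H^{1,1}_{\partial_{\theta'}\bar\partial_{\theta'}}(M)$ vanishes and the cohomology class $[\theta']\in H^1(M,\mathbb{R})$ is rational, i.e. lies in the image of $H^1(M,\mathbb{Q})$.
   Context: Let $M$ be a connected complex manifold with complex structure $I$. An LCK-form (LCK-structure) on $M$ is the fundamental form $\omega(X,Y)=g(IX,Y)$ of a Hermitian metric $g$ such that $d\omega=\theta\wedge\omega$ for some closed real 1-form $\theta$, called the Lee form of $\omega$. Its class $[\theta]\in H^1(M,\mathbb{R})$ is the Lee class. For a closed real 1-form $\theta$ put $d_\theta\eta=d\eta-\theta\wedge\eta$, with Hodge components $d_\theta=\partial_\theta+\bar\partial_\theta$, where $\partial_\theta=\partial-\theta^{1,0}$, $\bar\partial_\theta=\bar\partial-\theta^{0,1}$. The Bott–Chern cohomology is $$H^{1,1}_{\partial_\theta\bar\partial_\theta}(M)=\frac{\{\eta\in\Lambda^{1,1}(M):\ \partial_\theta\eta=0,\ \bar\partial_\theta\eta=0\}}{\partial_\theta\bar\partial_\theta\big(C^\infty(M,\mathbb{C})\big)}.$$ An LCK-form $\omega$ with Lee form $\theta$ is $d_\theta$-closed of type $(1,1)$; its class in $H^{1,1}_{\partial_\theta\bar\partial_\theta}(M)$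 is called the Bott–Chern class of the LCK-manifold. *)

theory Defs
  imports "HOL-Analysis.Analysis" "HOL-Homology.Homology"
begin

section \<open>Smooth and holomorphic maps between open subsets of Euclidean spaces\<close>

primrec Ck_on :: "nat \<Rightarrow> 'a::euclidean_space set \<Rightarrow> ('a \<Rightarrow> 'b::real_normed_vector) \<Rightarrow> bool" where
  "Ck_on 0 S f \<longleftrightarrow> continuous_on S f"
| "Ck_on (Suc k) S f \<longleftrightarrow>
     (\<forall>x\<in>S. f differentiable (at x)) \<and> (\<forall>v. Ck_on k S (\<lambda>x. frechet_derivative f (at x) v))"

text \<open>Only meaningful for open \<open>S\<close>; the derivatives are derivatives over the reals.\<close>

definition smooth_on :: "'a::euclidean_space set \<Rightarrow> ('a \<Rightarrow> 'b::real_normed_vector) \<Rightarrow> bool" where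
  "smooth_on S f \<longleftrightarrow> (\<forall>k. Ck_on k S f)"

text \<open>A holomorphic map of several complex variables: a smooth map satisfying the Cauchy--Riemann
  equations, i.e. whose real differential commutes with multiplication by \<open>\<i>\<close>.\<close>

definition holomorphic_map_on ::
    "(complex^'n::finite) set \<Rightarrow> (complex^'n \<Rightarrow> complex^'m::finite) \<Rightarrow> bool" where
  "holomorphic_map_on S f \<longleftrightarrow> smooth_on S f \<and>
     (\<forall>x\<in>S. \<forall>v. frechet_derivative f (at x) (\<i> *s v) = \<i> *s frechet_derivative f (at x) v)"


section \<open>Complex manifolds\<close>

text \<open>The underlying topological space is the whole type \<open>'m\<close>; a chart is a pair of its domain and
  its coordinate map (whose values outside the domain are irrelevant).\<close>

type_synonym ('m, 'n) chart = "'m set \<times> ('m \<Rightarrow> complex^'n)"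

definition chart_cod :: "('m, 'n::finite) chart \<Rightarrow> (complex^'n) set" where
  "chart_cod c = snd c ` fst c"

definition chart_inv :: "('m, 'n::finite) chart \<Rightarrow> complex^'n \<Rightarrow> 'm" where
  "chart_inv c = inv_into (fst c) (snd c)"

definition transition ::
    "('m, 'n::finite) chart \<Rightarrow> ('m, 'n) chart \<Rightarrow> complex^'n \<Rightarrow> complex^'n" where
  "transition c c' = snd c' \<circ> chart_inv c"

definition complex_atlas :: "('m::topological_space, 'n::finite) chart set \<Rightarrow> bool" where
  "complex_atlas A \<longleftrightarrow>
     (\<Union>c\<in>A. fst c) = UNIV \<and>
     (\<forall>c\<in>A. open (fst c) \<and> open (chart_cod c) \<and>
        homeomorphism (fst c) (chart_cod c) (snd c) (chart_inv c)) \<and>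
     (\<forall>c\<in>A. \<forall>c'\<in>A. holomorphic_map_on (snd c ` (fst c \<inter> fst c')) (transition c c'))"


section \<open>Tensors and differential forms\<close>

text \<open>A complex-valued covariant \<open>k\<close>-tensor (field) is given by its local expressions:
  \<open>\<eta> c x [v\<^sub>1, \<dots>, v\<^sub>k]\<close> is the value, in the chart \<open>c\<close> and at the point with coordinates \<open>x\<close>,
  on the tangent vectors with coordinates \<open>v\<^sub>1, \<dots>, v\<^sub>k\<close>. Junk arguments (not a chart of the atlas,
  outside the coordinate domain, wrong number of vectors) give 0, so that equality of tensors
  is equality of functions. Tangent vectors are real tangent vectors, and the almost complex structure
  acts on them as \<open>v \<mapsto> \<i> *s v\<close>.\<close>

type_synonym ('m, 'n) tensor = "('m, 'n) chart \<Rightarrow> complex^'n \<Rightarrow> (complex^'n) list \<Rightarrow> complex"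

definition covariant_tensor ::
    "('m, 'n::finite) chart set \<Rightarrow> nat \<Rightarrow> ('m, 'n) tensor \<Rightarrow> bool" where
  "covariant_tensor A k \<eta> \<longleftrightarrow>
     (\<forall>c x vs. c \<notin> A \<or> x \<notin> chart_cod c \<or> length vs \<noteq> k \<longrightarrow> \<eta> c x vs = 0) \<and>
     (\<forall>c\<in>A. \<forall>x\<in>chart_cod c. \<forall>vs. \<forall>i<k. length vs = k \<longrightarrow> linear (\<lambda>u. \<eta> c x (vs[i := u]))) \<and>
     (\<forall>c\<in>A. \<forall>vs. length vs = k \<longrightarrow> smooth_on (chart_cod c) (\<lambda>x. \<eta> c x vs)) \<and>
     (\<forall>c\<in>A. \<forall>c'\<in>A. \<forall>p\<in>fst c \<inter> fst c'. \<forall>vs. length vs = k \<longrightarrow>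
        \<eta> c (snd c p) vs =
        \<eta> c' (snd c' p) (map (frechet_derivative (transition c c') (at (snd c p))) vs))"

definition differential_form ::
    "('m, 'n::finite) chart set \<Rightarrow> nat \<Rightarrow> ('m, 'n) tensor \<Rightarrow> bool" where
  "differential_form A k \<eta> \<longleftrightarrow> covariant_tensor A k \<eta> \<and>
     (\<forall>c x vs i j. length vs = k \<and> i < j \<and> j < k \<and> vs ! i = vs ! j \<longrightarrow> \<eta> c x vs = 0)"

definition real_tensor :: "('m, 'n::finite) tensor \<Rightarrow> bool" where
  "real_tensor \<eta> \<longleftrightarrow> (\<forall>c x vs. \<eta> c x vs \<in> \<real>)"

text \<open>A \<open>(p+q)\<close>-form has type \<open>(p,q)\<close> iff it is homogeneous of bidegree \<open>(p,q)\<close> under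
  the action of complex scalars on tangent vectors.\<close>

definition of_type :: "nat \<Rightarrow> nat \<Rightarrow> ('m, 'n::finite) tensor \<Rightarrow> bool" where
  "of_type p q \<eta> \<longleftrightarrow>
     (\<forall>c x vs a. \<eta> c x (map (\<lambda>v. a *s v) vs) = a ^ p * cnj a ^ q * \<eta> c x vs)"

definition zero_tensor :: "('m, 'n::finite) tensor" where
  "zero_tensor = (\<lambda>c x vs. 0)"

definition diff_tensor :: "('m, 'n::finite) tensor \<Rightarrow> ('m, 'n) tensor \<Rightarrow> ('m, 'n) tensor" where
  "diff_tensor \<eta> \<zeta> = (\<lambda>c x vs. \<eta> c x vs - \<zeta> c x vs)"

definition smooth_function :: "('m, 'n::finite) chart set \<Rightarrow> ('m \<Rightarrow> complex) \<Rightarrow> bool" where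
  "smooth_function A f \<longleftrightarrow> (\<forall>c\<in>A. smooth_on (chart_cod c) (f \<circ> chart_inv c))"

definition function_form :: "('m, 'n::finite) chart set \<Rightarrow> ('m \<Rightarrow> complex) \<Rightarrow> ('m, 'n) tensor" where
  "function_form A f = (\<lambda>c x vs. if c \<in> A \<and> x \<in> chart_cod c \<and> vs = [] then f (chart_inv c x) else 0)"


section \<open>Exterior derivatives and their twisted versions\<close>

text \<open>The values at \<open>u\<close> of \<open>dh\<close>, of \<open>\<partial>h = \<Sum>\<^sub>j (\<partial>h/\<partial>z\<^sub>j) dz\<^sub>j\<close> and of its conjugate counterpart
  \<open>\<Sum>\<^sub>j (\<partial>h/\<partial>w\<^sub>j) dw\<^sub>j\<close> with \<open>w\<^sub>j = cnj z\<^sub>j\<close> (Wirtinger derivatives).\<close>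

type_synonym 'n deriv_op = "(complex^'n \<Rightarrow> complex) \<Rightarrow> complex^'n \<Rightarrow> complex^'n \<Rightarrow> complex"

definition dir_d :: "'n::finite deriv_op" where
  "dir_d h x u = frechet_derivative h (at x) u"

definition dir_del :: "'n::finite deriv_op" where
  "dir_del h x u = (dir_d h x u - \<i> * dir_d h x (\<i> *s u)) / 2"

definition dir_delbar :: "'n::finite deriv_op" where
  "dir_delbar h x u = (dir_d h x u + \<i> * dir_d h x (\<i> *s u)) / 2"

definition remove_nth :: "nat \<Rightarrow> 'a list \<Rightarrow> 'a list" where
  "remove_nth i vs = take i vs @ drop (Suc i) vs"

text \<open>\<open>(d\<eta>)(v\<^sub>0, \<dots>, v\<^sub>k) = \<Sum>\<^sub>i (-1)\<^sup>i D\<^bsub>v\<^sub>i\<^esub> (\<eta>(v\<^sub>0, \<dots>, v\<^sub>i omitted, \<dots>, v\<^sub>k))\<close> for constant coordinate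
  fields \<open>v\<^sub>i\<close>. Since the products of \<open>dz\<^sub>j\<close>s and \<open>dw\<^sub>j\<close>s have constant coefficients, replacing \<open>D\<close> by its
  complex linear or antilinear part differentiates the coefficients of \<open>\<eta>\<close> with respect to the \<open>z\<^sub>j\<close>
  or the \<open>w\<^sub>j\<close> only, which gives the Hodge components of \<open>d\<close>.\<close>

definition ext_deriv ::
    "'n::finite deriv_op \<Rightarrow> ('m, 'n) chart set \<Rightarrow> ('m, 'n) tensor \<Rightarrow> ('m, 'n) tensor" where
  "ext_deriv D A \<eta> = (\<lambda>c x vs.
     if c \<in> A \<and> x \<in> chart_cod c
     then \<Sum>i<length vs. (-1) ^ i * D (\<lambda>y. \<eta> c y (remove_nth i vs)) x (vs ! i)
     else 0)"

text \<open>The wedge product \<open>\<alpha> \<and> \<eta>\<close> of a 1-form with a form, normalised by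
  \<open>(\<alpha> \<and> \<beta>)(u, v) = \<alpha>(u) \<beta>(v) - \<alpha>(v) \<beta>(u)\<close> for 1-forms, compatibly with \<^const>\<open>ext_deriv\<close>.\<close>

definition wedge1 :: "('m, 'n::finite) tensor \<Rightarrow> ('m, 'n) tensor \<Rightarrow> ('m, 'n) tensor" where
  "wedge1 \<alpha> \<eta> = (\<lambda>c x vs. \<Sum>i<length vs. (-1) ^ i * \<alpha> c x [vs ! i] * \<eta> c x (remove_nth i vs))"

text \<open>Components of type \<open>(1,0)\<close> and \<open>(0,1)\<close> of a 1-form.\<close>

definition part10 :: "('m, 'n::finite) tensor \<Rightarrow> ('m, 'n) tensor" where
  "part10 \<theta> = (\<lambda>c x vs. (\<theta> c x vs - \<i> * \<theta> c x (map (\<lambda>v. \<i> *s v) vs)) / 2)"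

definition part01 :: "('m, 'n::finite) tensor \<Rightarrow> ('m, 'n) tensor" where
  "part01 \<theta> = (\<lambda>c x vs. (\<theta> c x vs + \<i> * \<theta> c x (map (\<lambda>v. \<i> *s v) vs)) / 2)"

definition ext_d :: "('m, 'n::finite) chart set \<Rightarrow> ('m, 'n) tensor \<Rightarrow> ('m, 'n) tensor" where
  "ext_d = ext_deriv dir_d"

definition del_tw ::
    "('m, 'n::finite) chart set \<Rightarrow> ('m, 'n) tensor \<Rightarrow> ('m, 'n) tensor \<Rightarrow> ('m, 'n) tensor" where
  "del_tw A \<theta> \<eta> = diff_tensor (ext_deriv dir_del A \<eta>) (wedge1 (part10 \<theta>) \<eta>)"

definition delbar_tw ::
    "('m, 'n::finite) chart set \<Rightarrow> ('m, 'n) tensor \<Rightarrow> ('m, 'n) tensor \<Rightarrow> ('m, 'n) tensor" where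
  "delbar_tw A \<theta> \<eta> = diff_tensor (ext_deriv dir_delbar A \<eta>) (wedge1 (part01 \<theta>) \<eta>)"


section \<open>LCK-structures\<close>

definition closed_real_1form :: "('m, 'n::finite) chart set \<Rightarrow> ('m, 'n) tensor \<Rightarrow> bool" where
  "closed_real_1form A \<theta> \<longleftrightarrow>
     differential_form A 1 \<theta> \<and> real_tensor \<theta> \<and> ext_d A \<theta> = zero_tensor"

definition hermitian_metric :: "('m, 'n::finite) chart set \<Rightarrow> ('m, 'n) tensor \<Rightarrow> bool" where
  "hermitian_metric A g \<longleftrightarrow>
     covariant_tensor A 2 g \<and> real_tensor g \<and>
     (\<forall>c\<in>A. \<forall>x\<in>chart_cod c.
        (\<forall>u v. g c x [u, v] = g c x [v, u]) \<and>
        (\<forall>u. u \<noteq> 0 \<longrightarrow> Re (g c x [u, u]) > 0) \<and>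
        (\<forall>u v. g c x [\<i> *s u, \<i> *s v] = g c x [u, v]))"

text \<open>\<open>\<omega>(X, Y) = g(I X, Y)\<close>\<close>

definition fundamental_form :: "('m, 'n::finite) tensor \<Rightarrow> ('m, 'n) tensor" where
  "fundamental_form g = (\<lambda>c x vs. g c x (vs[0 := \<i> *s (vs ! 0)]))"

text \<open>\<open>\<omega>\<close> is an LCK-form with Lee form \<open>\<theta>\<close>.\<close>

definition lck_form ::
    "('m, 'n::finite) chart set \<Rightarrow> ('m, 'n) tensor \<Rightarrow> ('m, 'n) tensor \<Rightarrow> bool" where
  "lck_form A \<omega> \<theta> \<longleftrightarrow>
     (\<exists>g. hermitian_metric A g \<and> \<omega> = fundamental_form g) \<and>
     closed_real_1form A \<theta> \<and> ext_d A \<omega> = wedge1 \<theta> \<omega>"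


section \<open>Twisted Bott--Chern cohomology in bidegree (1,1)\<close>

definition bott_chern_cocycles ::
    "('m, 'n::finite) chart set \<Rightarrow> ('m, 'n) tensor \<Rightarrow> ('m, 'n) tensor set" where
  "bott_chern_cocycles A \<theta> =
     {\<eta>. differential_form A 2 \<eta> \<and> of_type 1 1 \<eta> \<and>
         del_tw A \<theta> \<eta> = zero_tensor \<and> delbar_tw A \<theta> \<eta> = zero_tensor}"

definition bott_chern_coboundaries ::
    "('m, 'n::finite) chart set \<Rightarrow> ('m, 'n) tensor \<Rightarrow> ('m, 'n) tensor set" where
  "bott_chern_coboundaries A \<theta> =
     {del_tw A \<theta> (delbar_tw A \<theta> (function_form A f)) | f. smooth_function A f}"

definition bott_chern_rel ::
    "('m, 'n::finite) chart set \<Rightarrow> ('m, 'n) tensor \<Rightarrow> (('m, 'n) tensor \<times> ('m, 'n) tensor) set" where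
  "bott_chern_rel A \<theta> =
     {(\<eta>, \<zeta>). \<eta> \<in> bott_chern_cocycles A \<theta> \<and> \<zeta> \<in> bott_chern_cocycles A \<theta> \<and>
        diff_tensor \<eta> \<zeta> \<in> bott_chern_coboundaries A \<theta>}"

text \<open>The class of a cocycle as a coset, an element of
  \<open>bott_chern_cocycles A \<theta> // bott_chern_rel A \<theta>\<close>. It is empty for a form which is not a cocycle,
  and so differs from the zero class.\<close>

definition bott_chern_class ::
    "('m, 'n::finite) chart set \<Rightarrow> ('m, 'n) tensor \<Rightarrow> ('m, 'n) tensor \<Rightarrow> ('m, 'n) tensor set" where
  "bott_chern_class A \<theta> \<eta> = bott_chern_rel A \<theta> `` {\<eta>}"


section \<open>Rational classes in the first cohomology\<close>

text \<open>Singular cochains with coefficients in an abelian group, and the cocycle condition.\<close>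

definition singular_cochain ::
    "nat \<Rightarrow> 'm topology \<Rightarrow> ('m chain \<Rightarrow> 'r::ab_group_add) \<Rightarrow> bool" where
  "singular_cochain k X \<phi> \<longleftrightarrow>
     (\<forall>a b. singular_chain k X a \<and> singular_chain k X b \<longrightarrow> \<phi> (a + b) = \<phi> a + \<phi> b)"

definition singular_cocycle ::
    "nat \<Rightarrow> 'm topology \<Rightarrow> ('m chain \<Rightarrow> 'r::ab_group_add) \<Rightarrow> bool" where
  "singular_cocycle k X \<phi> \<longleftrightarrow> singular_cochain k X \<phi> \<and>
     (\<forall>a. singular_chain (Suc k) X a \<longrightarrow> \<phi> (chain_boundary (Suc k) a) = 0)"

text \<open>A path which is smooth on a neighbourhood of \<open>[0,1]\<close>, and the corresponding (smooth) singular
  1-simplex; the coordinate \<open>x 1\<close> runs from 0 at vertex 0 to 1 at vertex 1.\<close>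

definition smooth_path ::
    "('m::topological_space, 'n::finite) chart set \<Rightarrow> (real \<Rightarrow> 'm) \<Rightarrow> bool" where
  "smooth_path A \<gamma> \<longleftrightarrow> (\<exists>J. open J \<and> {0..1} \<subseteq> J \<and> continuous_on J \<gamma> \<and>
     (\<forall>c\<in>A. smooth_on {t \<in> J. \<gamma> t \<in> fst c} (snd c \<circ> \<gamma>)))"

definition path_simplex :: "(real \<Rightarrow> 'm) \<Rightarrow> (nat \<Rightarrow> real) \<Rightarrow> 'm" where
  "path_simplex \<gamma> = restrict (\<lambda>x. \<gamma> (x 1)) (standard_simplex 1)"

text \<open>The integral of a real 1-form along a smooth path. The integrand \<open>\<theta>(\<gamma>'(t))\<close> is computed
  in an arbitrary chart around \<open>\<gamma>(t)\<close>; it does not depend on the chart.\<close>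

definition path_integral_form ::
    "('m, 'n::finite) chart set \<Rightarrow> ('m, 'n) tensor \<Rightarrow> (real \<Rightarrow> 'm) \<Rightarrow> real" where
  "path_integral_form A \<theta> \<gamma> = integral {0..1} (\<lambda>t.
     let c = (SOME c. c \<in> A \<and> \<gamma> t \<in> fst c)
     in Re (\<theta> c (snd c (\<gamma> t)) [vector_derivative (snd c \<circ> \<gamma>) (at t)]))"

text \<open>The class of the closed real 1-form \<open>\<theta>\<close> lies in the image of
  \<open>H\<^sup>1(M, \<rat>) \<rightarrow> H\<^sup>1(M, \<real>)\<close>. The de Rham isomorphism sends \<open>[\<theta>]\<close> to the class of the
  cochain \<open>\<gamma> \<mapsto> \<integral>\<^sub>\<gamma> \<theta>\<close> on smooth singular 1-simplices; the condition is that, as a smooth singular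
  cochain, it is cohomologous over the reals to (the restriction of) a rational singular cocycle.\<close>

definition rational_class ::
    "('m::topological_space, 'n::finite) chart set \<Rightarrow> ('m, 'n) tensor \<Rightarrow> bool" where
  "rational_class A \<theta> \<longleftrightarrow>
     (\<exists>(\<phi> :: 'm chain \<Rightarrow> rat) (\<beta> :: 'm chain \<Rightarrow> real).
        singular_cocycle 1 euclidean \<phi> \<and> singular_cochain 0 euclidean \<beta> \<and>
        (\<forall>\<gamma>. smooth_path A \<gamma> \<longrightarrow>
           path_integral_form A \<theta> \<gamma> =
           of_rat (\<phi> (frag_of (path_simplex \<gamma>)))
             + \<beta> (chain_boundary 1 (frag_of (path_simplex \<gamma>)))))"

end

theory Submission
  imports Defs
begin

text \<open>If \<open>\<omega>\<close> is the twisted \<open>\<partial>\<close>-\<open>\<partial>\<close>bar derivative of \<open>f\<close> for the Lee form \<open>\<theta>\<close>, then for every closed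
  real 1-form \<open>\<theta>'\<close> the corresponding derivative of \<open>\<i> Im f\<close> is a real \<open>d\<close>-twisted closed (1,1)-form, and it is
  still positive when \<open>\<theta>'\<close> is \<open>C\<^sup>1\<close>-close to \<open>\<theta>\<close>, by compactness. A rational \<open>\<theta>'\<close> close to \<open>\<theta>\<close> is found as
  follows. Let \<open>f\<^sub>i\<close> be primitives of \<open>\<theta>\<close> on finitely many coordinate balls. On compact parts of the
  overlaps the differences \<open>f\<^sub>i - f\<^sub>j\<close> take finitely many values, so by Dirichlet's theorem some \<open>q \<ge> 1\<close> makes
  all \<open>q (f\<^sub>i - f\<^sub>j)\<close> nearly integral. Then the functions \<open>exp (2\<pi>\<i> q f\<^sub>i)\<close> nearly agree, a partition of unity
  glues them to a nowhere vanishing function \<open>F\<close>, and \<open>\<theta>' = Im (dF / F) / (2\<pi>q)\<close>. Its periods are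
  \<open>1/q\<close> times winding numbers of \<open>F\<close>.\<close>

section \<open>Calculus of smooth maps\<close>

text \<open>Only \<open>Im f\<close> matters because the Hermitian quadratic form at
  \<open>u\<close> is half the sum of the second twisted derivatives of \<open>Im f\<close> along
  \<open>u\<close> and \<open>\<i> *s u\<close>. The real part of \<open>f\<close> does not enter
  it, and for another Lee form it could spoil reality. These second derivatives contain first
  derivatives of the Lee form, which is why closeness in C^1 is required. The obstacle is the order
  of choices: \<open>q\<close> depends on the wanted accuracy, while every derivative of
  \<open>exp (2\<pi>\<i> q f\<^sub>i)\<close> costs a factor \<open>q\<close>. In dF/F and its
  derivative these factors cancel: the error beside \<theta> involves only derivatives of the
  partition of unity, weighted by the local functions. Those derivatives sum to zero and the weights
  nearly agree, so the error is small with constants independent of \<open>q\<close>. For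
  rationality a cocycle on all continuous simplices is needed. Subtracting the variation of the
  principal argument from the increment of a continuous argument leaves integer multiples of 2\<pi>,
  and what is subtracted is a real coboundary.\<close>

lemma frechet_derivative_cong_open:
  assumes "open S" "x \<in> S" "\<And>y. y \<in> S \<Longrightarrow> f y = g y"
  shows "frechet_derivative f (at x) = frechet_derivative g (at x)"
proof -
  have "(f has_derivative f') (at x) \<longleftrightarrow> (g has_derivative f') (at x)" for f'
    using assms by (metis has_derivative_transform_within_open)
  then show ?thesis by (simp add: frechet_derivative_def)
qed

lemma differentiable_cong_open:
  assumes "open S" "x \<in> S" "\<And>y. y \<in> S \<Longrightarrow> f y = g y" "f differentiable (at x)"
  shows "g differentiable (at x)"
  using assms unfolding differentiable_def by (metis has_derivative_transform_within_open)

section \<open>Closure properties of C^k maps between Euclidean spaces\<close>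

lemma Ck_on_cong:
  assumes "open S" "\<And>x. x \<in> S \<Longrightarrow> f x = g x" "Ck_on k S f"
  shows "Ck_on k S g"
  using assms
proof (induction k arbitrary: f g)
  case 0
  then show ?case by (simp cong: continuous_on_cong)
next
  case (Suc k)
  have "g differentiable (at x)" if "x \<in> S" for x
    using Suc.prems that by (auto intro: differentiable_cong_open[of S x f g])
  moreover have "Ck_on k S (\<lambda>x. frechet_derivative g (at x) v)" for v
    by (rule Suc.IH[of "\<lambda>x. frechet_derivative f (at x) v"])
       (use Suc.prems frechet_derivative_cong_open[of S _ f g] in auto)
  ultimately show ?case by simp
qed

lemma Ck_on_Suc_imp: "Ck_on (Suc k) S f \<Longrightarrow> Ck_on k S f"
proof (induction k arbitrary: f)
  case 0
  then show ?case
    by (auto intro!: continuous_at_imp_continuous_on differentiable_imp_continuous_within)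
next
  case (Suc k)
  then show ?case by (metis Ck_on.simps(2))
qed

lemma Ck_on_imp_continuous_on: "Ck_on k S f \<Longrightarrow> continuous_on S f"
  by (induction k) (use Ck_on_Suc_imp in \<open>auto simp del: Ck_on.simps(2)\<close>)

text \<open>The recursion of \<open>Ck_on\<close> speaks of \<open>frechet_derivative\<close>; this
  rule lets the inductions below work with any explicit formula for the derivative.\<close>

lemma Ck_on_SucI:
  assumes "open S" "\<And>x. x \<in> S \<Longrightarrow> (f has_derivative f' x) (at x)"
    and "\<And>v. Ck_on k S (\<lambda>x. f' x v)"
  shows "Ck_on (Suc k) S f"
proof -
  have "Ck_on k S (\<lambda>x. frechet_derivative f (at x) v)" for v
    by (rule Ck_on_cong[OF assms(1) _ assms(3)[of v]])
       (metis assms(2) frechet_derivative_at)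
  then show ?thesis using assms(2) by (auto simp: differentiable_def)
qed

lemma Ck_on_subset: "Ck_on k S f \<Longrightarrow> T \<subseteq> S \<Longrightarrow> Ck_on k T f"
  by (induction k arbitrary: f) (auto intro: continuous_on_subset)

lemma Ck_on_Un:
  assumes "open S" "open T" "Ck_on k S f" "Ck_on k T f"
  shows "Ck_on k (S \<union> T) f"
  using assms
  by (induction k arbitrary: f) (auto intro: continuous_on_open_Un)

lemma Ck_on_const: "Ck_on k S (\<lambda>x. c)"
  by (induction k arbitrary: c) auto

lemma Ck_on_add:
  assumes "open S" "Ck_on k S f" "Ck_on k S g"
  shows "Ck_on k S (\<lambda>x. f x + g x)"
  using assms
proof (induction k arbitrary: f g)
  case 0
  then show ?case by (auto intro: continuous_intros)
next
  case (Suc k)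
  show ?case
  proof (rule Ck_on_SucI[OF assms(1)])
    fix x assume "x \<in> S"
    then show "((\<lambda>x. f x + g x) has_derivative
      (\<lambda>v. frechet_derivative f (at x) v + frechet_derivative g (at x) v)) (at x)"
      using Suc.prems by (auto intro!: has_derivative_add simp: frechet_derivative_works[symmetric])
  next
    fix v show "Ck_on k S (\<lambda>x. frechet_derivative f (at x) v + frechet_derivative g (at x) v)"
      using Suc by auto
  qed
qed

lemma Ck_on_sum:
  assumes "open S" "\<And>i. i \<in> I \<Longrightarrow> Ck_on k S (f i)"
  shows "Ck_on k S (\<lambda>x. \<Sum>i\<in>I. f i x)"
proof (cases "finite I")
  case True
  then show ?thesis using assms(2)
    by (induction I) (auto intro: Ck_on_const Ck_on_add[OF assms(1)])
qed (auto intro: Ck_on_const)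

lemma (in bounded_bilinear) Ck_on:
  assumes "open S" "Ck_on k S f" "Ck_on k S g"
  shows "Ck_on k S (\<lambda>x. prod (f x) (g x))"
  using assms
proof (induction k arbitrary: f g)
  case 0
  then show ?case by (auto intro: continuous_on)
next
  case (Suc k)
  show ?case
  proof (rule Ck_on_SucI[OF assms(1)])
    fix x assume "x \<in> S"
    then show "((\<lambda>x. prod (f x) (g x)) has_derivative
      (\<lambda>v. prod (f x) (frechet_derivative g (at x) v) + prod (frechet_derivative f (at x) v) (g x))) (at x)"
      using Suc.prems by (auto intro!: FDERIV simp: frechet_derivative_works[symmetric])
  next
    fix v show "Ck_on k S (\<lambda>x. prod (f x) (frechet_derivative g (at x) v) + prod (frechet_derivative f (at x) v) (g x))"
      using Suc.prems Suc.prems(2,3)[THEN Ck_on_Suc_imp] Suc.IH by (auto intro!: Ck_on_add[OF assms(1)])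
  qed
qed

lemma (in bounded_linear) Ck_on:
  assumes "open S" "Ck_on k S g"
  shows "Ck_on k S (\<lambda>x. f (g x))"
  using assms
proof (induction k arbitrary: g)
  case 0
  then show ?case by (auto intro: continuous_on)
next
  case (Suc k)
  show ?case
  proof (rule Ck_on_SucI[OF assms(1)])
    fix x assume "x \<in> S"
    then show "((\<lambda>x. f (g x)) has_derivative (\<lambda>v. f (frechet_derivative g (at x) v))) (at x)"
      using Suc.prems by (auto intro!: has_derivative simp: frechet_derivative_works[symmetric])
  qed (use Suc in auto)
qed

lemma Ck_on_ident: "open S \<Longrightarrow> Ck_on k S (\<lambda>x. x)"
  by (cases k) (auto intro!: Ck_on_SucI[where f'="\<lambda>x v. v"] Ck_on_const)

lemma linear_eq_sum_Basis:
  fixes L :: "'a::euclidean_space \<Rightarrow> 'b::real_vector"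
  assumes "linear L"
  shows "L v = (\<Sum>b\<in>Basis. (v \<bullet> b) *\<^sub>R L b)"
proof -
  interpret linear L by fact
  have "L v = L (\<Sum>b\<in>Basis. (v \<bullet> b) *\<^sub>R b)" by (simp add: euclidean_representation)
  then show ?thesis by (simp add: sum scaleR)
qed

text \<open>In the chain rule the differential of \<open>f\<close> is taken at a moving point and
  applied to a moving vector. Expanding that vector in \<open>Basis\<close> leaves coordinates of
  the derivative of \<open>g\<close> times derivatives of \<open>f\<close> in fixed directions,
  composed with \<open>g\<close>. The latter are covered by the induction hypothesis.\<close>

lemma Ck_on_compose:
  fixes g :: "'a::euclidean_space \<Rightarrow> 'b::euclidean_space" and f :: "'b \<Rightarrow> 'c::real_normed_vector"
  assumes "open S" "open T" "g ` S \<subseteq> T" "Ck_on k T f" "Ck_on k S g"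
  shows "Ck_on k S (\<lambda>x. f (g x))"
  using assms(4,5)
proof (induction k arbitrary: f)
  case 0
  then show ?case using assms(3) by (auto intro: continuous_on_compose2)
next
  case (Suc k)
  let ?Df = "\<lambda>x. frechet_derivative f (at x)" and ?Dg = "\<lambda>x. frechet_derivative g (at x)"
  show ?case
  proof (rule Ck_on_SucI[OF assms(1)])
    fix x assume x: "x \<in> S"
    have f: "(f has_derivative ?Df (g x)) (at (g x))"
      using Suc.prems assms(3) x by (auto simp: frechet_derivative_works[symmetric])
    have g: "(g has_derivative ?Dg x) (at x)"
      using Suc.prems x by (auto simp: frechet_derivative_works[symmetric])
    have "?Df (g x) (?Dg x v) = (\<Sum>b\<in>Basis. (?Dg x v \<bullet> b) *\<^sub>R ?Df (g x) b)" for v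
      by (rule linear_eq_sum_Basis[OF has_derivative_linear[OF f]])
    then show "((\<lambda>x. f (g x)) has_derivative (\<lambda>v. \<Sum>b\<in>Basis. (?Dg x v \<bullet> b) *\<^sub>R ?Df (g x) b)) (at x)"
      using has_derivative_compose[OF g f] by simp
  next
    fix v
    have "Ck_on k S (\<lambda>x. ?Df (g x) b)" for b
      using Suc.prems Ck_on_Suc_imp[OF Suc.prems(2)] by (intro Suc.IH) auto
    then show "Ck_on k S (\<lambda>x. \<Sum>b\<in>Basis. (?Dg x v \<bullet> b) *\<^sub>R ?Df (g x) b)"
      using Suc.prems(2)
      by (auto intro!: Ck_on_sum bounded_bilinear.Ck_on[OF bounded_bilinear_scaleR]
          bounded_linear.Ck_on[OF bounded_linear_inner_left] assms(1))
  qed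
qed

lemma Ck_on_inverse:
  fixes f :: "'a::euclidean_space \<Rightarrow> 'b::real_normed_field"
  assumes "open S" "Ck_on k S f" "\<And>x. x \<in> S \<Longrightarrow> f x \<noteq> 0"
  shows "Ck_on k S (\<lambda>x. inverse (f x))"
  using assms(2)
proof (induction k)
  case 0
  then show ?case using assms(3) by (auto intro: continuous_intros)
next
  case (Suc k)
  show ?case
  proof (rule Ck_on_SucI[OF assms(1)])
    fix x assume x: "x \<in> S"
    have "(f has_derivative frechet_derivative f (at x)) (at x)"
      using Suc.prems x by (auto simp: frechet_derivative_works[symmetric])
    from Deriv.has_derivative_inverse[OF assms(3)[OF x] this]
    show "((\<lambda>x. inverse (f x)) has_derivative
      (\<lambda>v. (- 1) * ((inverse (f x) * frechet_derivative f (at x) v) * inverse (f x)))) (at x)"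
      by simp
  next
    fix v show "Ck_on k S (\<lambda>x. (- 1) * ((inverse (f x) * frechet_derivative f (at x) v) * inverse (f x)))"
      using Suc.prems Suc.IH[OF Ck_on_Suc_imp[OF Suc.prems]]
      by (intro bounded_bilinear.Ck_on[OF bounded_bilinear_mult] assms(1) Ck_on_const) auto
  qed
qed

lemma Ck_on_exp:
  fixes f :: "'a::euclidean_space \<Rightarrow> complex"
  assumes "open S" "Ck_on k S f"
  shows "Ck_on k S (\<lambda>x. exp (f x))"
  using assms(2)
proof (induction k)
  case 0
  then show ?case by (auto intro: continuous_intros)
next
  case (Suc k)
  show ?case
  proof (rule Ck_on_SucI[OF assms(1)])
    fix x assume x: "x \<in> S"
    have f: "(f has_derivative frechet_derivative f (at x)) (at x)"
      using Suc.prems x by (auto simp: frechet_derivative_works[symmetric])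
    have "(exp has_derivative (*) (exp (f x))) (at (f x))"
      using DERIV_exp[of "f x"] by (simp add: has_field_derivative_def)
    from has_derivative_compose[OF f this]
    show "((\<lambda>x. exp (f x)) has_derivative (\<lambda>v. exp (f x) * frechet_derivative f (at x) v)) (at x)" .
  next
    fix v show "Ck_on k S (\<lambda>x. exp (f x) * frechet_derivative f (at x) v)"
      using Suc.prems Suc.IH[OF Ck_on_Suc_imp[OF Suc.prems]]
      by (intro bounded_bilinear.Ck_on[OF bounded_bilinear_mult] assms(1)) auto
  qed
qed

section \<open>The same closure properties for smooth maps\<close>

lemma smooth_on_cong:
  "open S \<Longrightarrow> (\<And>x. x \<in> S \<Longrightarrow> f x = g x) \<Longrightarrow> smooth_on S f \<Longrightarrow> smooth_on S g"
  unfolding smooth_on_def by (blast intro: Ck_on_cong)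

lemma smooth_on_subset: "smooth_on S f \<Longrightarrow> T \<subseteq> S \<Longrightarrow> smooth_on T f"
  unfolding smooth_on_def by (blast intro: Ck_on_subset)

lemma smooth_on_Un:
  "open S \<Longrightarrow> open T \<Longrightarrow> smooth_on S f \<Longrightarrow> smooth_on T f \<Longrightarrow> smooth_on (S \<union> T) f"
  unfolding smooth_on_def by (blast intro: Ck_on_Un)

lemma smooth_on_imp_continuous_on: "smooth_on S f \<Longrightarrow> continuous_on S f"
  unfolding smooth_on_def by (blast intro: Ck_on_imp_continuous_on)

lemma smooth_on_differentiable: "smooth_on S f \<Longrightarrow> x \<in> S \<Longrightarrow> f differentiable (at x)"
  unfolding smooth_on_def by (metis Ck_on.simps(2))

lemma smooth_on_has_derivative:
  "smooth_on S f \<Longrightarrow> x \<in> S \<Longrightarrow> (f has_derivative frechet_derivative f (at x)) (at x)"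
  by (metis smooth_on_differentiable frechet_derivative_works)

lemma smooth_on_frechet_derivative:
  "smooth_on S f \<Longrightarrow> smooth_on S (\<lambda>x. frechet_derivative f (at x) v)"
  unfolding smooth_on_def by (metis Ck_on.simps(2))

lemma smooth_onI_derivative:
  assumes "open S" "\<And>x. x \<in> S \<Longrightarrow> (f has_derivative f' x) (at x)" "\<And>v. smooth_on S (\<lambda>x. f' x v)"
  shows "smooth_on S f"
  using assms unfolding smooth_on_def by (blast intro: Ck_on_SucI Ck_on_Suc_imp)

lemma smooth_on_const: "smooth_on S (\<lambda>x. c)"
  by (simp add: smooth_on_def Ck_on_const)

lemma smooth_on_ident: "open S \<Longrightarrow> smooth_on S (\<lambda>x. x)"
  by (simp add: smooth_on_def Ck_on_ident)

lemma smooth_on_add: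
  "open S \<Longrightarrow> smooth_on S f \<Longrightarrow> smooth_on S g \<Longrightarrow> smooth_on S (\<lambda>x. f x + g x)"
  by (simp add: smooth_on_def Ck_on_add)

lemma smooth_on_sum:
  "open S \<Longrightarrow> (\<And>i. i \<in> I \<Longrightarrow> smooth_on S (f i)) \<Longrightarrow> smooth_on S (\<lambda>x. \<Sum>i\<in>I. f i x)"
  by (simp add: smooth_on_def Ck_on_sum)

lemma (in bounded_bilinear) smooth_on:
  "open S \<Longrightarrow> smooth_on S f \<Longrightarrow> smooth_on S g \<Longrightarrow> smooth_on S (\<lambda>x. prod (f x) (g x))"
  by (simp add: smooth_on_def Ck_on)

lemma (in bounded_linear) smooth_on:
  "open S \<Longrightarrow> smooth_on S g \<Longrightarrow> smooth_on S (\<lambda>x. f (g x))"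
  by (simp add: smooth_on_def Ck_on)

lemmas smooth_on_mult = bounded_bilinear.smooth_on[OF bounded_bilinear_mult]
lemmas smooth_on_inner = bounded_bilinear.smooth_on[OF bounded_bilinear_inner]
lemmas smooth_on_Re = bounded_linear.smooth_on[OF bounded_linear_Re]
lemmas smooth_on_Im = bounded_linear.smooth_on[OF bounded_linear_Im]
lemmas smooth_on_of_real = bounded_linear.smooth_on[OF bounded_linear_of_real]
lemmas smooth_on_minus = bounded_linear.smooth_on[OF bounded_linear_minus[OF bounded_linear_ident]]

lemma smooth_on_diff:
  assumes "open S" "smooth_on S f" "smooth_on S g"
  shows "smooth_on S (\<lambda>x. f x - g x)"
  using smooth_on_add[OF assms(1,2) smooth_on_minus[OF assms(1,3)]] by simp

lemma smooth_on_compose: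
  fixes g :: "'a::euclidean_space \<Rightarrow> 'b::euclidean_space" and f :: "'b \<Rightarrow> 'c::real_normed_vector"
  assumes "open S" "open T" "g ` S \<subseteq> T" "smooth_on T f" "smooth_on S g"
  shows "smooth_on S (\<lambda>x. f (g x))"
  using assms by (simp add: smooth_on_def Ck_on_compose)

lemma smooth_on_inverse:
  fixes f :: "'a::euclidean_space \<Rightarrow> 'b::real_normed_field"
  assumes "open S" "smooth_on S f" "\<And>x. x \<in> S \<Longrightarrow> f x \<noteq> 0"
  shows "smooth_on S (\<lambda>x. inverse (f x))"
  using assms by (simp add: smooth_on_def Ck_on_inverse)

lemma smooth_on_divide:
  fixes f :: "'a::euclidean_space \<Rightarrow> 'b::real_normed_field"
  assumes "open S" "smooth_on S f" "smooth_on S g" "\<And>x. x \<in> S \<Longrightarrow> g x \<noteq> 0"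
  shows "smooth_on S (\<lambda>x. f x / g x)"
  unfolding divide_inverse using assms by (intro smooth_on_mult smooth_on_inverse)

lemma smooth_on_exp:
  fixes f :: "'a::euclidean_space \<Rightarrow> complex"
  assumes "open S" "smooth_on S f"
  shows "smooth_on S (\<lambda>x. exp (f x))"
  using assms by (simp add: smooth_on_def Ck_on_exp)

section \<open>Symmetry of second derivatives\<close>

lemma mixed_difference_mean_value:
  fixes f :: "'a::real_normed_vector \<Rightarrow> real"
  assumes d: "d > 0" and S: "\<And>s t. 0 \<le> s \<Longrightarrow> s \<le> d \<Longrightarrow> 0 \<le> t \<Longrightarrow> t \<le> d \<Longrightarrow> x + s *\<^sub>R u + t *\<^sub>R v \<in> S"
    and f: "\<And>y. y \<in> S \<Longrightarrow> (f has_derivative f' y) (at y)"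
    and f': "\<And>y. y \<in> S \<Longrightarrow> ((\<lambda>y. f' y u) has_derivative f'' y) (at y)"
  shows "\<exists>s t. 0 < s \<and> s < d \<and> 0 < t \<and> t < d \<and>
    f (x + d *\<^sub>R u + d *\<^sub>R v) - f (x + d *\<^sub>R u) - f (x + d *\<^sub>R v) + f x
      = d * (d * f'' (x + s *\<^sub>R u + t *\<^sub>R v) v)"
proof -
  \<comment> \<open>\<open>p d - p 0\<close> is the second difference of \<open>f\<close> over a
    parallelogram. The mean value theorem is used on it along \<open>u\<close>, and afterwards along
    \<open>v\<close> on the directional derivative that it produces.\<close>
  define p where "p s = f (x + s *\<^sub>R u + d *\<^sub>R v) - f (x + s *\<^sub>R u)" for s
  have "(p has_derivative (\<lambda>h. h * (f' (x + s *\<^sub>R u + d *\<^sub>R v) u - f' (x + s *\<^sub>R u) u))) (at s)"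
    if "0 \<le> s" "s \<le> d" for s
  proof -
    have m: "x + s *\<^sub>R u + d *\<^sub>R v \<in> S" "x + s *\<^sub>R u \<in> S"
      using S[OF that, of d] S[OF that, of 0] d by auto
    have 1: "((\<lambda>s. f (x + s *\<^sub>R u + d *\<^sub>R v)) has_derivative (\<lambda>h. f' (x + s *\<^sub>R u + d *\<^sub>R v) (h *\<^sub>R u))) (at s)"
      by (rule has_derivative_compose[where g=f and f="\<lambda>s. x + s *\<^sub>R u + d *\<^sub>R v", OF _ f[OF m(1)]]) (auto intro!: derivative_eq_intros)
    have 2: "((\<lambda>s. f (x + s *\<^sub>R u)) has_derivative (\<lambda>h. f' (x + s *\<^sub>R u) (h *\<^sub>R u))) (at s)"
      by (rule has_derivative_compose[where g=f and f="\<lambda>s. x + s *\<^sub>R u", OF _ f[OF m(2)]]) (auto intro!: derivative_eq_intros)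
    have l: "linear (f' (x + s *\<^sub>R u + d *\<^sub>R v))" "linear (f' (x + s *\<^sub>R u))"
      using f m has_derivative_linear by blast+
    show ?thesis
      unfolding p_def using has_derivative_diff[OF 1 2]
      by (simp add: linear_scale[OF l(1)] linear_scale[OF l(2)] right_diff_distrib)
  qed
  then have "\<exists>s. 0 < s \<and> s < d \<and> p d - p 0 = (d - 0) * (f' (x + s *\<^sub>R u + d *\<^sub>R v) u - f' (x + s *\<^sub>R u) u)"
    using d by (intro MVT2) (auto simp: has_field_derivative_def mult.commute[of _ "f' _ _ - f' _ _"] )
  then obtain s where s: "0 < s" "s < d"
    "p d - p 0 = d * (f' (x + s *\<^sub>R u + d *\<^sub>R v) u - f' (x + s *\<^sub>R u) u)" by auto
  define q where "q t = f' (x + s *\<^sub>R u + t *\<^sub>R v) u" for t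
  have "(q has_derivative (\<lambda>h. h * f'' (x + s *\<^sub>R u + t *\<^sub>R v) v)) (at t)" if "0 \<le> t" "t \<le> d" for t
  proof -
    have m: "x + s *\<^sub>R u + t *\<^sub>R v \<in> S" using S that s by auto
    have 1: "(q has_derivative (\<lambda>h. f'' (x + s *\<^sub>R u + t *\<^sub>R v) (h *\<^sub>R v))) (at t)"
      unfolding q_def by (rule has_derivative_compose[where g="\<lambda>y. f' y u" and f="\<lambda>t. x + s *\<^sub>R u + t *\<^sub>R v", OF _ f'[OF m]]) (auto intro!: derivative_eq_intros)
    have "linear (f'' (x + s *\<^sub>R u + t *\<^sub>R v))"
      using f' m has_derivative_linear by blast
    with 1 show ?thesis by (simp add: linear_scale)
  qed
  then have "\<exists>t. 0 < t \<and> t < d \<and> q d - q 0 = (d - 0) * f'' (x + s *\<^sub>R u + t *\<^sub>R v) v"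
    using d by (intro MVT2) (auto simp: has_field_derivative_def mult.commute[of _ "f'' _ _"])
  then obtain t where t: "0 < t" "t < d" "q d - q 0 = d * f'' (x + s *\<^sub>R u + t *\<^sub>R v) v" by auto
  have "f (x + d *\<^sub>R u + d *\<^sub>R v) - f (x + d *\<^sub>R u) - f (x + d *\<^sub>R v) + f x = p d - p 0"
    by (simp add: p_def)
  also have "\<dots> = d * (q d - q 0)" using s by (simp add: q_def)
  finally show ?thesis using s t by (intro exI[of _ s] exI[of _ t]) simp
qed

text \<open>The second difference over a small parallelogram is symmetric in \<open>u\<close> and
  \<open>v\<close>. It equals \<open>d * d\<close> times a value near \<open>x\<close> of either
  mixed derivative, so a value of one near \<open>x\<close> equals a value of the other near
  \<open>x\<close>, and continuity forces equality at \<open>x\<close>.\<close>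

lemma frechet_derivative_commute_real:
  fixes f :: "'a::euclidean_space \<Rightarrow> real"
  assumes "open S" "x \<in> S" "Ck_on 2 S f"
  shows "frechet_derivative (\<lambda>y. frechet_derivative f (at y) u) (at x) v
       = frechet_derivative (\<lambda>y. frechet_derivative f (at y) v) (at x) u" (is "?A u v x = ?A v u x")
proof (rule ccontr)
  assume ne: "?A u v x \<noteq> ?A v u x"
  define e where "e = dist (?A u v x) (?A v u x) / 2"
  have e: "e > 0" using ne by (simp add: e_def)
  have C: "Ck_on (Suc (Suc 0)) S f" using assms(3) by (simp add: numeral_2_eq_2)
  have cont: "continuous_on S (?A u v)" for u v using C by simp
  have ev: "\<forall>\<^sub>F y in nhds x. dist (?A u v y) (?A u v x) < e" for u v
  proof -
    have "isCont (?A u v) x" using cont assms(1,2) continuous_on_eq_continuous_at by blast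
    then have "(?A u v \<longlongrightarrow> ?A u v x) (nhds x)"
      unfolding isCont_def by (subst (asm) tendsto_at_iff_tendsto_nhds)
    then show ?thesis using e by (rule tendstoD)
  qed
  have "\<forall>\<^sub>F y in nhds x. y \<in> S \<and> dist (?A u v y) (?A u v x) < e \<and> dist (?A v u y) (?A v u x) < e"
    using ev assms(1,2) by (intro eventually_conj eventually_nhds_in_open)
  then obtain r where r: "r > 0" "\<And>y. dist y x < r \<Longrightarrow> y \<in> S"
    "\<And>y. dist y x < r \<Longrightarrow> dist (?A u v y) (?A u v x) < e"
    "\<And>y. dist y x < r \<Longrightarrow> dist (?A v u y) (?A v u x) < e"
    by (auto simp: eventually_nhds_metric)
  \<comment> \<open>Chosen so that the whole parallelogram stays within \<open>r / 2\<close> of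
    \<open>x\<close>; the summand 1 keeps the denominator positive when \<open>u\<close> and
    \<open>v\<close> vanish.\<close>
  define d where "d = r / (2 * (norm u + norm v + 1))"
  have nn: "norm u + norm v + 1 > 0" by (simp add: add_nonneg_pos)
  have d: "d > 0" unfolding d_def using r(1) nn by simp
  have near: "dist (x + s *\<^sub>R u' + t *\<^sub>R v') x < r"
    if "0 \<le> s" "s \<le> d" "0 \<le> t" "t \<le> d" "norm u' + norm v' = norm u + norm v" for s t u' v'
  proof -
    have "dist (x + s *\<^sub>R u' + t *\<^sub>R v') x \<le> s * norm u' + t * norm v'"
      using norm_triangle_ineq[of "s *\<^sub>R u'" "t *\<^sub>R v'"] that by (simp add: dist_norm add.assoc)
    also have "\<dots> \<le> d * norm u' + d * norm v'"
      using that by (intro add_mono mult_right_mono) auto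
    also have "\<dots> = d * (norm u + norm v)" using that by (simp flip: distrib_left)
    also have "\<dots> \<le> d * (norm u + norm v + 1)" using d by simp
    also have "\<dots> = r / 2" unfolding d_def using nn by (simp add: field_simps)
    finally show ?thesis using r(1) by simp
  qed
  have df: "(f has_derivative frechet_derivative f (at y)) (at y)" if "y \<in> S" for y
    using C that by (simp add: frechet_derivative_works[symmetric])
  have ddf: "((\<lambda>y. frechet_derivative f (at y) u) has_derivative frechet_derivative (\<lambda>y. frechet_derivative f (at y) u) (at y)) (at y)"
    if "y \<in> S" for y u using C that by (simp add: frechet_derivative_works[symmetric])
  have mv: "\<exists>s t. 0 < s \<and> s < d \<and> 0 < t \<and> t < d \<and>
      f (x + d *\<^sub>R u' + d *\<^sub>R v') - f (x + d *\<^sub>R u') - f (x + d *\<^sub>R v') + f x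
        = d * (d * ?A u' v' (x + s *\<^sub>R u' + t *\<^sub>R v'))"
    if "norm u' + norm v' = norm u + norm v" for u' v'
    by (rule mixed_difference_mean_value[OF d _ df ddf]) (use near r(2) that in auto)
  obtain s t where st: "0 < s" "s < d" "0 < t" "t < d"
    "f (x + d *\<^sub>R u + d *\<^sub>R v) - f (x + d *\<^sub>R u) - f (x + d *\<^sub>R v) + f x
      = d * (d * ?A u v (x + s *\<^sub>R u + t *\<^sub>R v))"
    using mv[of u v] by blast
  obtain s' t' where st': "0 < s'" "s' < d" "0 < t'" "t' < d"
    "f (x + d *\<^sub>R v + d *\<^sub>R u) - f (x + d *\<^sub>R v) - f (x + d *\<^sub>R u) + f x
      = d * (d * ?A v u (x + s' *\<^sub>R v + t' *\<^sub>R u))"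
    using mv[of v u] by (auto simp: add.commute)
  have "?A u v (x + s *\<^sub>R u + t *\<^sub>R v) = ?A v u (x + s' *\<^sub>R v + t' *\<^sub>R u)"
    using st(5) st'(5) d by (simp add: algebra_simps)
  moreover have "dist (?A u v (x + s *\<^sub>R u + t *\<^sub>R v)) (?A u v x) < e"
    by (rule r(3)) (use near st in auto)
  moreover have "dist (?A v u (x + s' *\<^sub>R v + t' *\<^sub>R u)) (?A v u x) < e"
    by (rule r(4)) (use near[of _ _ v u] st' in auto)
  ultimately show False unfolding e_def by (metis dist_triangle_half_r less_irrefl)
qed

lemma frechet_derivative_commute:
  fixes f :: "'a::euclidean_space \<Rightarrow> 'b::euclidean_space"
  assumes "open S" "x \<in> S" "smooth_on S f"
  shows "frechet_derivative (\<lambda>y. frechet_derivative f (at y) u) (at x) v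
       = frechet_derivative (\<lambda>y. frechet_derivative f (at y) v) (at x) u"
proof (rule euclidean_eqI)
  fix b :: 'b assume "b \<in> Basis"
  have 1: "frechet_derivative (\<lambda>y. g y \<bullet> b) (at z) w = frechet_derivative g (at z) w \<bullet> b"
    if "g differentiable (at z)" for g :: "'a \<Rightarrow> 'b" and z w
    by (metis (mono_tags) that frechet_derivative_at frechet_derivative_works has_derivative_inner_left)
  have 2: "frechet_derivative (\<lambda>y. frechet_derivative (\<lambda>y. f y \<bullet> b) (at y) u) (at x) v
      = frechet_derivative (\<lambda>y. frechet_derivative f (at y) u) (at x) v \<bullet> b" for u v
  proof -
    have "frechet_derivative (\<lambda>y. frechet_derivative (\<lambda>y. f y \<bullet> b) (at y) u) (at x)
        = frechet_derivative (\<lambda>y. frechet_derivative f (at y) u \<bullet> b) (at x)"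
      by (rule frechet_derivative_cong_open[OF assms(1,2)])
         (use assms 1 smooth_on_differentiable in blast)
    then show ?thesis
      using 1 smooth_on_differentiable[OF smooth_on_frechet_derivative[OF assms(3)] assms(2)] by simp
  qed
  have "Ck_on 2 S (\<lambda>y. f y \<bullet> b)"
    using bounded_linear.smooth_on[OF bounded_linear_inner_left assms(1,3)] by (simp add: smooth_on_def)
  from frechet_derivative_commute_real[OF assms(1,2) this, of u v]
  show "frechet_derivative (\<lambda>y. frechet_derivative f (at y) u) (at x) v \<bullet> b
       = frechet_derivative (\<lambda>y. frechet_derivative f (at y) v) (at x) u \<bullet> b"
    by (simp add: 2)
qed

section \<open>Bump functions and primitives of closed 1-forms\<close>

text \<open>The index makes the family closed under differentiation up to linear combinations: the
  derivative of member \<open>n\<close> involves members \<open>n + 1\<close> and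
  \<open>n + 2\<close> only. Smoothness of the usual flat function, member 0, then follows by
  induction on the order, for all members at once.\<close>

definition flat_exp :: "nat \<Rightarrow> real \<Rightarrow> real" where
  "flat_exp n t = (if t > 0 then inverse t ^ n * exp (- inverse t) else 0)"

lemma flat_exp_tendsto_0: "(flat_exp n \<longlongrightarrow> 0) (at 0)"
proof -
  have "((\<lambda>x::real. x ^ n / exp x) \<longlongrightarrow> 0) at_top" by (rule tendsto_power_div_exp_0)
  then have "((\<lambda>t. inverse t ^ n / exp (inverse t)) \<longlongrightarrow> 0) (at_right (0::real))"
    by (rule filterlim_compose[OF _ filterlim_inverse_at_top_right])
  then have "(flat_exp n \<longlongrightarrow> 0) (at_right 0)"
    by (rule Lim_transform_eventually)
       (auto simp: flat_exp_def exp_minus divide_inverse eventually_at_filter)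
  moreover have "(flat_exp n \<longlongrightarrow> 0) (at_left 0)"
    by (rule tendsto_eventually) (auto simp: flat_exp_def eventually_at_filter)
  ultimately show ?thesis by (simp add: filterlim_split_at)
qed

lemma flat_exp_has_derivative:
  "(flat_exp n has_real_derivative flat_exp (n + 2) t - n * flat_exp (n + 1) t) (at t)"
proof -
  consider "t > 0" | "t < 0" | "t = 0" by linarith
  then show ?thesis
  proof cases
    case 1
    have "((\<lambda>t. inverse t ^ n * exp (- inverse t)) has_real_derivative
      flat_exp (n + 2) t - n * flat_exp (n + 1) t) (at t)"
    proof -
      have "((\<lambda>t. inverse t ^ n) has_real_derivative - (real n * inverse t ^ Suc n)) (at t)" for n
      proof (induction n)
        case (Suc n)
        have "((\<lambda>t. inverse t * inverse t ^ n) has_real_derivative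
            inverse t * - (real n * inverse t ^ Suc n) + - (inverse t ^ Suc (Suc 0)) * inverse t ^ n) (at t)"
          using 1 by (intro DERIV_mult' Suc DERIV_inverse) auto
        then show ?case by (simp add: algebra_simps)
      qed simp
      moreover have "((\<lambda>t. exp (- inverse t)) has_real_derivative exp (- inverse t) * inverse t ^ 2) (at t)"
        using 1 by (auto intro!: derivative_eq_intros simp: power2_eq_square)
      ultimately have "((\<lambda>t. inverse t ^ n * exp (- inverse t)) has_real_derivative
          inverse t ^ n * (exp (- inverse t) * inverse t ^ 2) + - (real n * inverse t ^ Suc n) * exp (- inverse t)) (at t)"
        by (rule DERIV_mult')
      then show ?thesis
        using 1 by (simp add: flat_exp_def algebra_simps power2_eq_square)
    qed
    then show ?thesis
      by (rule DERIV_cong_ev[OF refl _ refl, THEN iffD1, rotated])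
         (use 1 in \<open>auto simp: flat_exp_def intro!: eventually_mono[OF eventually_nhds_in_open[of "{0<..}"]]\<close>)
  next
    case 2
    have "((\<lambda>t. 0) has_real_derivative flat_exp (n + 2) t - n * flat_exp (n + 1) t) (at t)"
      using 2 by (auto simp: flat_exp_def)
    then show ?thesis
      by (rule DERIV_cong_ev[OF refl _ refl, THEN iffD1, rotated])
         (use 2 in \<open>auto simp: flat_exp_def intro!: eventually_mono[OF eventually_nhds_in_open[of "{..<0}"]]\<close>)
  next
    case 3
    \<comment> \<open>The difference quotient at 0 is the next member of the family, whose limit at
      0 is known.\<close>
    have "((\<lambda>h. (flat_exp n (0 + h) - flat_exp n 0) / h) \<longlongrightarrow> 0) (at 0)"
      by (rule Lim_transform_eventually[OF flat_exp_tendsto_0[of "Suc n"]])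
         (auto simp: flat_exp_def eventually_at_filter divide_inverse)
    then show ?thesis using 3 by (simp add: flat_exp_def DERIV_def)
  qed
qed

lemma Ck_on_flat_exp: "Ck_on k UNIV (flat_exp n)"
proof (induction k arbitrary: n)
  case 0
  show ?case
    by (auto intro!: continuous_at_imp_continuous_on DERIV_isCont flat_exp_has_derivative)
next
  case (Suc k)
  show ?case
  proof (rule Ck_on_SucI)
    show "(flat_exp n has_derivative (\<lambda>v. v * (flat_exp (n + 2) t + (- real n) * flat_exp (n + 1) t))) (at t)" for t
      by (rule has_derivative_eq_rhs[OF flat_exp_has_derivative[unfolded has_field_derivative_def]])
         (simp add: fun_eq_iff mult.commute)
    show "Ck_on k UNIV (\<lambda>t. v * (flat_exp (n + 2) t + (- real n) * flat_exp (n + 1) t))" for v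
      using Suc by (intro bounded_bilinear.Ck_on[OF bounded_bilinear_mult] Ck_on_const Ck_on_add) auto
  qed simp
qed

text \<open>Only the squared distance enters, so no smoothness is lost at the centre.\<close>

definition ball_bump :: "'a::euclidean_space \<Rightarrow> real \<Rightarrow> 'a \<Rightarrow> real" where
  "ball_bump a r x = flat_exp 0 (r\<^sup>2 - (x - a) \<bullet> (x - a))"

lemma smooth_on_ball_bump: "smooth_on UNIV (ball_bump a r)"
  unfolding ball_bump_def
  by (rule smooth_on_compose[where T=UNIV and f="flat_exp 0"])
     (auto simp: smooth_on_def[of _ "flat_exp 0"] Ck_on_flat_exp
       intro!: smooth_on_diff smooth_on_const smooth_on_inner smooth_on_ident)

lemma ball_bump_nonneg: "ball_bump a r x \<ge> 0"
  by (simp add: ball_bump_def flat_exp_def)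

lemma ball_bump_pos_iff: "r > 0 \<Longrightarrow> ball_bump a r x > 0 \<longleftrightarrow> x \<in> ball a r"
proof -
  assume "r > 0"
  then have "(x - a) \<bullet> (x - a) < r\<^sup>2 \<longleftrightarrow> dist a x < r"
    by (metis dist_norm norm_minus_commute norm_lt_square)
  then show ?thesis by (simp add: ball_bump_def flat_exp_def)
qed

section \<open>Linear maps depending on a point, and the Poincare lemma\<close>

lemma frechet_derivative_linear_slot:
  fixes \<theta> :: "'a::euclidean_space \<Rightarrow> 'c::euclidean_space \<Rightarrow> 'b::real_normed_vector"
  assumes "open S" "x \<in> S" "\<And>y. y \<in> S \<Longrightarrow> linear (\<theta> y)"
    and "\<And>v. (\<lambda>y. \<theta> y v) differentiable (at x)"
  shows "linear (\<lambda>w. frechet_derivative (\<lambda>y. \<theta> y w) (at x) v)"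
proof (rule linearI)
  fix w w' :: 'c and r :: real
  have d: "((\<lambda>y. \<theta> y w) has_derivative frechet_derivative (\<lambda>y. \<theta> y w) (at x)) (at x)" for w
    using assms(4) frechet_derivative_works by blast
  have "frechet_derivative (\<lambda>y. \<theta> y (w + w')) (at x) = frechet_derivative (\<lambda>y. \<theta> y w + \<theta> y w') (at x)"
    by (rule frechet_derivative_cong_open[OF assms(1,2)]) (use assms(3) linear_add in blast)
  also have "\<dots> = (\<lambda>v. frechet_derivative (\<lambda>y. \<theta> y w) (at x) v + frechet_derivative (\<lambda>y. \<theta> y w') (at x) v)"
    by (rule frechet_derivative_at[symmetric]) (intro has_derivative_add d)
  finally show "frechet_derivative (\<lambda>y. \<theta> y (w + w')) (at x) v
    = frechet_derivative (\<lambda>y. \<theta> y w) (at x) v + frechet_derivative (\<lambda>y. \<theta> y w') (at x) v" by simp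
  have "frechet_derivative (\<lambda>y. \<theta> y (r *\<^sub>R w)) (at x) = frechet_derivative (\<lambda>y. r *\<^sub>R \<theta> y w) (at x)"
    by (rule frechet_derivative_cong_open[OF assms(1,2)]) (use assms(3) linear_scale in blast)
  also have "\<dots> = (\<lambda>v. r *\<^sub>R frechet_derivative (\<lambda>y. \<theta> y w) (at x) v)"
    by (rule frechet_derivative_at[symmetric]) (intro has_derivative_scaleR_right d)
  finally show "frechet_derivative (\<lambda>y. \<theta> y (r *\<^sub>R w)) (at x) v
    = r *\<^sub>R frechet_derivative (\<lambda>y. \<theta> y w) (at x) v" by simp
qed

text \<open>A linear map is determined by its values on the finite \<open>Basis\<close>, so
  continuity for each fixed vector gives joint continuity in point and vector. This makes
  compactness of a ball times the unit sphere available for tensors.\<close>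

lemma continuous_on_linear_slot:
  fixes \<theta> :: "'x::topological_space \<Rightarrow> 'a::euclidean_space \<Rightarrow> 'b::real_normed_vector"
  assumes "\<And>x. x \<in> S \<Longrightarrow> linear (\<theta> x)" "\<And>v. continuous_on S (\<lambda>x. \<theta> x v)"
  shows "continuous_on (S \<times> UNIV) (\<lambda>p. \<theta> (fst p) (snd p))"
proof -
  have "\<theta> x v = (\<Sum>b\<in>Basis. (v \<bullet> b) *\<^sub>R \<theta> x b)" if "x \<in> S" for x v
    by (rule linear_eq_sum_Basis[OF assms(1)[OF that]])
  moreover have "continuous_on (S \<times> (UNIV :: 'a set)) (\<lambda>p. \<Sum>b\<in>Basis. (snd p \<bullet> b) *\<^sub>R \<theta> (fst p) b)"
    by (intro continuous_intros continuous_on_compose2[OF assms(2)]) auto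
  ultimately show ?thesis by (auto intro: continuous_on_eq)
qed

text \<open>Product rule for a linear map applied to a vector, both depending on the point. It
  serves the radial integrand of the Poincare lemma and pulled back 1-forms, where the vector is
  moved by the Jacobian.\<close>

lemma has_derivative_linear_slot:
  fixes B :: "'a::euclidean_space \<Rightarrow> 'c::euclidean_space \<Rightarrow> 'b::real_normed_vector"
  assumes "open S" "g x \<in> S" "\<And>y. y \<in> S \<Longrightarrow> linear (B y)"
    and B: "\<And>v. (\<lambda>y. B y v) differentiable (at (g x))"
    and g: "(g has_derivative g') (at x)" and w: "(w has_derivative w') (at x)"
  shows "((\<lambda>y. B (g y) (w y)) has_derivative
    (\<lambda>u. frechet_derivative (\<lambda>y. B y (w x)) (at (g x)) (g' u) + B (g x) (w' u))) (at x)"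
proof -
  let ?D = "\<lambda>b. frechet_derivative (\<lambda>y. B y b) (at (g x))"
  have "((\<lambda>y. B (g y) b) has_derivative (\<lambda>u. ?D b (g' u))) (at x)" for b
    using has_derivative_compose[OF g B[THEN frechet_derivative_works[THEN iffD1]]] .
  then have 1: "((\<lambda>y. \<Sum>b\<in>Basis. (w y \<bullet> b) *\<^sub>R B (g y) b) has_derivative
    (\<lambda>u. \<Sum>b\<in>Basis. (w x \<bullet> b) *\<^sub>R ?D b (g' u) + (w' u \<bullet> b) *\<^sub>R B (g x) b)) (at x)"
    by (intro has_derivative_sum has_derivative_scaleR has_derivative_inner_left w)
  have "linear (\<lambda>b. ?D b v)" for v
    by (rule frechet_derivative_linear_slot[OF assms(1,2,3) B])
  from linear_eq_sum_Basis[OF this] have 2: "?D v u = (\<Sum>b\<in>Basis. (v \<bullet> b) *\<^sub>R ?D b u)" for u v .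
  have "\<forall>\<^sub>F y in nhds x. g y \<in> S"
    using assms(1,2) has_derivative_continuous[OF g]
    by (metis isCont_def tendsto_at_iff_tendsto_nhds topological_tendstoD)
  then obtain T where T: "open T" "x \<in> T" "\<And>y. y \<in> T \<Longrightarrow> g y \<in> S"
    by (auto simp: eventually_nhds)
  show ?thesis
    unfolding 2[of "w x"] linear_eq_sum_Basis[OF assms(3)[OF assms(2)], of "w' _"] sum.distrib[symmetric]
    by (rule has_derivative_transform_within_open[OF 1 T(1,2)])
       (use linear_eq_sum_Basis[OF assms(3)] T(3) in simp)
qed

text \<open>The primitive is the integral of the form along the radius from the centre
  \<open>a\<close> to \<open>x\<close>. Differentiation under the integral sign gives an integrand
  which closedness identifies with the derivative in \<open>t\<close> of
  \<open>t * \<theta> (z x t) v\<close>, so the integral is its value at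
  \<open>t = 1\<close>.\<close>

lemma closed_form_has_primitive:
  fixes \<theta> :: "'a::euclidean_space \<Rightarrow> 'a \<Rightarrow> real"
  assumes lin: "\<And>x. x \<in> ball a r \<Longrightarrow> linear (\<theta> x)"
    and sm: "\<And>v. smooth_on (ball a r) (\<lambda>x. \<theta> x v)"
    and cl: "\<And>x u v. x \<in> ball a r \<Longrightarrow>
      frechet_derivative (\<lambda>y. \<theta> y u) (at x) v = frechet_derivative (\<lambda>y. \<theta> y v) (at x) u"
  shows "\<exists>f. \<forall>x\<in>ball a r. (f has_derivative \<theta> x) (at x)"
proof -
  let ?S = "ball a r"
  define z where "z x t = a + t *\<^sub>R (x - a)" for x and t :: real
  define D where "D w y v = frechet_derivative (\<lambda>y. \<theta> y w) (at y) v" for w y v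
  have zS: "z x t \<in> ?S" if "x \<in> ?S" "t \<in> {0..1}" for x t
  proof -
    have "z x t = (1 - t) *\<^sub>R a + t *\<^sub>R x" by (simp add: z_def algebra_simps)
    moreover have "r > 0" using that(1) le_less_trans[OF zero_le_dist[of a x]] by simp
    ultimately show ?thesis using that convexD_alt[OF convex_ball, of a a r x t] by auto
  qed
  have dD: "((\<lambda>y. \<theta> y w) has_derivative D w y) (at y)" if "y \<in> ?S" for w y
    unfolding D_def using smooth_on_has_derivative[OF sm that] .
  have linD: "linear (\<lambda>w. D w y v)" if "y \<in> ?S" for y v
    unfolding D_def
    by (rule frechet_derivative_linear_slot[OF open_ball that lin])
       (auto intro: smooth_on_differentiable[OF sm that])
  \<comment> \<open>Derivative of the radial integrand with respect to \<open>x\<close> in direction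
    \<open>v\<close>; the factor \<open>t\<close> comes from the dependence of \<open>z x t\<close>
    on \<open>x\<close>.\<close>
  define L where "L x t v = \<theta> (z x t) v + t * D (x - a) (z x t) v" for x t v
  define f where "f x = integral {0..1} (\<lambda>t. \<theta> (z x t) (x - a))" for x
  have blL: "bounded_linear (L x t)" if "x \<in> ?S" "t \<in> {0..1}" for x t
    unfolding L_def using lin[OF zS[OF that]] has_derivative_bounded_linear[OF dD[OF zS[OF that]]]
    by (auto intro!: bounded_linear_add bounded_linear_const_mult simp: linear_conv_bounded_linear)
  have fx: "((\<lambda>x. \<theta> (z x t) (x - a)) has_derivative L x t) (at x within ?S)" if x: "x \<in> ?S" "t \<in> {0..1}" for x t
  proof -
    have dz: "((\<lambda>x. z x t) has_derivative (\<lambda>v. t *\<^sub>R v)) (at x)"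
      and dw: "((\<lambda>x. x - a) has_derivative (\<lambda>v. v)) (at x)"
      unfolding z_def by (auto intro!: derivative_eq_intros)
    have "((\<lambda>x. \<theta> (z x t) (x - a)) has_derivative (\<lambda>v. D (x - a) (z x t) (t *\<^sub>R v) + \<theta> (z x t) v)) (at x)"
      unfolding D_def
      by (rule has_derivative_linear_slot[OF open_ball zS[OF x] lin _ dz dw])
         (auto intro: smooth_on_differentiable[OF sm zS[OF x]])
    moreover have "D (x - a) (z x t) (t *\<^sub>R v) = t * D (x - a) (z x t) v" for v
      using linear_scale[OF has_derivative_linear[OF dD[OF zS[OF x]]]] by simp
    ultimately show ?thesis
      unfolding L_def[abs_def] by (simp add: add.commute has_derivative_at_withinI)
  qed
  have contz: "continuous_on (?S \<times> {0..1}) (\<lambda>p. z (fst p) (snd p))"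
    unfolding z_def by (intro continuous_intros)
  have contT: "continuous_on (?S \<times> {0..1}) (\<lambda>p. \<theta> (z (fst p) (snd p)) v)" for v
    by (rule continuous_on_compose2[OF smooth_on_imp_continuous_on[OF sm] contz]) (use zS in force)
  have contD: "continuous_on (?S \<times> {0..1}) (\<lambda>p. D b (z (fst p) (snd p)) v)" for b v
    unfolding D_def
    by (rule continuous_on_compose2[OF smooth_on_imp_continuous_on[OF smooth_on_frechet_derivative[OF sm]] contz])
       (use zS in force)
  have contL: "continuous_on (?S \<times> {0..1}) (\<lambda>p. L (fst p) (snd p) v)" for v
  proof -
    have "continuous_on (?S \<times> {0..1}) (\<lambda>p. \<theta> (z (fst p) (snd p)) v
        + snd p * (\<Sum>b\<in>Basis. ((fst p - a) \<bullet> b) * D b (z (fst p) (snd p)) v))"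
      by (intro continuous_intros contT contD)
    then show ?thesis
      by (rule continuous_on_eq) (use linear_eq_sum_Basis[OF linD[OF zS]] in \<open>force simp: L_def\<close>)
  qed
  have seg: "continuous_on {0..1} (\<lambda>t. g (x, t))" if "continuous_on (?S \<times> {0..1}) g" "x \<in> ?S"
    for g :: "'a \<times> real \<Rightarrow> 'c::topological_space" and x
    by (rule continuous_on_compose2[OF that(1)]) (use that(2) in \<open>auto intro!: continuous_intros\<close>)
  have contf: "continuous_on {0..1} (\<lambda>t. \<theta> (z x t) (x - a))" if "x \<in> ?S" for x
    using seg[OF contT that, of "x - a"] by simp
  \<comment> \<open>\<open>leibniz_rule\<close> takes the derivative as a continuous family of
    bounded linear maps, so \<open>L\<close> is packaged as one.\<close>
  define BL where "BL x t = Blinfun (L x t)" for x t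
  have BL: "blinfun_apply (BL x t) = L x t" if "x \<in> ?S" "t \<in> {0..1}" for x t
    unfolding BL_def by (rule bounded_linear_Blinfun_apply[OF blL[OF that]])
  have contBL: "continuous_on (?S \<times> {0..1}) (\<lambda>p. BL (fst p) (snd p))"
  proof (rule continuous_on_blinfun_componentwise)
    fix i :: 'a
    show "continuous_on (?S \<times> {0..1}) (\<lambda>p. blinfun_apply (BL (fst p) (snd p)) i)"
      by (rule continuous_on_eq[OF contL[of i]]) (use BL in auto)
  qed
  have "(f has_derivative \<theta> x) (at x)" if x: "x \<in> ?S" for x
  proof -
    have "((\<lambda>x. integral (cbox 0 1) (\<lambda>t. \<theta> (z x t) (x - a))) has_derivative
        blinfun_apply (integral (cbox 0 1) (BL x))) (at x within ?S)"
    proof (rule leibniz_rule)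
      show "((\<lambda>x. \<theta> (z x t) (x - a)) has_derivative blinfun_apply (BL x t)) (at x within ?S)"
        if "x \<in> ?S" "t \<in> cbox 0 1" for x t using fx BL that by auto
      show "(\<lambda>t. \<theta> (z x t) (x - a)) integrable_on cbox 0 1" if "x \<in> ?S" for x
        using contf[OF that] integrable_continuous_interval by auto
      show "continuous_on (?S \<times> cbox 0 1) (\<lambda>(x, t). BL x t)"
        using contBL by (simp add: case_prod_beta)
    qed (use x in auto)
    moreover have "blinfun_apply (integral (cbox 0 1) (BL x)) v = \<theta> x v" for v
    proof -
      have "continuous_on {0..1} (BL x)" using seg[OF contBL x] by simp
      then have "blinfun_apply (integral (cbox 0 1) (BL x)) v = integral {0..1} (\<lambda>t. BL x t v)"
        by (subst blinfun_apply_integral) (auto intro: integrable_continuous_interval)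
      also have "\<dots> = integral {0..1} (\<lambda>t. L x t v)"
        by (rule integral_cong) (use BL x in auto)
      also have "((\<lambda>t. L x t v) has_integral (1 * \<theta> (z x 1) v - 0 * \<theta> (z x 0) v)) {0..1}"
      proof (rule fundamental_theorem_of_calculus)
        fix t :: real assume t: "t \<in> {0..1}"
        have dz: "((\<lambda>t. z x t) has_derivative (\<lambda>h. h *\<^sub>R (x - a))) (at t)"
          unfolding z_def by (auto intro!: derivative_eq_intros)
        have "((\<lambda>t. \<theta> (z x t) v) has_derivative (\<lambda>h. D v (z x t) (h *\<^sub>R (x - a)))) (at t)"
          by (rule has_derivative_compose[OF dz dD[OF zS[OF x t]]])
        then have "((\<lambda>t. \<theta> (z x t) v) has_real_derivative D v (z x t) (x - a)) (at t)"
          using linear_scale[OF has_derivative_linear[OF dD[OF zS[OF x t]]]]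
          by (simp add: has_field_derivative_def mult.commute[of "D _ _ _"] fun_eq_iff mult_commute_abs)
        then have "((\<lambda>t. t * \<theta> (z x t) v) has_real_derivative
            t * D v (z x t) (x - a) + 1 * \<theta> (z x t) v) (at t)"
          by (intro DERIV_mult') auto
        \<comment> \<open>Closedness enters here: it exchanges the direction of differentiation with
          the argument of the form.\<close>
        moreover have "D v (z x t) (x - a) = D (x - a) (z x t) v"
          unfolding D_def by (rule cl[OF zS[OF x t]])
        ultimately show "((\<lambda>t. t * \<theta> (z x t) v) has_vector_derivative L x t v) (at t within {0..1})"
          unfolding L_def
          by (auto intro!: has_vector_derivative_at_within simp: add.commute has_real_derivative_iff_has_vector_derivative)
      qed simp
      then have "integral {0..1} (\<lambda>t. L x t v) = \<theta> (z x 1) v" by (simp add: integral_unique)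
      finally show ?thesis by (simp add: z_def)
    qed
    ultimately show ?thesis
      using x unfolding f_def by (simp add: at_within_open[OF x open_ball] blinfun_apply_inverse)
        (metis (no_types, lifting) ext)
  qed
  then show ?thesis by blast
qed

section \<open>Twisted derivatives in a coordinate domain\<close>

lemma linear_imaginary_smult: "linear (\<lambda>v::complex^'n. \<i> *s v)"
  by (rule linearI) (auto simp: vec_eq_iff algebra_simps)

lemma imaginary_smult_smult [simp]: "\<i> *s (\<i> *s v) = - (v::complex^'n)"
  by (simp add: vec_eq_iff)

lemma imaginary_smult_add: "\<i> *s (u + v) = \<i> *s u + \<i> *s (v::complex^'n)"
  by (simp add: vec_eq_iff algebra_simps)

lemma imaginary_smult_scaleR: "\<i> *s (r *\<^sub>R v) = r *\<^sub>R (\<i> *s (v::complex^'n))"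
  by (simp add: vec_eq_iff)

lemma norm_imaginary_smult [simp]: "norm (\<i> *s (v::complex^'n)) = norm v"
  by (simp add: norm_vec_def norm_mult)

text \<open>\<^term>\<open>tw t u\<close> is the derivation \<open>D\<^sub>u - t(u)\<close>; \<^term>\<open>twc (-1) t u\<close> and \<^term>\<open>twc 1 t u\<close> are its parts of
  type (1,0) and (0,1).\<close>

definition tw :: "(complex^'n::finite \<Rightarrow> complex^'n \<Rightarrow> complex) \<Rightarrow> complex^'n \<Rightarrow>
    (complex^'n \<Rightarrow> complex) \<Rightarrow> complex^'n \<Rightarrow> complex" where
  "tw t u h x = dir_d h x u - t x u * h x"

definition twc :: "complex \<Rightarrow> (complex^'n::finite \<Rightarrow> complex^'n \<Rightarrow> complex) \<Rightarrow> complex^'n \<Rightarrow>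
    (complex^'n \<Rightarrow> complex) \<Rightarrow> complex^'n \<Rightarrow> complex" where
  "twc s t u h x = (tw t u h x + s * \<i> * tw t (\<i> *s u) h x) / 2"

lemma tw_cong:
  assumes "open S" "x \<in> S" "\<And>y. y \<in> S \<Longrightarrow> h y = k y"
  shows "tw t u h x = tw t u k x"
  using frechet_derivative_cong_open[OF assms] assms(2,3) by (simp add: tw_def dir_d_def)

lemma twc_cong:
  assumes "open S" "x \<in> S" "\<And>y. y \<in> S \<Longrightarrow> h y = k y"
  shows "twc s t u h x = twc s t u k x"
  using tw_cong[OF assms] by (simp add: twc_def)

lemma tw_zero [simp]: "tw t u (\<lambda>y. 0) x = 0"
  by (simp add: tw_def dir_d_def)

lemma twc_zero [simp]: "twc s t u (\<lambda>y. 0) x = 0"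
  by (simp add: twc_def)

lemma tw_lincomb:
  assumes "h differentiable (at x)" "k differentiable (at x)"
  shows "tw t u (\<lambda>y. a * h y + b * k y) x = a * tw t u h x + b * tw t u k x"
proof -
  have "((\<lambda>y. a * h y + b * k y) has_derivative (\<lambda>u. a * frechet_derivative h (at x) u + b * frechet_derivative k (at x) u)) (at x)"
    using assms[unfolded frechet_derivative_works] by (intro has_derivative_add has_derivative_mult_right)
  from frechet_derivative_at[OF this, symmetric] show ?thesis
    by (simp add: tw_def dir_d_def algebra_simps)
qed

lemma twc_lincomb:
  assumes "h differentiable (at x)" "k differentiable (at x)"
  shows "twc s t u (\<lambda>y. a * h y + b * k y) x = a * twc s t u h x + b * twc s t u k x"
  by (simp add: twc_def tw_lincomb[OF assms] algebra_simps add_divide_distrib)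

lemma twc_diff:
  assumes "h differentiable (at x)" "k differentiable (at x)"
  shows "twc s t u (\<lambda>y. h y - k y) x = twc s t u h x - twc s t u k x"
  using twc_lincomb[OF assms, of s t u 1 "-1"] by simp

lemma twc_cmult:
  assumes "h differentiable (at x)"
  shows "twc s t u (\<lambda>y. a * h y) x = a * twc s t u h x"
  using twc_lincomb[OF assms assms, of s t u a 0] by simp

lemma tw_cnj:
  assumes "h differentiable (at x)" "t x u \<in> \<real>"
  shows "tw t u (\<lambda>y. cnj (h y)) x = cnj (tw t u h x)"
proof -
  have "((\<lambda>y. cnj (h y)) has_derivative (\<lambda>u. cnj (frechet_derivative h (at x) u))) (at x)"
    using assms(1)[unfolded frechet_derivative_works]
    by (rule bounded_linear.has_derivative[OF bounded_linear_cnj])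
  from frechet_derivative_at[OF this, symmetric] show ?thesis
    using assms(2) by (simp add: tw_def dir_d_def Reals_cnj_iff)
qed

text \<open>A closed real 1-form as seen in one chart; \<open>closed_t\<close> is dt = 0 tested on
  constant coordinate fields. The twisted calculus is done here and transferred to the manifold by
  \<open>local_1form_chart\<close>.\<close>

locale local_1form =
  fixes S :: "(complex^'n::finite) set" and t :: "complex^'n \<Rightarrow> complex^'n \<Rightarrow> complex"
  assumes open_S: "open S"
    and lin_t: "x \<in> S \<Longrightarrow> linear (t x)"
    and smooth_t: "smooth_on S (\<lambda>x. t x v)"
    and real_t: "t x v \<in> \<real>"
    and closed_t: "x \<in> S \<Longrightarrow> frechet_derivative (\<lambda>y. t y u) (at x) v = frechet_derivative (\<lambda>y. t y v) (at x) u"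
begin

lemma tw_add: 
  assumes "x \<in> S" "h differentiable (at x)"
  shows "tw t (u + v) h x = tw t u h x + tw t v h x"
  using linear_add[OF lin_t[OF assms(1)]] linear_add[OF linear_frechet_derivative[OF assms(2)]]
  by (simp add: tw_def dir_d_def algebra_simps)

lemma tw_scaleR: 
  assumes "x \<in> S" "h differentiable (at x)"
  shows "tw t (r *\<^sub>R u) h x = r *\<^sub>R tw t u h x"
  using linear_scale[OF lin_t[OF assms(1)]] linear_scale[OF linear_frechet_derivative[OF assms(2)]]
  by (simp add: tw_def dir_d_def algebra_simps)

lemma tw_minus: 
  assumes "x \<in> S" "h differentiable (at x)"
  shows "tw t (- u) h x = - tw t u h x"
  using tw_scaleR[OF assms, of "-1" u] by simp

lemma twc_add: 
  assumes "x \<in> S" "h differentiable (at x)"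
  shows "twc s t (u + v) h x = twc s t u h x + twc s t v h x"
  using assms by (simp add: twc_def imaginary_smult_add tw_add algebra_simps add_divide_distrib)

lemma twc_scaleR: 
  assumes "x \<in> S" "h differentiable (at x)"
  shows "twc s t (r *\<^sub>R u) h x = r *\<^sub>R twc s t u h x"
  using assms by (simp add: twc_def imaginary_smult_scaleR tw_scaleR scaleR_conv_of_real[where 'a=complex] algebra_simps)

lemma linear_twc: "x \<in> S \<Longrightarrow> h differentiable (at x) \<Longrightarrow> linear (\<lambda>u. twc s t u h x)"
  by (rule linearI) (auto simp: twc_add twc_scaleR)

lemma twc_imaginary: 
  assumes "x \<in> S" "h differentiable (at x)" "s * s = 1"
  shows "twc s t (\<i> *s u) h x = - s * \<i> * twc s t u h x"
proof -
  have "s * (s * z) = z" for z using assms(3) by (simp flip: mult.assoc)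
  then show ?thesis
    using assms(1,2) by (simp add: twc_def tw_minus) (simp add: algebra_simps)
qed

lemma smooth_tw: "smooth_on S h \<Longrightarrow> smooth_on S (tw t u h)"
  unfolding tw_def dir_d_def
  by (intro smooth_on_diff smooth_on_mult smooth_t smooth_on_frechet_derivative open_S)

lemma smooth_twc: "smooth_on S h \<Longrightarrow> smooth_on S (twc s t u h)"
  unfolding twc_def
  by (intro smooth_on_divide smooth_on_add smooth_on_mult smooth_tw smooth_on_const open_S) auto

lemma tw_twice:
  assumes "smooth_on S h" "x \<in> S"
  shows "tw t u (tw t v h) x = dir_d (\<lambda>y. dir_d h y v) x u - dir_d (\<lambda>y. t y v) x u * h x
     - t x v * dir_d h x u - t x u * dir_d h x v + t x u * t x v * h x"
proof -
  have "(tw t v h has_derivative (\<lambda>u. frechet_derivative (\<lambda>y. frechet_derivative h (at y) v) (at x) u -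
      (t x v * frechet_derivative h (at x) u + frechet_derivative (\<lambda>y. t y v) (at x) u * h x))) (at x)"
    unfolding tw_def dir_d_def
    by (intro has_derivative_diff has_derivative_mult)
       (use assms smooth_t smooth_on_frechet_derivative smooth_on_has_derivative in blast)+
  from frechet_derivative_at[OF this, symmetric] show ?thesis
    unfolding tw_def[of t u] dir_d_def by (simp add: tw_def dir_d_def algebra_simps)
qed

text \<open>The operators \<open>tw t u\<close> are covariant derivatives for the connection d - t
  on the trivial line bundle, whose curvature is dt up to sign. In \<open>tw_twice\<close> the
  second derivatives of \<open>h\<close> are symmetric, the derivative of \<open>t\<close> is
  symmetric by closedness, and the other terms are visibly so.\<close>

lemma tw_commute:
  assumes "smooth_on S h" "x \<in> S"
  shows "tw t u (tw t v h) x = tw t v (tw t u h) x"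
  using frechet_derivative_commute[OF open_S assms(2,1), of u v] closed_t[OF assms(2), of u v]
  by (simp add: tw_twice[OF assms] dir_d_def algebra_simps)

lemma twc_twice:
  assumes "smooth_on S h" "x \<in> S"
  shows "twc s t u (twc s' t v h) x =
    (tw t u (tw t v h) x + s' * \<i> * tw t u (tw t (\<i> *s v) h) x
     + s * \<i> * tw t (\<i> *s u) (tw t v h) x - s * s' * tw t (\<i> *s u) (tw t (\<i> *s v) h) x) / 4"
proof -
  have d: "tw t v h differentiable (at x)" for v
    using smooth_on_differentiable[OF smooth_tw[OF assms(1)] assms(2)] .
  have "twc s' t v h = (\<lambda>y. (1/2) * tw t v h y + (s' * \<i> / 2) * tw t (\<i> *s v) h y)"
    by (rule ext) (simp add: twc_def add_divide_distrib)
  then have *: "tw t u (twc s' t v h) x = (1/2) * tw t u (tw t v h) x + (s' * \<i> / 2) * tw t u (tw t (\<i> *s v) h) x" for u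
    using tw_lincomb[OF d d, of t u "1/2" v "s' * \<i> / 2" "\<i> *s v"] by simp
  then show ?thesis
    unfolding twc_def[of s] * by (simp add: field_simps)
qed

text \<open>Both types are complex combinations of commuting operators. The lemma contains at once
  that the two twisted operators square to zero and that they anticommute.\<close>

lemma twc_commute:
  assumes "smooth_on S h" "x \<in> S"
  shows "twc s t u (twc s' t v h) x = twc s' t v (twc s t u h) x"
  by (simp add: twc_twice[OF assms] tw_commute[OF assms, of v u] tw_commute[OF assms, of v "\<i> *s u"]
      tw_commute[OF assms, of "\<i> *s v" u] tw_commute[OF assms, of "\<i> *s v" "\<i> *s u"] algebra_simps)

lemma twc_cnj:
  assumes "h differentiable (at x)" "s \<in> \<real>"
  shows "twc s t u (\<lambda>y. cnj (h y)) x = cnj (twc (- s) t u h x)"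
  using assms(2) by (simp add: twc_def tw_cnj[OF assms(1) real_t] Reals_cnj_iff)

text \<open>The twisted del-delbar of \<open>h\<close> on two constant vector fields: the inner
  operator has type (0,1), the outer one type (1,0), and the vectors are alternated.\<close>

definition bc :: "(complex^'n \<Rightarrow> complex) \<Rightarrow> complex^'n \<Rightarrow> complex^'n \<Rightarrow> complex^'n \<Rightarrow> complex" where
  "bc h x u v = twc (- 1) t u (twc 1 t v h) x - twc (- 1) t v (twc 1 t u h) x"

context
  fixes h :: "complex^'n \<Rightarrow> complex" assumes h: "smooth_on S h"
begin

lemma twc_differentiable: "x \<in> S \<Longrightarrow> twc s t v h differentiable (at x)"
  using smooth_on_differentiable[OF smooth_twc[OF h]] .

lemma smooth_bc: "smooth_on S (\<lambda>x. bc h x u v)"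
  unfolding bc_def by (intro smooth_on_diff smooth_twc h open_S)

lemma linear_twc_twc2:
  assumes "x \<in> S"
  shows "linear (\<lambda>v. twc s t u (twc s' t v h) x)"
proof (rule linearI)
  show "twc s t u (twc s' t (v + w) h) x = twc s t u (twc s' t v h) x + twc s t u (twc s' t w h) x" for v w
  proof -
    have "twc s t u (twc s' t (v + w) h) x = twc s t u (\<lambda>y. 1 * twc s' t v h y + 1 * twc s' t w h y) x"
      by (rule twc_cong[OF open_S assms]) (simp add: twc_add smooth_on_differentiable[OF h])
    then show ?thesis by (subst (asm) twc_lincomb) (auto intro!: twc_differentiable assms)
  qed
  show "twc s t u (twc s' t (r *\<^sub>R v) h) x = r *\<^sub>R twc s t u (twc s' t v h) x" for r v
  proof -
    have "twc s t u (twc s' t (r *\<^sub>R v) h) x = twc s t u (\<lambda>y. of_real r * twc s' t v h y) x"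
      by (rule twc_cong[OF open_S assms]) (simp add: twc_scaleR smooth_on_differentiable[OF h] scaleR_conv_of_real[where 'a=complex])
    then show ?thesis
      by (subst (asm) twc_cmult) (auto intro!: twc_differentiable assms simp: scaleR_conv_of_real[where 'a=complex])
  qed
qed

lemma linear_bc1: "x \<in> S \<Longrightarrow> linear (\<lambda>u. bc h x u v)"
  unfolding bc_def
  by (intro linear_compose_sub linear_twc linear_twc_twc2 twc_differentiable)

lemma linear_bc2: "x \<in> S \<Longrightarrow> linear (\<lambda>v. bc h x u v)"
  unfolding bc_def
  by (intro linear_compose_sub linear_twc linear_twc_twc2 twc_differentiable)

lemma bc_swap: "bc h x v u = - bc h x u v"
  by (simp add: bc_def)

text \<open>The outer operator is complex linear in its vector. The inner one is antilinear, which
  becomes visible after the two are exchanged by \<open>twc_commute\<close>.\<close>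

lemma twc_twc_imaginary:
  assumes "x \<in> S"
  shows "twc (- 1) t (\<i> *s u) (twc 1 t v h) x = \<i> * twc (- 1) t u (twc 1 t v h) x"
    and "twc (- 1) t u (twc 1 t (\<i> *s v) h) x = - \<i> * twc (- 1) t u (twc 1 t v h) x"
  using twc_imaginary[OF assms twc_differentiable[OF assms], of "- 1"]
    twc_imaginary[OF assms twc_differentiable[OF assms], of 1]
  by (auto simp: twc_commute[OF h assms, of "- 1" u 1])

lemma bc_imaginary: "x \<in> S \<Longrightarrow> bc h x (\<i> *s u) (\<i> *s v) = bc h x u v"
  by (simp add: bc_def twc_twc_imaginary)

lemma bc_imaginary_swap: "x \<in> S \<Longrightarrow> bc h x (\<i> *s u) v = - bc h x u (\<i> *s v)"
  by (simp add: bc_def twc_twc_imaginary)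

text \<open>Since I squares to -1, a metric is recovered from \<omega>(X,Y) = g(IX,Y) as g(u,v) =
  \<omega>(-Iu,v). Its symmetry combines alternation with type (1,1).\<close>

lemma bc_metric_sym:
  assumes "x \<in> S"
  shows "bc h x (- (\<i> *s u)) v = bc h x (- (\<i> *s v)) u"
proof -
  have "bc h x (- (\<i> *s u)) v = - bc h x (\<i> *s u) v"
    by (rule linear_neg[OF linear_bc1[OF assms]])
  also have "\<dots> = bc h x u (\<i> *s v)" by (simp add: bc_imaginary_swap[OF assms, of u v])
  also have "\<dots> = - bc h x (\<i> *s v) u" by (rule bc_swap)
  also have "\<dots> = bc h x (- (\<i> *s v)) u"
    by (rule linear_neg[OF linear_bc1[OF assms], symmetric])
  finally show ?thesis .
qed

lemma bc_type:
  assumes "x \<in> S"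
  shows "bc h x (a *s u) (a *s v) = a * cnj a * bc h x u v"
proof -
  have a: "a *s w = Re a *\<^sub>R w + Im a *\<^sub>R (\<i> *s w)" for w :: "complex^'n"
    by (simp add: vec_eq_iff complex_eq_iff)
  have "bc h x (a *s u) (a *s v) =
     Re a *\<^sub>R Re a *\<^sub>R bc h x u v + Re a *\<^sub>R Im a *\<^sub>R (bc h x u (\<i> *s v) + bc h x (\<i> *s u) v)
       + Im a *\<^sub>R Im a *\<^sub>R bc h x (\<i> *s u) (\<i> *s v)"
    unfolding a linear_add[OF linear_bc1[OF assms]] linear_add[OF linear_bc2[OF assms]]
      linear_scale[OF linear_bc1[OF assms]] linear_scale[OF linear_bc2[OF assms]]
    by (simp add: algebra_simps)
  also have "\<dots> = (Re a * Re a + Im a * Im a) *\<^sub>R bc h x u v"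
    using assms by (simp add: bc_imaginary bc_imaginary_swap[of x u v] algebra_simps)
  also have "\<dots> = a * cnj a * bc h x u v"
    by (simp add: complex_mult_cnj scaleR_conv_of_real power2_eq_square)
  finally show ?thesis .
qed

text \<open>Each term expands into threefold operators in which two factors have the same type:
  (0,1) for \<open>s = 1\<close> and (1,0) for \<open>s = - 1\<close>. The vectors of these two
  factors may be interchanged, and the six terms cancel in pairs.\<close>

lemma bc_cocycle:
  assumes "x \<in> S" "s = 1 \<or> s = - 1"
  shows "twc s t u (\<lambda>y. bc h y v w) x - twc s t v (\<lambda>y. bc h y u w) x + twc s t w (\<lambda>y. bc h y u v) x = 0"
proof -
  define Q where "Q s u s' v s'' w = twc s t u (twc s' t v (twc s'' t w h)) x" for s u s' v s'' w
  have e: "twc s t u (\<lambda>y. bc h y v w) x = Q s u (- 1) v 1 w - Q s u (- 1) w 1 v" for u v w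
    unfolding bc_def Q_def
    by (rule twc_diff; rule smooth_on_differentiable[OF smooth_twc[OF smooth_twc[OF h]] assms(1)])
  have c: "Q s u s' v s'' w = Q s' v s u s'' w" for u v w s s' s''
    unfolding Q_def by (rule twc_commute[OF smooth_twc[OF h] assms(1)])
  have d: "Q s u s' v s'' w = Q s u s'' w s' v" for u v w s s' s''
    unfolding Q_def by (rule twc_cong[OF open_S assms(1)]) (rule twc_commute[OF h])
  from assms(2) show ?thesis
  proof
    assume s: "s = 1"
    have "Q 1 u (- 1) v 1 w = Q 1 w (- 1) v 1 u" for u v w
    proof -
      have "Q 1 u (- 1) v 1 w = Q (- 1) v 1 u 1 w" by (rule c)
      also have "\<dots> = Q (- 1) v 1 w 1 u" by (rule d)
      also have "\<dots> = Q 1 w (- 1) v 1 u" by (rule c)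
      finally show ?thesis .
    qed
    from this[of u v w] this[of u w v] this[of v u w] show ?thesis unfolding e unfolding s by simp
  next
    assume s: "s = - 1"
    show ?thesis
      unfolding e unfolding s c[of "- 1" v "- 1" u] c[of "- 1" w "- 1" u] c[of "- 1" w "- 1" v] by simp
  qed
qed

text \<open>On the diagonal the mixed terms cancel by commutativity, leaving
  \<open>- (\<i> / 2)\<close> times the sum of the second twisted derivatives of \<open>h\<close>
  along \<open>u\<close> and \<open>\<i> *s u\<close>. Since \<open>t\<close> is real, these are
  real on real functions, so the factor \<open>\<i>\<close> selects \<open>Im (h y)\<close>.
  Estimates of the metric are thereby reduced to \<open>tw\<close>, whose dependence on
  \<open>t\<close> is explicit.\<close>

lemma bc_metric_Re:
  assumes "x \<in> S" "\<phi> = (\<lambda>y. complex_of_real (Im (h y)))"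
  shows "Re (bc h x (- (\<i> *s u)) u) = Re (tw t u (tw t u \<phi>) x + tw t (\<i> *s u) (tw t (\<i> *s u) \<phi>) x) / 2"
proof -
  define \<psi> where "\<psi> y = complex_of_real (Re (h y))" for y
  have sm: "smooth_on S \<phi>" "smooth_on S \<psi>"
    unfolding assms(2) \<psi>_def by (intro smooth_on_of_real smooth_on_Im smooth_on_Re open_S h)+
  have r: "tw t u k y \<in> \<real>" if "smooth_on S k" "y \<in> S" "\<And>y. k y \<in> \<real>" for k y u
  proof -
    have "(\<lambda>y. cnj (k y)) = k" using that(3) by (auto simp: Reals_cnj_iff)
    then show ?thesis
      using tw_cnj[where t=t and u=u and x=y, OF smooth_on_differentiable[OF that(1,2)] real_t]
      by (metis Reals_cnj_iff)
  qed
  have rr: "tw t u (tw t v k) x \<in> \<real>" if "smooth_on S k" "\<And>y. k y \<in> \<real>" for k u v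
  proof -
    have "tw t u (tw t v k) x = tw t u (\<lambda>y. cnj (tw t v k y)) x"
      by (rule tw_cong[OF open_S assms(1)]) (use r[OF that(1) _ that(2)] Reals_cnj_iff in metis)
    also have "\<dots> = cnj (tw t u (tw t v k) x)"
      by (rule tw_cnj[OF smooth_on_differentiable[OF smooth_tw[OF that(1)] assms(1)] real_t])
    finally show ?thesis by (metis Reals_cnj_iff)
  qed
  let ?H = "\<lambda>k u. tw t u (tw t u k) x + tw t (\<i> *s u) (tw t (\<i> *s u) k) x"
  have heq: "h = (\<lambda>y. 1 * \<psi> y + \<i> * \<phi> y)"
    by (auto simp: \<psi>_def assms(2) complex_eq_iff)
  have "tw t v h y = 1 * tw t v \<psi> y + \<i> * tw t v \<phi> y" if "y \<in> S" for v y
    by (subst heq, rule tw_lincomb) (use sm smooth_on_differentiable that in blast)+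
  then have "tw t u (tw t v h) x = tw t u (\<lambda>y. 1 * tw t v \<psi> y + \<i> * tw t v \<phi> y) x" for u v
    by (intro tw_cong[OF open_S assms(1)]) 
  moreover have "tw t u (\<lambda>y. 1 * tw t v \<psi> y + \<i> * tw t v \<phi> y) x = 1 * tw t u (tw t v \<psi>) x + \<i> * tw t u (tw t v \<phi>) x" for u v
    by (rule tw_lincomb) (use smooth_tw sm smooth_on_differentiable assms(1) in blast)+
  ultimately have H: "?H h u = ?H \<psi> u + \<i> * ?H \<phi> u"
    by (simp add: algebra_simps)
  have "bc h x (- (\<i> *s u)) u = - bc h x (\<i> *s u) u"
    using linear_neg[OF linear_bc1[OF assms(1)]] .
  also have "\<dots> = - 2 * \<i> * twc (- 1) t u (twc 1 t u h) x"
    by (simp add: bc_def twc_twc_imaginary assms(1) )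
  also have "\<dots> = - (\<i> / 2) * ?H h u"
    by (simp add: twc_twice[OF h assms(1)] tw_commute[OF h assms(1), of "\<i> *s u" u])
  moreover have "Re (- (\<i> / 2) * z) = Im z / 2" for z by simp
  ultimately have "Re (bc h x (- (\<i> *s u)) u) = Im (?H h u) / 2" by metis
  moreover have "Im (p + \<i> * q) = Re q" if "p \<in> \<real>" for p q
    using that by (auto elim!: Reals_cases)
  moreover have "?H \<psi> u \<in> \<real>"
    by (intro Reals_add rr sm; simp add: \<psi>_def)
  ultimately show ?thesis unfolding H by metis
qed

text \<open>Conjugation exchanges the two types because \<open>t\<close> is real, and it changes the
  sign of \<open>h\<close>. The second term of \<open>bc\<close> is therefore minus the conjugate of
  the first, so \<open>bc\<close> is twice a real part.\<close>

lemma bc_real: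
  assumes "x \<in> S" "\<And>y. cnj (h y) = - h y"
  shows "bc h x u v \<in> \<real>"
proof -
  have a: "cnj (twc (- 1) t u (twc 1 t v h) x) = - twc (- 1) t v (twc 1 t u h) x" for u v
  proof -
    have "cnj (twc (- 1) t u (twc 1 t v h) x) = twc 1 t u (\<lambda>y. cnj (twc 1 t v h y)) x"
      using twc_cnj[OF twc_differentiable[OF assms(1)], of 1] by simp
    also have "\<dots> = twc 1 t u (\<lambda>y. - 1 * twc (- 1) t v h y) x"
    proof (rule twc_cong[OF open_S assms(1)])
      fix y assume y: "y \<in> S"
      have "h = (\<lambda>y. - 1 * cnj (h y))" by (rule ext) (simp add: assms(2))
      then have "twc (- 1) t v h y = twc (- 1) t v (\<lambda>y. - 1 * cnj (h y)) y" by simp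
      also have "\<dots> = - 1 * twc (- 1) t v (\<lambda>y. cnj (h y)) y"
        by (rule twc_cmult) (use smooth_on_differentiable[OF h y] in \<open>simp add: assms(2)\<close>)
      also have "\<dots> = - cnj (twc 1 t v h y)"
        using twc_cnj[OF smooth_on_differentiable[OF h y], of "- 1" v] by simp
      finally show "cnj (twc 1 t v h y) = - 1 * twc (- 1) t v h y" by simp
    qed
    also have "\<dots> = - twc 1 t u (twc (- 1) t v h) x"
      using twc_cmult[OF twc_differentiable[OF assms(1)], of 1 t u "- 1"] by simp
    also have "\<dots> = - twc (- 1) t v (twc 1 t u h) x"
      by (simp add: twc_commute[OF h assms(1), of 1])
    finally show ?thesis .
  qed
  show ?thesis by (simp add: Reals_cnj_iff bc_def a)
qed

end

end

section \<open>Twisted potentials on a complex manifold\<close>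

definition bc_form :: "('m, 'n::finite) chart set \<Rightarrow> ('m, 'n) tensor \<Rightarrow> ('m \<Rightarrow> complex) \<Rightarrow> ('m, 'n) tensor" where
  "bc_form A \<theta> f = del_tw A \<theta> (delbar_tw A \<theta> (function_form A f))"

lemma length_remove_nth: "i < length vs \<Longrightarrow> length (remove_nth i vs) = length vs - 1"
  by (simp add: remove_nth_def)

lemma del_tw_eq:
  assumes "c \<in> A" "x \<in> chart_cod c"
  shows "del_tw A \<theta> \<eta> c x vs =
    (\<Sum>i<length vs. (- 1) ^ i * twc (- 1) (\<lambda>x u. \<theta> c x [u]) (vs ! i) (\<lambda>y. \<eta> c y (remove_nth i vs)) x)"
  using assms
  by (auto simp: del_tw_def diff_tensor_def ext_deriv_def wedge1_def part10_def twc_def tw_def dir_del_def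
      sum_subtractf[symmetric] field_simps intro!: sum.cong)

lemma delbar_tw_eq:
  assumes "c \<in> A" "x \<in> chart_cod c"
  shows "delbar_tw A \<theta> \<eta> c x vs =
    (\<Sum>i<length vs. (- 1) ^ i * twc 1 (\<lambda>x u. \<theta> c x [u]) (vs ! i) (\<lambda>y. \<eta> c y (remove_nth i vs)) x)"
  using assms
  by (auto simp: delbar_tw_def diff_tensor_def ext_deriv_def wedge1_def part01_def twc_def tw_def dir_delbar_def
      sum_subtractf[symmetric] field_simps intro!: sum.cong)

lemma ext_d_eq:
  assumes "c \<in> A" "x \<in> chart_cod c"
  shows "ext_d A \<eta> c x vs - wedge1 \<theta> \<eta> c x vs = del_tw A \<theta> \<eta> c x vs + delbar_tw A \<theta> \<eta> c x vs"
  unfolding del_tw_eq[OF assms] delbar_tw_eq[OF assms] sum.distrib[symmetric]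
  using assms
  by (auto simp: ext_d_def ext_deriv_def wedge1_def twc_def tw_def
      sum_subtractf[symmetric] field_simps intro!: sum.cong)

lemma tw_outside:
  assumes "\<And>ws. \<eta> c x ws = 0" "c \<notin> A \<or> x \<notin> chart_cod c"
  shows "del_tw A \<theta> \<eta> c x vs = 0" "delbar_tw A \<theta> \<eta> c x vs = 0" "ext_d A \<eta> c x vs = 0" "wedge1 \<theta> \<eta> c x vs = 0"
  using assms by (auto simp: del_tw_def delbar_tw_def diff_tensor_def ext_deriv_def ext_d_def wedge1_def)

section \<open>Charts, overlaps and transition maps\<close>

locale cplx_atlas =
  fixes A :: "('m::t2_space, 'n::finite) chart set"
  assumes atlas: "complex_atlas A"
begin

lemma open_dom: "c \<in> A \<Longrightarrow> open (fst c)"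
  and open_cod: "c \<in> A \<Longrightarrow> open (chart_cod c)"
  and chart_homeo: "c \<in> A \<Longrightarrow> homeomorphism (fst c) (chart_cod c) (snd c) (chart_inv c)"
  using atlas by (auto simp: complex_atlas_def)

lemma chart_exists: "\<exists>c\<in>A. p \<in> fst c"
  using atlas unfolding complex_atlas_def by (metis UNIV_I UN_iff)

lemma chart_inv_snd [simp]: "c \<in> A \<Longrightarrow> p \<in> fst c \<Longrightarrow> chart_inv c (snd c p) = p"
  using chart_homeo by (auto simp: homeomorphism_def)

lemma snd_chart_inv [simp]: "c \<in> A \<Longrightarrow> y \<in> chart_cod c \<Longrightarrow> snd c (chart_inv c y) = y"
  using chart_homeo by (auto simp: homeomorphism_def)

lemma chart_inv_in: "c \<in> A \<Longrightarrow> y \<in> chart_cod c \<Longrightarrow> chart_inv c y \<in> fst c"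
  using chart_homeo[of c] unfolding homeomorphism_def by blast

lemma snd_in: "p \<in> fst c \<Longrightarrow> snd c p \<in> chart_cod c"
  by (simp add: chart_cod_def)

definition overlap :: "('m, 'n) chart \<Rightarrow> ('m, 'n) chart \<Rightarrow> (complex^'n) set" where
  "overlap c c' = snd c ` (fst c \<inter> fst c')"

lemma overlap_subset: "overlap c c' \<subseteq> chart_cod c"
  by (auto simp: overlap_def chart_cod_def)

lemma overlap_iff: "c \<in> A \<Longrightarrow> y \<in> overlap c c' \<longleftrightarrow> y \<in> chart_cod c \<and> chart_inv c y \<in> fst c'"
  unfolding overlap_def chart_cod_def by auto

lemma open_overlap:
  assumes "c \<in> A" "c' \<in> A"
  shows "open (overlap c c')"
proof -
  have "overlap c c' = chart_cod c \<inter> chart_inv c -` fst c'"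
    using overlap_iff[OF assms(1), of _ c'] by blast
  moreover have "continuous_on (chart_cod c) (chart_inv c)"
    using chart_homeo[OF assms(1)] by (simp add: homeomorphism_def)
  ultimately show ?thesis
    using open_cod open_dom assms by (metis continuous_open_preimage)
qed

context
  fixes c c' assumes cc: "c \<in> A" "c' \<in> A"
begin

lemma smooth_transition: "smooth_on (overlap c c') (transition c c')"
  using atlas cc by (auto simp: complex_atlas_def holomorphic_map_on_def overlap_def)

lemma transition_app: "p \<in> fst c \<Longrightarrow> transition c c' (snd c p) = snd c' p"
  using cc by (simp add: transition_def)

lemma transition_in: "y \<in> overlap c c' \<Longrightarrow> transition c c' y \<in> overlap c' c"
  by (auto simp: overlap_def transition_app)

lemma chart_inv_transition: "y \<in> overlap c c' \<Longrightarrow> chart_inv c' (transition c c' y) = chart_inv c y"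
  using cc by (auto simp: overlap_def transition_app)

definition jac :: "complex^'n \<Rightarrow> complex^'n \<Rightarrow> complex^'n" where
  "jac y = frechet_derivative (transition c c') (at y)"

lemma jac_imaginary: "y \<in> overlap c c' \<Longrightarrow> jac y (\<i> *s v) = \<i> *s jac y v"
  using atlas cc by (auto simp: complex_atlas_def holomorphic_map_on_def overlap_def jac_def)

lemma has_derivative_transition: "y \<in> overlap c c' \<Longrightarrow> (transition c c' has_derivative jac y) (at y)"
  unfolding jac_def by (rule smooth_on_has_derivative[OF smooth_transition])

lemma linear_jac: "y \<in> overlap c c' \<Longrightarrow> linear (jac y)"
  using has_derivative_transition has_derivative_linear by blast

lemma smooth_jac: "smooth_on (overlap c c') (\<lambda>y. jac y v)"
  unfolding jac_def by (rule smooth_on_frechet_derivative[OF smooth_transition])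

text \<open>The Jacobian of a holomorphic map is complex linear in its vector. By symmetry of second
  derivatives that vector can trade places with the direction of differentiation.\<close>

lemma jac2_imaginary:
  assumes x: "x \<in> overlap c c'"
  shows "frechet_derivative (\<lambda>y. jac y v) (at x) (\<i> *s u) = \<i> *s frechet_derivative (\<lambda>y. jac y v) (at x) u"
proof -
  note sym = frechet_derivative_commute[OF open_overlap[OF cc] x smooth_transition, folded jac_def]
  have bl: "bounded_linear (\<lambda>v::complex^'n. \<i> *s v)"
    using linear_imaginary_smult linear_conv_bounded_linear by blast
  have "frechet_derivative (\<lambda>y. jac y v) (at x) (\<i> *s u) = frechet_derivative (\<lambda>y. jac y (\<i> *s u)) (at x) v"
    by (rule sym)
  also have "frechet_derivative (\<lambda>y. jac y (\<i> *s u)) (at x) = frechet_derivative (\<lambda>y. \<i> *s jac y u) (at x)"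
    by (rule frechet_derivative_cong_open[OF open_overlap[OF cc] x]) (rule jac_imaginary)
  also have "\<dots> = (\<lambda>v. \<i> *s frechet_derivative (\<lambda>y. jac y u) (at x) v)"
    by (rule frechet_derivative_at[symmetric], rule bounded_linear.has_derivative[OF bl])
       (rule smooth_on_has_derivative[OF smooth_jac x])
  finally show ?thesis using sym by simp
qed

lemma tw_pullback:
  assumes x: "x \<in> overlap c c'" and h': "h' differentiable (at (transition c c' x))"
    and h: "\<And>y. y \<in> overlap c c' \<Longrightarrow> h y = h' (transition c c' y)"
    and t: "\<And>v. t x v = t' (transition c c' x) (jac x v)"
  shows "tw t v h x = tw t' (jac x v) h' (transition c c' x)"
proof -
  have "frechet_derivative h (at x) = frechet_derivative (\<lambda>y. h' (transition c c' y)) (at x)"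
    by (rule frechet_derivative_cong_open[OF open_overlap[OF cc] x h])
  also have "\<dots> = (\<lambda>v. frechet_derivative h' (at (transition c c' x)) (jac x v))"
    by (rule frechet_derivative_at[symmetric],
        rule has_derivative_compose[OF has_derivative_transition[OF x]])
       (use h' frechet_derivative_works in blast)
  finally show ?thesis by (simp add: tw_def dir_d_def h[OF x] t)
qed

lemma twc_pullback:
  assumes "x \<in> overlap c c'" "h' differentiable (at (transition c c' x))"
    and "\<And>y. y \<in> overlap c c' \<Longrightarrow> h y = h' (transition c c' y)"
    and "\<And>v. t x v = t' (transition c c' x) (jac x v)"
  shows "twc s t v h x = twc s t' (jac x v) h' (transition c c' x)"
  by (simp add: twc_def tw_pullback[where t=t and t'=t', OF assms] jac_imaginary[OF assms(1)])

text \<open>The second derivatives of the transition map are complex linear in the direction of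
  differentiation, and so are annihilated by forms of type (0,1) after taking the (1,0)-part.\<close>

lemma twc_pullback_01:
  assumes x: "x \<in> overlap c c'"
    and B: "\<And>y. y \<in> chart_cod c' \<Longrightarrow> linear (B y)" "\<And>w. smooth_on (chart_cod c') (\<lambda>y. B y w)"
    and B01: "\<And>w. B (transition c c' x) (\<i> *s w) = - \<i> * B (transition c c' x) w"
    and t: "\<And>v. t x v = t' (transition c c' x) (jac x v)"
  shows "twc (- 1) t u (\<lambda>y. B (transition c c' y) (jac y v)) x =
    twc (- 1) t' (jac x u) (\<lambda>y. B y (jac x v)) (transition c c' x)"
proof -
  let ?z = "transition c c' x"
  let ?K = "frechet_derivative (\<lambda>y. jac y v) (at x)"
  have z: "?z \<in> chart_cod c'" using transition_in[OF x] overlap_subset by blast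
  have "((\<lambda>y. B (transition c c' y) (jac y v)) has_derivative
      (\<lambda>w. frechet_derivative (\<lambda>y. B y (jac x v)) (at ?z) (jac x w) + B ?z (?K w))) (at x)"
    by (rule has_derivative_linear_slot[OF open_cod[OF cc(2)] z B(1) _ has_derivative_transition[OF x]])
       (auto intro: smooth_on_differentiable[OF B(2) z] smooth_on_has_derivative[OF smooth_jac x])
  from frechet_derivative_at[OF this, symmetric]
  show ?thesis
    by (simp add: twc_def tw_def dir_d_def t jac_imaginary[OF x] jac2_imaginary[OF x] B01 algebra_simps)
qed

end

lemma overlap_chart: "p \<in> fst c \<Longrightarrow> p \<in> fst c' \<Longrightarrow> snd c p \<in> overlap c c'"
  by (auto simp: overlap_def)

section \<open>Tensors of degree one and two in vector notation\<close>

lemma covariant_tensor_1D: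
  assumes "covariant_tensor A 1 \<theta>"
  shows "c \<in> A \<Longrightarrow> x \<in> chart_cod c \<Longrightarrow> linear (\<lambda>u. \<theta> c x [u])"
    and "c \<in> A \<Longrightarrow> smooth_on (chart_cod c) (\<lambda>x. \<theta> c x [u])"
    and "c \<in> A \<Longrightarrow> c' \<in> A \<Longrightarrow> x \<in> overlap c c' \<Longrightarrow> \<theta> c x [u] = \<theta> c' (transition c c' x) [jac c c' x u]"
proof -
  show "linear (\<lambda>u. \<theta> c x [u])" if "c \<in> A" "x \<in> chart_cod c"
  proof -
    have "linear (\<lambda>u. \<theta> c x ([0][0 := u]))"
      using assms that unfolding covariant_tensor_def
      by (metis One_nat_def length_Cons less_one list.size(3))
    then show ?thesis by simp
  qed
  show "smooth_on (chart_cod c) (\<lambda>x. \<theta> c x [u])" if "c \<in> A"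
    using assms that unfolding covariant_tensor_def by (auto simp: length_Suc_conv)
  show "\<theta> c x [u] = \<theta> c' (transition c c' x) [jac c c' x u]" if cc: "c \<in> A" "c' \<in> A" "x \<in> overlap c c'"
  proof -
    obtain p where p: "p \<in> fst c \<inter> fst c'" "x = snd c p" using cc(3) by (auto simp: overlap_def)
    have "\<theta> c (snd c p) [u] = \<theta> c' (snd c' p)
        (map (frechet_derivative (transition c c') (at (snd c p))) [u])"
      using assms cc(1,2) p(1) unfolding covariant_tensor_def
      by (metis One_nat_def length_Cons list.size(3))
    then show ?thesis using cc p by (auto simp: transition_app jac_def)
  qed
qed

lemma covariant_tensor_1I:
  assumes "\<And>c x vs. c \<notin> A \<or> x \<notin> chart_cod c \<or> length vs \<noteq> 1 \<Longrightarrow> \<theta> c x vs = 0"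
    and "\<And>c x. c \<in> A \<Longrightarrow> x \<in> chart_cod c \<Longrightarrow> linear (\<lambda>u. \<theta> c x [u])"
    and "\<And>c u. c \<in> A \<Longrightarrow> smooth_on (chart_cod c) (\<lambda>x. \<theta> c x [u])"
    and "\<And>c c' x u. c \<in> A \<Longrightarrow> c' \<in> A \<Longrightarrow> x \<in> overlap c c' \<Longrightarrow> \<theta> c x [u] = \<theta> c' (transition c c' x) [jac c c' x u]"
  shows "covariant_tensor A 1 \<theta>"
  unfolding covariant_tensor_def
proof (intro conjI allI ballI impI)
  fix c c' p and vs :: "(complex^'n) list"
  assume c: "c \<in> A" "c' \<in> A" "p \<in> fst c \<inter> fst c'" and "length vs = 1"
  then obtain u where "vs = [u]" by (auto simp: length_Suc_conv)
  with c show "\<theta> c (snd c p) vs = \<theta> c' (snd c' p) (map (frechet_derivative (transition c c') (at (snd c p))) vs)"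
    using assms(4)[OF c(1,2), of "snd c p" u] by (simp add: overlap_chart transition_app jac_def)
next
  fix c x and i :: nat and vs :: "(complex^'n) list"
  assume c: "c \<in> A" "x \<in> chart_cod c" "length vs = 1" "i < 1"
  then obtain u where "vs = [u]" by (auto simp: length_Suc_conv)
  with c show "linear (\<lambda>u. \<theta> c x (vs[i := u]))" using assms(2) by simp
next
  fix c and vs :: "(complex^'n) list"
  assume c: "c \<in> A" "length vs = 1"
  then obtain u where "vs = [u]" by (auto simp: length_Suc_conv)
  with c show "smooth_on (chart_cod c) (\<lambda>x. \<theta> c x vs)" using assms(3) by simp
qed (use assms(1) in blast)

lemma covariant_tensor_2I:
  assumes "\<And>c x vs. c \<notin> A \<or> x \<notin> chart_cod c \<or> length vs \<noteq> 2 \<Longrightarrow> \<eta> c x vs = 0"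
    and "\<And>c x v. c \<in> A \<Longrightarrow> x \<in> chart_cod c \<Longrightarrow> linear (\<lambda>u. \<eta> c x [u, v])"
    and "\<And>c x u. c \<in> A \<Longrightarrow> x \<in> chart_cod c \<Longrightarrow> linear (\<lambda>v. \<eta> c x [u, v])"
    and "\<And>c u v. c \<in> A \<Longrightarrow> smooth_on (chart_cod c) (\<lambda>x. \<eta> c x [u, v])"
    and "\<And>c c' x u v. c \<in> A \<Longrightarrow> c' \<in> A \<Longrightarrow> x \<in> overlap c c' \<Longrightarrow>
      \<eta> c x [u, v] = \<eta> c' (transition c c' x) [jac c c' x u, jac c c' x v]"
  shows "covariant_tensor A 2 \<eta>"
  unfolding covariant_tensor_def
proof (intro conjI allI ballI impI)
  fix c c' p and vs :: "(complex^'n) list"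
  assume c: "c \<in> A" "c' \<in> A" "p \<in> fst c \<inter> fst c'" and "length vs = 2"
  then obtain u v where "vs = [u, v]" by (auto simp: length_Suc_conv numeral_2_eq_2)
  with c show "\<eta> c (snd c p) vs = \<eta> c' (snd c' p) (map (frechet_derivative (transition c c') (at (snd c p))) vs)"
    using assms(5)[OF c(1,2), of "snd c p" u v] by (simp add: overlap_chart transition_app jac_def)
next
  fix c x and i :: nat and vs :: "(complex^'n) list"
  assume c: "c \<in> A" "x \<in> chart_cod c" "length vs = 2" "i < 2"
  then obtain u v where "vs = [u, v]" by (auto simp: length_Suc_conv numeral_2_eq_2)
  moreover have "i = 0 \<or> i = 1" using c(4) by auto
  ultimately show "linear (\<lambda>u. \<eta> c x (vs[i := u]))" using assms(2,3)[OF c(1,2)] by auto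
next
  fix c and vs :: "(complex^'n) list"
  assume c: "c \<in> A" "length vs = 2"
  then obtain u v where "vs = [u, v]" by (auto simp: length_Suc_conv numeral_2_eq_2)
  with c show "smooth_on (chart_cod c) (\<lambda>x. \<eta> c x vs)" using assms(4) by simp
qed (use assms(1) in blast)

lemma local_1form_chart:
  assumes "closed_real_1form A \<theta>" "c \<in> A"
  shows "local_1form (chart_cod c) (\<lambda>x u. \<theta> c x [u])"
proof (rule local_1form.intro)
  have cov: "covariant_tensor A 1 \<theta>"
    using assms(1) by (simp add: closed_real_1form_def differential_form_def)
  show "open (chart_cod c)" using open_cod assms(2) .
  show "linear (\<lambda>u. \<theta> c x [u])" if "x \<in> chart_cod c" for x
    using covariant_tensor_1D(1)[OF cov assms(2) that] .
  show "smooth_on (chart_cod c) (\<lambda>x. \<theta> c x [v])" for v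
    using covariant_tensor_1D(2)[OF cov assms(2)] .
  show "\<theta> c x [v] \<in> \<real>" for x v
    using assms(1) unfolding closed_real_1form_def real_tensor_def by blast
  show "frechet_derivative (\<lambda>y. \<theta> c y [u]) (at x) v = frechet_derivative (\<lambda>y. \<theta> c y [v]) (at x) u"
    if "x \<in> chart_cod c" for x u v
  proof -
    have "ext_d A \<theta> c x [u, v] = 0"
      using assms(1) by (simp add: closed_real_1form_def zero_tensor_def)
    then show ?thesis
      using that assms(2) by (simp add: ext_d_def ext_deriv_def remove_nth_def dir_d_def)
  qed
qed

section \<open>The (1,1)-form of a potential\<close>

context
  fixes \<theta> :: "('m, 'n) tensor" and f :: "'m \<Rightarrow> complex"
  assumes \<theta>: "closed_real_1form A \<theta>" and f: "smooth_function A f"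
begin

abbreviation "tloc c \<equiv> (\<lambda>x u. \<theta> c x [u])"
abbreviation "floc c \<equiv> f \<circ> chart_inv c"

lemma smooth_floc: "c \<in> A \<Longrightarrow> smooth_on (chart_cod c) (floc c)"
  using f by (auto simp: smooth_function_def)

lemma delbar_function_form:
  assumes "c \<in> A" "x \<in> chart_cod c"
  shows "delbar_tw A \<theta> (function_form A f) c x [v] = twc 1 (tloc c) v (floc c) x"
    and "length vs \<noteq> 1 \<Longrightarrow> delbar_tw A \<theta> (function_form A f) c x vs = 0"
proof -
  show "delbar_tw A \<theta> (function_form A f) c x [v] = twc 1 (tloc c) v (floc c) x"
    unfolding delbar_tw_eq[OF assms] using assms(1)
    by (auto simp: remove_nth_def function_form_def intro!: twc_cong[OF open_cod[OF assms(1)] assms(2)])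
  assume "length vs \<noteq> 1"
  then have "function_form A f c y (remove_nth i vs) = 0" if "i < length vs" for i y
    using that length_remove_nth[OF that] by (auto simp: function_form_def)
  then show "delbar_tw A \<theta> (function_form A f) c x vs = 0"
    unfolding delbar_tw_eq[OF assms] by simp
qed

lemma bc_form_chart:
  assumes "c \<in> A" "x \<in> chart_cod c"
  shows "bc_form A \<theta> f c x [u, v] = local_1form.bc (tloc c) (floc c) x u v"
    and "length vs \<noteq> 2 \<Longrightarrow> bc_form A \<theta> f c x vs = 0"
proof -
  have *: "twc s (tloc c) u (\<lambda>y. delbar_tw A \<theta> (function_form A f) c y [v]) x =
      twc s (tloc c) u (twc 1 (tloc c) v (floc c)) x" for s u v
    by (rule twc_cong[OF open_cod[OF assms(1)] assms(2)]) (rule delbar_function_form[OF assms(1)])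
  show "bc_form A \<theta> f c x [u, v] = local_1form.bc (tloc c) (floc c) x u v"
    unfolding bc_form_def del_tw_eq[OF assms] local_1form.bc_def[OF local_1form_chart[OF \<theta> assms(1)]]
    by (simp add: remove_nth_def *)
  assume l: "length vs \<noteq> 2"
  have "twc s (tloc c) u (\<lambda>y. delbar_tw A \<theta> (function_form A f) c y (remove_nth i vs)) x = twc s (tloc c) u (\<lambda>y. 0) x"
    if "i < length vs" for s u i
    by (rule twc_cong[OF open_cod[OF assms(1)] assms(2)], rule delbar_function_form(2)[OF assms(1)])
       (use l length_remove_nth[OF that] that in auto)
  then show "bc_form A \<theta> f c x vs = 0"
    unfolding bc_form_def del_tw_eq[OF assms] by simp
qed

lemma bc_form_outside:
  assumes "c \<notin> A \<or> x \<notin> chart_cod c"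
  shows "bc_form A \<theta> f c x vs = 0"
  unfolding bc_form_def
  by (intro tw_outside(1,2)[OF _ assms]) (use assms in \<open>auto simp: function_form_def\<close>)

lemma bc_form_support:
  "c \<notin> A \<or> x \<notin> chart_cod c \<or> length vs \<noteq> 2 \<Longrightarrow> bc_form A \<theta> f c x vs = 0"
  using bc_form_outside bc_form_chart(2) by blast

text \<open>Chart independence needs an argument because the derivatives are taken on constant
  coordinate fields, which a transition map does not preserve. The inner step is the chain rule with
  a complex linear Jacobian. The outer step meets second derivatives of the transition map, which
  \<open>twc_pullback_01\<close> removes.\<close>

lemma bc_form_pullback:
  assumes cc: "c \<in> A" "c' \<in> A" and x: "x \<in> overlap c c'"
  shows "bc_form A \<theta> f c x [u, v] = bc_form A \<theta> f c' (transition c c' x) [jac c c' x u, jac c c' x v]"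
proof -
  let ?z = "transition c c' x"
  interpret c': local_1form "chart_cod c'" "tloc c'" by (rule local_1form_chart[OF \<theta> cc(2)])
  have xc: "x \<in> chart_cod c" using x overlap_subset by blast
  have zc: "transition c c' y \<in> chart_cod c'" if "y \<in> overlap c c'" for y
    using transition_in[OF cc that] overlap_subset by blast
  have cov: "covariant_tensor A 1 \<theta>"
    using \<theta> by (simp add: closed_real_1form_def differential_form_def)
  note t = covariant_tensor_1D(3)[OF cov cc]
  have df: "floc c' differentiable (at y)" if "y \<in> chart_cod c'" for y
    using smooth_on_differentiable[OF smooth_floc[OF cc(2)] that] .
  have *: "twc (- 1) (tloc c) u (twc 1 (tloc c) v (floc c)) x =
      twc (- 1) (tloc c') (jac c c' x u) (twc 1 (tloc c') (jac c c' x v) (floc c')) ?z" for u v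
  proof -
    have "twc (- 1) (tloc c) u (twc 1 (tloc c) v (floc c)) x =
        twc (- 1) (tloc c) u (\<lambda>y. twc 1 (tloc c') (jac c c' y v) (floc c') (transition c c' y)) x"
    proof (rule twc_cong[OF open_overlap[OF cc] x])
      fix y assume y: "y \<in> overlap c c'"
      show "twc 1 (tloc c) v (floc c) y = twc 1 (tloc c') (jac c c' y v) (floc c') (transition c c' y)"
        by (rule twc_pullback[OF cc y df[OF zc[OF y]]])
           (auto simp: chart_inv_transition[OF cc] t[OF y])
    qed
    also have "\<dots> = twc (- 1) (tloc c') (jac c c' x u) (twc 1 (tloc c') (jac c c' x v) (floc c')) ?z"
      by (rule twc_pullback_01[OF cc x, where B="\<lambda>y w. twc 1 (tloc c') w (floc c') y"])
         (auto intro: c'.linear_twc df c'.smooth_twc smooth_floc cc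
           simp: c'.twc_imaginary[OF zc[OF x] df[OF zc[OF x]]] t[OF x])
    finally show ?thesis .
  qed
  show ?thesis
    unfolding bc_form_chart(1)[OF cc(1) xc] bc_form_chart(1)[OF cc(2) zc[OF x]]
      local_1form.bc_def[OF local_1form_chart[OF \<theta> cc(1)]] c'.bc_def * ..
qed

lemma covariant_bc_form: "covariant_tensor A 2 (bc_form A \<theta> f)"
proof (rule covariant_tensor_2I, erule bc_form_support)
  fix c u v assume c: "c \<in> A"
  interpret local_1form "chart_cod c" "tloc c" by (rule local_1form_chart[OF \<theta> c])
  show "linear (\<lambda>u. bc_form A \<theta> f c x [u, v])" if "x \<in> chart_cod c" for x v
    unfolding bc_form_chart(1)[OF c that] by (rule linear_bc1[OF smooth_floc[OF c] that])
  show "linear (\<lambda>v. bc_form A \<theta> f c x [u, v])" if "x \<in> chart_cod c" for x u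
    unfolding bc_form_chart(1)[OF c that] by (rule linear_bc2[OF smooth_floc[OF c] that])
  show "smooth_on (chart_cod c) (\<lambda>x. bc_form A \<theta> f c x [u, v])"
    by (rule smooth_on_cong[OF open_cod[OF c] _ smooth_bc[OF smooth_floc[OF c]]])
       (rule bc_form_chart(1)[OF c, symmetric])
qed (rule bc_form_pullback)

lemma bc_form_cocycle: "bc_form A \<theta> f \<in> bott_chern_cocycles A \<theta>"
proof -
  have 1: "differential_form A 2 (bc_form A \<theta> f)"
    unfolding differential_form_def
  proof (intro conjI allI impI covariant_bc_form)
    fix c x i j and vs :: "(complex^'n) list"
    assume "length vs = 2 \<and> i < j \<and> j < 2 \<and> vs ! i = vs ! j"
    then obtain v where vs: "vs = [v, v]"
      by (auto simp: length_Suc_conv numeral_2_eq_2 less_Suc_eq)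
    show "bc_form A \<theta> f c x vs = 0"
    proof (cases "c \<in> A \<and> x \<in> chart_cod c")
      case True
      then show ?thesis
        using local_1form.bc_def[OF local_1form_chart[OF \<theta>]] by (simp add: vs bc_form_chart)
    qed (use bc_form_outside in blast)
  qed
  have 2: "of_type 1 1 (bc_form A \<theta> f)"
    unfolding of_type_def
  proof (intro allI)
    fix c x a and vs :: "(complex^'n) list"
    show "bc_form A \<theta> f c x (map ((*s) a) vs) = a ^ 1 * cnj a ^ 1 * bc_form A \<theta> f c x vs"
    proof (cases "c \<in> A \<and> x \<in> chart_cod c \<and> length vs = 2")
      case True
      then obtain u v where vs: "vs = [u, v]" by (auto simp: length_Suc_conv numeral_2_eq_2)
      show ?thesis
        using True local_1form.bc_type[OF local_1form_chart[OF \<theta>] smooth_floc]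
        by (simp add: vs bc_form_chart)
    next
      case False
      then have "bc_form A \<theta> f c x ws = 0" if "length ws = length vs" for ws
        using that by (intro bc_form_support) auto
      then show ?thesis by simp
    qed
  qed
  \<comment> \<open>One computation for both twisted operators, with the sign \<open>s\<close>
    selecting the type. Only lists of length 3 are of interest; for other lengths each summand
    vanishes.\<close>
  have 3: "(\<Sum>i<length vs. (- 1) ^ i * twc s (tloc c) (vs ! i) (\<lambda>y. bc_form A \<theta> f c y (remove_nth i vs)) x) = 0"
    if c: "c \<in> A" "x \<in> chart_cod c" and s: "s = 1 \<or> s = - 1" for c x s vs
  proof (cases "length vs = 3")
    case True
    then obtain u v w where vs: "vs = [u, v, w]" by (auto simp: length_Suc_conv numeral_3_eq_3)
    interpret local_1form "chart_cod c" "tloc c" by (rule local_1form_chart[OF \<theta> c(1)])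
    have e: "twc s (tloc c) u (\<lambda>y. bc_form A \<theta> f c y [v, w]) x = twc s (tloc c) u (\<lambda>y. bc (floc c) y v w) x" for u v w
      by (rule twc_cong[OF open_cod[OF c(1)] c(2)]) (rule bc_form_chart(1)[OF c(1)])
    show ?thesis
      using bc_cocycle[OF smooth_floc[OF c(1)] c(2) s, of u v w]
      by (simp add: vs remove_nth_def e numeral_3_eq_3)
  next
    case False
    have "twc s (tloc c) (vs ! i) (\<lambda>y. bc_form A \<theta> f c y (remove_nth i vs)) x = twc s (tloc c) (vs ! i) (\<lambda>y. 0) x"
      if "i < length vs" for i
      by (rule twc_cong[OF open_cod[OF c(1)] c(2)], rule bc_form_chart(2)[OF c(1)])
         (use False length_remove_nth[OF that] that in auto)
    then show ?thesis by simp
  qed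
  have "del_tw A \<theta> (bc_form A \<theta> f) c x vs = 0 \<and> delbar_tw A \<theta> (bc_form A \<theta> f) c x vs = 0" for c x vs
  proof (cases "c \<in> A \<and> x \<in> chart_cod c")
    case True
    then show ?thesis using 3 by (simp add: del_tw_eq delbar_tw_eq)
  next
    case False
    then have "c \<notin> A \<or> x \<notin> chart_cod c" by blast
    then show ?thesis by (intro conjI tw_outside(1,2) bc_form_outside)
  qed
  then show ?thesis
    using 1 2 by (auto simp: bott_chern_cocycles_def zero_tensor_def fun_eq_iff)
qed

lemma ext_d_bc_form: "ext_d A (bc_form A \<theta> f) = wedge1 \<theta> (bc_form A \<theta> f)"
proof (intro ext)
  fix c x vs
  show "ext_d A (bc_form A \<theta> f) c x vs = wedge1 \<theta> (bc_form A \<theta> f) c x vs"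
  proof (cases "c \<in> A \<and> x \<in> chart_cod c")
    case True
    then show ?thesis
      using ext_d_eq[of c A x "bc_form A \<theta> f" vs \<theta>] bc_form_cocycle
      by (simp add: bott_chern_cocycles_def zero_tensor_def)
  next
    case False
    then have out: "c \<notin> A \<or> x \<notin> chart_cod c" by blast
    show ?thesis
      using tw_outside(3,4)[where \<eta>="bc_form A \<theta> f", OF bc_form_outside[OF out] out] by simp
  qed
qed

text \<open>Reality comes from the imaginary potential, symmetry and invariance under I from type
  (1,1), and the Lee equation holds for any potential. Only positivity has to be supplied from
  outside.\<close>

lemma lck_form_bc_form:
  assumes im: "\<And>p. Re (f p) = 0"
    and pos: "\<And>c x u. c \<in> A \<Longrightarrow> x \<in> chart_cod c \<Longrightarrow> u \<noteq> 0 \<Longrightarrow> Re (bc_form A \<theta> f c x [- (\<i> *s u), u]) > 0"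
  shows "lck_form A (bc_form A \<theta> f) \<theta>"
proof -
  \<comment> \<open>Inverts \<omega>(X,Y) = g(IX,Y) by feeding -Iu into slot 0. Updating the empty
    list changes nothing, so the formula is also consistent there.\<close>
  define g :: "('m, 'n) tensor" where "g c x vs = bc_form A \<theta> f c x (vs[0 := - (\<i> *s (vs ! 0))])" for c x vs
  have g: "g c x [u, v] = local_1form.bc (tloc c) (floc c) x (- (\<i> *s u)) v" if "c \<in> A" "x \<in> chart_cod c" for c x u v
    using bc_form_chart(1)[OF that] by (simp add: g_def)
  have "fundamental_form g = bc_form A \<theta> f"
  proof (intro ext)
    fix c x and vs :: "(complex^'n) list"
    show "fundamental_form g c x vs = bc_form A \<theta> f c x vs"
      by (cases vs) (auto simp: fundamental_form_def g_def)
  qed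
  moreover have "hermitian_metric A g"
    unfolding hermitian_metric_def
  proof (intro conjI ballI)
    show "covariant_tensor A 2 g"
    proof (rule covariant_tensor_2I)
      fix c x and vs :: "(complex^'n) list"
      assume "c \<notin> A \<or> x \<notin> chart_cod c \<or> length vs \<noteq> 2"
      then show "g c x vs = 0"
        unfolding g_def by (intro bc_form_support) simp
    next
      fix c u v assume c: "c \<in> A"
      interpret local_1form "chart_cod c" "tloc c" by (rule local_1form_chart[OF \<theta> c])
      show "linear (\<lambda>u. g c x [u, v])" if "x \<in> chart_cod c" for x v
        unfolding g[OF c that]
        using linear_compose[OF linear_compose_neg[OF linear_imaginary_smult] linear_bc1[OF smooth_floc[OF c] that, of v]]
        by (simp add: o_def)
      show "linear (\<lambda>v. g c x [u, v])" if "x \<in> chart_cod c" for x u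
        unfolding g[OF c that] by (rule linear_bc2[OF smooth_floc[OF c] that])
      show "smooth_on (chart_cod c) (\<lambda>x. g c x [u, v])"
        by (rule smooth_on_cong[OF open_cod[OF c] _ smooth_bc[OF smooth_floc[OF c]]])
           (rule g[OF c, symmetric])
    next
      fix c c' x u v assume cc: "c \<in> A" "c' \<in> A" and x: "x \<in> overlap c c'"
      show "g c x [u, v] = g c' (transition c c' x) [jac c c' x u, jac c c' x v]"
        using bc_form_pullback[OF cc x, of "- (\<i> *s u)" v] linear_neg[OF linear_jac[OF cc x]]
        by (simp add: g_def jac_imaginary[OF cc x])
    qed
    show "real_tensor g"
      unfolding real_tensor_def
    proof (intro allI)
      fix c x and vs :: "(complex^'n) list"
      show "g c x vs \<in> \<real>"
      proof (cases "c \<in> A \<and> x \<in> chart_cod c \<and> length vs = 2")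
        case True
        then obtain u v where vs: "vs = [u, v]" by (auto simp: length_Suc_conv numeral_2_eq_2)
        show ?thesis
          using True local_1form.bc_real[OF local_1form_chart[OF \<theta>] smooth_floc] im
          by (simp add: vs g complex_eq_iff)
      next
        case False
        then have "g c x vs = 0"
          unfolding g_def by (intro bc_form_support) auto
        then show ?thesis by simp
      qed
    qed
    fix c x assume c: "c \<in> A" "x \<in> chart_cod c"
    interpret local_1form "chart_cod c" "tloc c" by (rule local_1form_chart[OF \<theta> c(1)])
    note sm = smooth_floc[OF c(1)]
    show "\<forall>u v. g c x [u, v] = g c x [v, u]"
      unfolding g[OF c] using bc_metric_sym[OF sm c(2)] by blast
    show "\<forall>u. u \<noteq> 0 \<longrightarrow> 0 < Re (g c x [u, u])"
      using pos[OF c] by (simp add: g_def)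
    show "\<forall>u v. g c x [\<i> *s u, \<i> *s v] = g c x [u, v]"
      unfolding g[OF c] using bc_imaginary[OF sm c(2)] linear_neg[OF linear_imaginary_smult]
      by metis
  qed
  ultimately show ?thesis
    using \<theta> ext_d_bc_form by (auto simp: lck_form_def intro!: exI[of _ g])
qed

end

section \<open>Bott-Chern classes of coboundaries\<close>

lemma bc_form_diff:
  assumes \<theta>: "closed_real_1form A \<theta>" and f: "smooth_function A f" and k: "smooth_function A k"
  shows "smooth_function A (\<lambda>p. f p - k p)"
    and "bc_form A \<theta> (\<lambda>p. f p - k p) = diff_tensor (bc_form A \<theta> f) (bc_form A \<theta> k)"
proof -
  show fk: "smooth_function A (\<lambda>p. f p - k p)"
    using f k unfolding smooth_function_def o_def by (auto intro: smooth_on_diff open_cod)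
  show "bc_form A \<theta> (\<lambda>p. f p - k p) = diff_tensor (bc_form A \<theta> f) (bc_form A \<theta> k)"
  proof (intro ext)
    fix c x and vs :: "(complex^'n) list"
    show "bc_form A \<theta> (\<lambda>p. f p - k p) c x vs = diff_tensor (bc_form A \<theta> f) (bc_form A \<theta> k) c x vs"
    proof (cases "c \<in> A \<and> x \<in> chart_cod c \<and> length vs = 2")
      case True
      then have c: "c \<in> A" "x \<in> chart_cod c" by auto
      obtain u v where vs: "vs = [u, v]" using True by (auto simp: length_Suc_conv numeral_2_eq_2)
      interpret local_1form "chart_cod c" "\<lambda>x u. \<theta> c x [u]" by (rule local_1form_chart[OF \<theta> c(1)])
      note sf = smooth_floc[OF \<theta> f c(1)] and sk = smooth_floc[OF \<theta> k c(1)]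
      let ?t = "\<lambda>x u. \<theta> c x [u]"
      have "twc (- 1) ?t u (twc 1 ?t v (\<lambda>y. f (chart_inv c y) - k (chart_inv c y))) x =
          twc (- 1) ?t u (twc 1 ?t v (f \<circ> chart_inv c)) x - twc (- 1) ?t u (twc 1 ?t v (k \<circ> chart_inv c)) x" for u v
      proof -
        have "twc (- 1) ?t u (twc 1 ?t v (\<lambda>y. f (chart_inv c y) - k (chart_inv c y))) x =
            twc (- 1) ?t u (\<lambda>y. twc 1 ?t v (f \<circ> chart_inv c) y - twc 1 ?t v (k \<circ> chart_inv c) y) x"
        proof (rule twc_cong[OF open_cod[OF c(1)] c(2)])
          fix y assume y: "y \<in> chart_cod c"
          show "twc 1 ?t v (\<lambda>y. f (chart_inv c y) - k (chart_inv c y)) y =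
              twc 1 ?t v (f \<circ> chart_inv c) y - twc 1 ?t v (k \<circ> chart_inv c) y"
            using twc_diff[OF smooth_on_differentiable[OF sf y] smooth_on_differentiable[OF sk y]]
            by (simp add: o_def)
        qed
        then show ?thesis
          using twc_diff[OF twc_differentiable[OF sf c(2)] twc_differentiable[OF sk c(2)]] by simp
      qed
      then show ?thesis
        unfolding vs diff_tensor_def bc_form_chart(1)[OF \<theta> f c] bc_form_chart(1)[OF \<theta> k c]
          bc_form_chart(1)[OF \<theta> fk c] bc_def by (simp add: o_def)
    next
      case False
      then have out: "c \<notin> A \<or> x \<notin> chart_cod c \<or> length vs \<noteq> 2" by blast
      show ?thesis
        by (simp add: diff_tensor_def bc_form_support[OF \<theta> _ out] f k fk)
    qed
  qed
qed

lemma bc_form_zero: "bc_form A \<theta> (\<lambda>p. 0) = zero_tensor"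
proof -
  have "delbar_tw A \<theta> (function_form A (\<lambda>p. 0)) = (\<lambda>c x vs. 0)"
    by (auto simp: fun_eq_iff delbar_tw_def diff_tensor_def ext_deriv_def wedge1_def function_form_def
        dir_delbar_def dir_d_def)
  then show ?thesis
    by (auto simp: fun_eq_iff bc_form_def del_tw_def diff_tensor_def ext_deriv_def wedge1_def 
        dir_del_def dir_d_def zero_tensor_def)
qed

lemma bott_chern_coboundaries_eq:
  "bott_chern_coboundaries A \<theta> = {bc_form A \<theta> f | f. smooth_function A f}"
  by (simp add: bott_chern_coboundaries_def bc_form_def)

lemma smooth_function_const: "smooth_function A (\<lambda>p. z)"
  by (simp add: smooth_function_def o_def smooth_on_const)

lemma zero_tensor_cocycle: "closed_real_1form A \<theta> \<Longrightarrow> zero_tensor \<in> bott_chern_cocycles A \<theta>"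
  using bc_form_cocycle[OF _ smooth_function_const[of 0]] by (simp add: bc_form_zero)

text \<open>Differences of coboundaries are coboundaries, so subtracting one does not change
  membership of a coset. That both forms are cocycles is also used, since the class of a non-cocycle
  is empty.\<close>

lemma bott_chern_class_bc_form:
  assumes \<theta>: "closed_real_1form A \<theta>" and f: "smooth_function A f"
  shows "bott_chern_class A \<theta> (bc_form A \<theta> f) = bott_chern_class A \<theta> zero_tensor"
proof -
  have "diff_tensor (bc_form A \<theta> f) \<zeta> \<in> bott_chern_coboundaries A \<theta> \<longleftrightarrow>
      diff_tensor zero_tensor \<zeta> \<in> bott_chern_coboundaries A \<theta>" for \<zeta>
  proof
    assume "diff_tensor (bc_form A \<theta> f) \<zeta> \<in> bott_chern_coboundaries A \<theta>"
    then obtain k where k: "smooth_function A k" "diff_tensor (bc_form A \<theta> f) \<zeta> = bc_form A \<theta> k"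
      by (auto simp: bott_chern_coboundaries_eq)
    have "diff_tensor zero_tensor \<zeta> = diff_tensor (diff_tensor (bc_form A \<theta> f) \<zeta>) (bc_form A \<theta> f)"
      by (simp add: diff_tensor_def zero_tensor_def)
    also have "\<dots> = bc_form A \<theta> (\<lambda>p. k p - f p)" unfolding k(2) bc_form_diff(2)[OF \<theta> k(1) f] ..
    finally show "diff_tensor zero_tensor \<zeta> \<in> bott_chern_coboundaries A \<theta>"
      using bc_form_diff(1)[OF \<theta> k(1) f] by (auto simp: bott_chern_coboundaries_eq)
  next
    assume "diff_tensor zero_tensor \<zeta> \<in> bott_chern_coboundaries A \<theta>"
    then obtain k where k: "smooth_function A k" "diff_tensor zero_tensor \<zeta> = bc_form A \<theta> k"
      by (auto simp: bott_chern_coboundaries_eq)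
    have k': "smooth_function A (\<lambda>p. 0 - k p)" "bc_form A \<theta> (\<lambda>p. 0 - k p) = diff_tensor zero_tensor (bc_form A \<theta> k)"
      using bc_form_diff[OF \<theta> smooth_function_const[of 0] k(1)] by (auto simp: bc_form_zero)
    have "diff_tensor (bc_form A \<theta> f) \<zeta> = diff_tensor (bc_form A \<theta> f) (bc_form A \<theta> (\<lambda>p. 0 - k p))"
      unfolding k'(2) k(2)[symmetric] by (simp add: diff_tensor_def zero_tensor_def)
    also have "\<dots> = bc_form A \<theta> (\<lambda>p. f p - (0 - k p))" unfolding bc_form_diff(2)[OF \<theta> f k'(1)] ..
    finally show "diff_tensor (bc_form A \<theta> f) \<zeta> \<in> bott_chern_coboundaries A \<theta>"
      using bc_form_diff(1)[OF \<theta> f k'(1)] unfolding bott_chern_coboundaries_eq by blast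
  qed
  then show ?thesis
    using bc_form_cocycle[OF \<theta> f] zero_tensor_cocycle[OF \<theta>]
    by (auto simp: bott_chern_class_def bott_chern_rel_def)
qed

text \<open>The zero tensor lies in its own coset, hence in that of \<omega>; reading the relation
  at this single member yields the potential.\<close>

lemma bott_chern_class_zeroD:
  assumes \<theta>: "closed_real_1form A \<theta>" and "bott_chern_class A \<theta> \<omega> = bott_chern_class A \<theta> zero_tensor"
  obtains f where "smooth_function A f" "\<omega> = bc_form A \<theta> f"
proof -
  have "zero_tensor \<in> bott_chern_class A \<theta> zero_tensor"
    using zero_tensor_cocycle[OF \<theta>] bc_form_zero[of \<theta>] smooth_function_const[of 0]
    by (auto simp: bott_chern_class_def bott_chern_rel_def bott_chern_coboundaries_eq diff_tensor_def zero_tensor_def)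
       metis
  then have "diff_tensor \<omega> zero_tensor \<in> bott_chern_coboundaries A \<theta>"
    using assms(2) by (auto simp: bott_chern_class_def bott_chern_rel_def)
  then show thesis
    using that by (auto simp: bott_chern_coboundaries_eq diff_tensor_def zero_tensor_def)
qed

end

section \<open>Logarithmic differentials and rational classes\<close>

text \<open>\<open>\<kappa>\<close> times the differential of any local argument of a nowhere
  vanishing \<open>F\<close>. Written through dF / F it needs no choice of a branch.\<close>

definition dlog_form :: "('m, 'n::finite) chart set \<Rightarrow> ('m \<Rightarrow> complex) \<Rightarrow> real \<Rightarrow> ('m, 'n) tensor" where
  "dlog_form A F \<kappa> = (\<lambda>c x vs. if c \<in> A \<and> x \<in> chart_cod c \<and> length vs = 1
     then of_real (\<kappa> * Im (dir_d (F \<circ> chart_inv c) x (vs ! 0) / F (chart_inv c x))) else 0)"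

context cplx_atlas
begin

lemma smooth_function_continuous:
  assumes "smooth_function A F"
  shows "continuous_on UNIV F"
proof -
  have "isCont F p" for p
  proof -
    obtain c where c: "c \<in> A" "p \<in> fst c" using chart_exists by blast
    have "continuous_on (chart_cod c) (F \<circ> chart_inv c)"
      using assms c(1) smooth_on_imp_continuous_on unfolding smooth_function_def by blast
    moreover have "continuous_on (fst c) (snd c)" "snd c ` fst c \<subseteq> chart_cod c"
      using chart_homeo[OF c(1)] by (auto simp: homeomorphism_def)
    ultimately have "continuous_on (fst c) (\<lambda>p. (F \<circ> chart_inv c) (snd c p))"
      by (rule continuous_on_compose2)
    then have "continuous_on (fst c) F"
      by (rule continuous_on_eq) (simp add: c(1))
    then show ?thesis using open_dom[OF c(1)] c(2) by (simp add: continuous_on_eq_continuous_at)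
  qed
  then show ?thesis by (simp add: continuous_at_imp_continuous_on)
qed

context
  fixes F :: "'m \<Rightarrow> complex" and \<kappa> :: real
  assumes F: "smooth_function A F" and F0: "\<And>p. F p \<noteq> 0"
begin

lemma dlog_form_chart:
  "c \<in> A \<Longrightarrow> x \<in> chart_cod c \<Longrightarrow>
    dlog_form A F \<kappa> c x [u] = of_real (\<kappa> * Im (dir_d (F \<circ> chart_inv c) x u / F (chart_inv c x)))"
  by (simp add: dlog_form_def)

lemma covariant_dlog_form: "covariant_tensor A 1 (dlog_form A F \<kappa>)"
proof (rule covariant_tensor_1I)
  fix c x assume c: "c \<in> A" "x \<in> chart_cod c"
  have L: "linear (frechet_derivative (F \<circ> chart_inv c) (at x))"
    using F c by (intro linear_frechet_derivative smooth_on_differentiable[of "chart_cod c"])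
      (auto simp: smooth_function_def)
  show "linear (\<lambda>u. dlog_form A F \<kappa> c x [u])"
    by (rule linearI)
       (simp_all add: dlog_form_chart[OF c] dir_d_def linear_add[OF L] linear_scale[OF L] divide_inverse
         complex_eq_iff algebra_simps)
next
  fix c u assume c: "c \<in> A"
  have smF: "smooth_on (chart_cod c) (F \<circ> chart_inv c)" using F c by (simp add: smooth_function_def)
  have "smooth_on (chart_cod c)
      (\<lambda>x. complex_of_real (\<kappa> * Im (dir_d (F \<circ> chart_inv c) x u / (F \<circ> chart_inv c) x)))"
    unfolding dir_d_def
    by (intro smooth_on_of_real smooth_on_mult smooth_on_Im smooth_on_divide smooth_on_const
        smooth_on_frechet_derivative open_cod c smF) (simp add: F0)
  then show "smooth_on (chart_cod c) (\<lambda>x. dlog_form A F \<kappa> c x [u])"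
    by (rule smooth_on_cong[OF open_cod[OF c], rotated]) (simp add: dlog_form_chart[OF c])
next
  fix c c' x u assume cc: "c \<in> A" "c' \<in> A" and x: "x \<in> overlap c c'"
  let ?z = "transition c c' x"
  have xc: "x \<in> chart_cod c" using x overlap_subset by blast
  have zc: "?z \<in> chart_cod c'" using transition_in[OF cc x] overlap_subset by blast
  \<comment> \<open>For the zero 1-form \<open>tw\<close> is the plain directional derivative, so
    \<open>tw_pullback\<close> is just the chain rule.\<close>
  have "tw (\<lambda>x u. 0) u (F \<circ> chart_inv c) x = tw (\<lambda>x u. 0) (jac c c' x u) (F \<circ> chart_inv c') ?z"
    by (rule tw_pullback[OF cc x])
       (use F cc smooth_on_differentiable[OF _ zc] in \<open>auto simp: smooth_function_def chart_inv_transition[OF cc]\<close>)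
  then show "dlog_form A F \<kappa> c x [u] = dlog_form A F \<kappa> c' ?z [jac c c' x u]"
    by (simp add: dlog_form_chart cc xc zc tw_def chart_inv_transition[OF cc x])
qed (auto simp: dlog_form_def)

lemma dlog_form_derivative:
  assumes c: "c \<in> A" "x \<in> chart_cod c" and Fc: "Fc = F \<circ> chart_inv c"
  shows "((\<lambda>y. dlog_form A F \<kappa> c y [u]) has_derivative
     (\<lambda>v. of_real (\<kappa> * Im (dir_d (\<lambda>y. dir_d Fc y u) x v / Fc x - dir_d Fc x u * dir_d Fc x v / (Fc x)\<^sup>2)))) (at x)"
proof -
  have sm: "smooth_on (chart_cod c) Fc" using F c Fc by (simp add: smooth_function_def)
  have nz: "Fc x \<noteq> 0" using F0 Fc by simp
  have "((\<lambda>y. dir_d Fc y u / Fc y) has_derivative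
     (\<lambda>v. - dir_d Fc x u * (inverse (Fc x) * dir_d Fc x v * inverse (Fc x)) + dir_d (\<lambda>y. dir_d Fc y u) x v / Fc x)) (at x)"
    unfolding dir_d_def
    by (intro has_derivative_divide[where f="\<lambda>y. frechet_derivative Fc (at y) u" and g=Fc, OF _ _ nz] smooth_on_has_derivative[OF sm c(2)]
        smooth_on_has_derivative[OF smooth_on_frechet_derivative[OF sm] c(2)])
  then have "((\<lambda>y. dir_d Fc y u / Fc y) has_derivative
     (\<lambda>v. dir_d (\<lambda>y. dir_d Fc y u) x v / Fc x - dir_d Fc x u * dir_d Fc x v / (Fc x)\<^sup>2)) (at x)"
    by (rule has_derivative_eq_rhs) (simp add: fun_eq_iff divide_inverse power2_eq_square algebra_simps)
  from has_derivative_of_real[OF has_derivative_mult_right[OF has_derivative_Im[OF this], of \<kappa>]]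
  show ?thesis
    by (rule has_derivative_transform_within_open[OF _ open_cod[OF c(1)] c(2)])
       (simp add: dlog_form_chart c Fc)
qed

text \<open>The expression in \<open>dlog_form_derivative\<close> is symmetric in \<open>u\<close>
  and \<open>v\<close>: its first term by symmetry of second derivatives of \<open>F\<close>, its
  second as a product.\<close>

lemma closed_dlog_form: "closed_real_1form A (dlog_form A F \<kappa>)"
  unfolding closed_real_1form_def
proof (intro conjI)
  show "differential_form A 1 (dlog_form A F \<kappa>)"
    by (simp add: differential_form_def covariant_dlog_form[simplified])
  show "real_tensor (dlog_form A F \<kappa>)"
    by (simp add: real_tensor_def dlog_form_def)
  show "ext_d A (dlog_form A F \<kappa>) = zero_tensor"
  proof (intro ext)
    fix c x and vs :: "(complex^'n) list"
    show "ext_d A (dlog_form A F \<kappa>) c x vs = zero_tensor c x vs"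
    proof (cases "c \<in> A \<and> x \<in> chart_cod c")
      case True
      then have c: "c \<in> A" "x \<in> chart_cod c" by auto
      show ?thesis
      proof (cases "length vs = 2")
        case True
        then obtain u v where vs: "vs = [u, v]" by (auto simp: length_Suc_conv numeral_2_eq_2)
        have sm: "smooth_on (chart_cod c) (F \<circ> chart_inv c)" using F c by (simp add: smooth_function_def)
        note d = dlog_form_derivative[OF c refl, THEN frechet_derivative_at, symmetric]
        show ?thesis
          using frechet_derivative_commute[OF open_cod[OF c(1)] c(2) sm, of u v]
          by (simp add: vs ext_d_def ext_deriv_def remove_nth_def zero_tensor_def c dir_d_def[of "\<lambda>y. dlog_form A F \<kappa> c y ws" for ws] d)
             (simp add: dir_d_def mult.commute)
      next
        case False
        then have "dlog_form A F \<kappa> c y (remove_nth i vs) = 0" if "i < length vs" for i y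
          using length_remove_nth[OF that] that by (auto simp: dlog_form_def)
        then show ?thesis using c by (simp add: ext_d_def ext_deriv_def zero_tensor_def dir_d_def)
      qed
    qed (auto simp: ext_d_def ext_deriv_def zero_tensor_def)
  qed
qed

end

end

text \<open>Only meaningful for \<open>g\<close> continuous and without zeros on \<open>[0,1]\<close>.\<close>

definition arg_incr :: "(real \<Rightarrow> complex) \<Rightarrow> real" where
  "arg_incr g = (THE d. \<exists>h. continuous_on {0..1} h \<and> (\<forall>t\<in>{0..1}. g t = exp (h t)) \<and> d = Im (h 1 - h 0))"

section \<open>Continuous logarithms along paths\<close>

lemma continuous_logarithm_unique:
  fixes h k :: "real \<Rightarrow> complex"
  assumes h: "continuous_on {0..1} h" and k: "continuous_on {0..1} k"
    and eq: "\<And>t. t \<in> {0..1} \<Longrightarrow> exp (h t) = exp (k t)"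
  shows "h 1 - h 0 = k 1 - k 0"
proof -
  have "(\<lambda>t. h t - k t) constant_on {0..1}"
  proof (rule continuous_discrete_range_constant)
    show "continuous_on {0..1} (\<lambda>t. h t - k t)" using h k by (intro continuous_intros)
    fix s :: real assume s: "s \<in> {0..1}"
    \<comment> \<open>Two logarithms of the same number differ by a multiple of 2\<pi>\<i>, so
      distinct values of \<open>h - k\<close> are at least 2\<pi> apart; a continuous function with
      such a range is constant on an interval.\<close>
    have "2 * pi \<le> norm ((h t - k t) - (h s - k s))" if t: "t \<in> {0..1}" "h t - k t \<noteq> h s - k s" for t
    proof -
      obtain m n :: int where "h t = k t + of_int (2 * m) * pi * \<i>" "h s = k s + of_int (2 * n) * pi * \<i>"
        using eq[OF t(1)] eq[OF s] unfolding exp_eq by blast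
      then have e: "(h t - k t) - (h s - k s) = of_real (2 * pi * of_int (m - n)) * \<i>" and "m \<noteq> n"
        using t(2) by (auto simp: algebra_simps)
      then have "1 \<le> \<bar>m - n\<bar>" by linarith
      then have "1 \<le> \<bar>real_of_int (m - n)\<bar>" by linarith
      then show ?thesis unfolding e by (simp add: norm_mult abs_mult del: of_int_diff)
    qed
    then show "\<exists>e>0. \<forall>t. t \<in> {0..1} \<and> h t - k t \<noteq> h s - k s \<longrightarrow> e \<le> norm ((h t - k t) - (h s - k s))"
      by (intro exI[of _ "2 * pi"]) auto
  qed simp
  then have "h 1 - k 1 = h 0 - k 0" by (auto simp: constant_on_def)
  then show ?thesis by (simp add: algebra_simps)
qed

lemma arg_incr_eq:
  assumes "continuous_on {0..1} h" "\<And>t. t \<in> {0..1} \<Longrightarrow> g t = exp (h t)"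
  shows "arg_incr g = Im (h 1 - h 0)"
  unfolding arg_incr_def
proof (rule the_equality)
  fix d assume "\<exists>k. continuous_on {0..1} k \<and> (\<forall>t\<in>{0..1}. g t = exp (k t)) \<and> d = Im (k 1 - k 0)"
  then obtain k where k: "continuous_on {0..1} k" "\<forall>t\<in>{0..1}. g t = exp (k t)" "d = Im (k 1 - k 0)"
    by blast
  have "k 1 - k 0 = h 1 - h 0"
    by (rule continuous_logarithm_unique[OF k(1) assms(1)]) (use k(2) assms(2) in metis)
  then show "d = Im (h 1 - h 0)" using k(3) by simp
qed (use assms in blast)

text \<open>Continuity alone keeps \<open>h s\<close> within \<pi> of \<open>h t\<close> for
  \<open>s\<close> near \<open>t\<close>. There \<open>h s\<close> is \<open>h t\<close> plus the
  principal logarithm of \<open>g s / g t\<close>, and that quotient stays near 1, where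
  \<open>Ln\<close> is differentiable with derivative 1.\<close>

lemma continuous_logarithm_has_derivative:
  fixes g h :: "real \<Rightarrow> complex"
  assumes h: "continuous_on {0..1} h" "\<And>t. t \<in> {0..1} \<Longrightarrow> g t = exp (h t)"
    and t: "0 < t" "t < 1" and g: "(g has_vector_derivative g') (at t)"
  shows "(h has_vector_derivative g' / g t) (at t)"
proof -
  have nz: "g t \<noteq> 0" using h(2)[of t] t by simp
  have "isCont h t"
    using h(1) t by (metis continuous_on_interior interior_atLeastAtMost_real greaterThanLessThan_iff)
  then obtain d where d: "d > 0" "\<And>s. dist s t < d \<Longrightarrow> dist (h s) (h t) < pi"
    unfolding continuous_at_eps_delta using pi_gt_zero by blast
  let ?U = "ball t d \<inter> {0<..<1}"
  have Ln: "h t + Ln (g s / g t) = h s" if "s \<in> ?U" for s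
  proof -
    have "\<bar>Im (h s - h t)\<bar> < pi"
      using d(2)[of s] that abs_Im_le_cmod[of "h s - h t"] by (auto simp: dist_norm abs_minus_commute)
    moreover have "g s / g t = exp (h s - h t)" using h(2)[of s] h(2)[of t] t that by (simp add: exp_diff)
    ultimately show ?thesis by (simp add: Ln_exp abs_less_iff)
  qed
  have "((\<lambda>s. g s / g t) has_vector_derivative g' / g t) (at t)"
    using has_vector_derivative_mult_left[OF g, of "inverse (g t)"] by (simp add: divide_inverse)
  moreover have "(Ln has_field_derivative 1) (at (g t / g t))"
    using nz has_field_derivative_Ln[of 1] by (simp add: inverse_eq_divide)
  ultimately have "((\<lambda>s. Ln (g s / g t)) has_vector_derivative g' / g t) (at t)"
    using field_vector_diff_chain_at[of "\<lambda>s. g s / g t" "g' / g t" t Ln 1] by (simp add: o_def)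
  then have "((\<lambda>s. h t + Ln (g s / g t)) has_vector_derivative g' / g t) (at t)"
    by (auto intro!: derivative_eq_intros)
  then show ?thesis
    by (rule has_vector_derivative_transform_within_open[of _ _ _ ?U]) (use Ln d t in auto)
qed

section \<open>Singular cochains from winding numbers\<close>

definition frag_linear :: "('b \<Rightarrow> 'r::comm_ring_1) \<Rightarrow> ('b \<Rightarrow>\<^sub>0 int) \<Rightarrow> 'r" where
  "frag_linear w a = (\<Sum>b\<in>Poly_Mapping.keys a. of_int (Poly_Mapping.lookup a b) * w b)"

lemma frag_linear_superset:
  assumes "finite S" "Poly_Mapping.keys a \<subseteq> S"
  shows "frag_linear w a = (\<Sum>b\<in>S. of_int (Poly_Mapping.lookup a b) * w b)"
  unfolding frag_linear_def
  by (rule sum.mono_neutral_left[OF assms]) (auto simp: in_keys_iff)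

lemma frag_linear_add: "frag_linear w (a + b) = frag_linear w a + frag_linear w b"
proof -
  let ?S = "Poly_Mapping.keys a \<union> Poly_Mapping.keys b"
  have "frag_linear w (a + b) = (\<Sum>x\<in>?S. of_int (Poly_Mapping.lookup (a + b) x) * w x)"
    by (rule frag_linear_superset) (auto simp: Poly_Mapping.keys_add)
  also have "\<dots> = frag_linear w a + frag_linear w b"
    using frag_linear_superset[of ?S a w] frag_linear_superset[of ?S b w]
    by (simp add: lookup_add sum.distrib algebra_simps)
  finally show ?thesis .
qed

lemma frag_linear_of [simp]: "frag_linear w (frag_of x) = w x"
  by (simp add: frag_linear_def)

lemma frag_linear_0 [simp]: "frag_linear w 0 = 0"
  by (simp add: frag_linear_def)

lemma frag_linear_diff: "frag_linear w (a - b) = frag_linear w a - frag_linear w b"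
  using frag_linear_add[of w "a - b" b] by simp

text \<open>Barycentric coordinates with vertex 0 at \<open>t = 0\<close> and vertex 1 at
  \<open>t = 1\<close>, the orientation that \<open>path_simplex\<close> uses.\<close>

definition edge_point :: "real \<Rightarrow> nat \<Rightarrow> real" where
  "edge_point t = (\<lambda>i. if i = 0 then 1 - t else if i = 1 then t else 0)"

definition triangle_point :: "real \<times> real \<Rightarrow> nat \<Rightarrow> real" where
  "triangle_point p = (\<lambda>i. if i = 0 then 1 - fst p - snd p else if i = 1 then fst p else if i = 2 then snd p else 0)"

lemma edge_point_in: "t \<in> {0..1} \<Longrightarrow> edge_point t \<in> standard_simplex 1"
  by (auto simp: edge_point_def standard_simplex_def)

lemma triangle_point_in:
  "fst p \<ge> 0 \<Longrightarrow> snd p \<ge> 0 \<Longrightarrow> fst p + snd p \<le> 1 \<Longrightarrow> triangle_point p \<in> standard_simplex 2"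
  by (auto simp: triangle_point_def standard_simplex_def numeral_2_eq_2)

text \<open>Standard simplices carry the product topology on infinitely many coordinates, so a
  parametrisation \<open>e\<close> only has to be continuous in each coordinate.\<close>

lemma continuous_on_singular_simplex:
  assumes "singular_simplex p euclidean \<sigma>" "\<And>i. continuous_on T (\<lambda>x. e x i)" "e ` T \<subseteq> standard_simplex p"
  shows "continuous_on T (\<lambda>x. \<sigma> (e x))"
proof -
  have "continuous_map (top_of_set T) (powertop_real UNIV) e"
    using assms(2) by (simp add: continuous_map_componentwise_UNIV)
  then have "continuous_map (top_of_set T) (subtopology (powertop_real UNIV) (standard_simplex p)) e"
    using assms(3) by (auto simp: continuous_map_in_subtopology)
  moreover have "continuous_map (subtopology (powertop_real UNIV) (standard_simplex p)) euclidean \<sigma>"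
    using assms(1) by (simp add: singular_simplex_def)
  ultimately have "continuous_map (top_of_set T) euclidean (\<sigma> \<circ> e)"
    by (rule continuous_map_compose)
  then show ?thesis by (simp add: o_def)
qed

context
  fixes F :: "'m::topological_space \<Rightarrow> complex"
  assumes contF: "continuous_on UNIV F" and F0: "\<And>p. F p \<noteq> 0"
begin

lemma edge_logarithm:
  assumes "singular_simplex 1 euclidean \<tau>"
  obtains h where "continuous_on {0..1} h" "\<And>t. t \<in> {0..1} \<Longrightarrow> F (\<tau> (edge_point t)) = exp (h t)"
proof -
  have "continuous_on {0..1} (\<lambda>t. edge_point t i)" for i
    unfolding edge_point_def by (cases "i = 0"; cases "i = 1") (auto intro!: continuous_intros)
  then have "continuous_on {0..1} (\<lambda>t. \<tau> (edge_point t))"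
    by (rule continuous_on_singular_simplex[OF assms]) (use edge_point_in in blast)
  then have "continuous_on {0..1} (\<lambda>t. F (\<tau> (edge_point t)))"
    by (rule continuous_on_compose2[OF contF]) auto
  then show thesis
    using continuous_logarithm_on_contractible[of "{0..1}" "\<lambda>t. F (\<tau> (edge_point t))"] F0
      convex_imp_contractible that by (metis convex_real_interval(5))
qed

text \<open>The winding of \<open>F\<close> along \<open>\<tau>\<close>, up to the coboundary of the principal argument of \<open>F\<close>.\<close>

definition winding_defect :: "((nat \<Rightarrow> real) \<Rightarrow> 'm) \<Rightarrow> real" where
  "winding_defect \<tau> = arg_incr (\<lambda>t. F (\<tau> (edge_point t)))
     - (Im (Ln (F (\<tau> (edge_point 1)))) - Im (Ln (F (\<tau> (edge_point 0)))))"

text \<open>At each end of the edge a continuous logarithm differs from the principal one by a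
  multiple of 2\<pi>\<i>; the defect is the difference of these two multiples, divided by
  \<i>.\<close>

lemma winding_defect_int:
  assumes "singular_simplex 1 euclidean \<tau>"
  shows "\<exists>n::int. winding_defect \<tau> = 2 * pi * n"
proof -
  obtain h where h: "continuous_on {0..1} h" "\<And>t. t \<in> {0..1} \<Longrightarrow> F (\<tau> (edge_point t)) = exp (h t)"
    using edge_logarithm[OF assms] by blast
  have "\<exists>n::int. h t = Ln (F (\<tau> (edge_point t))) + (of_int (2 * n) * pi) * \<i>" if "t \<in> {0..1}" for t
    using h(2)[OF that] F0 by (metis exp_Ln exp_eq)
  then obtain n m :: int where "h 0 = Ln (F (\<tau> (edge_point 0))) + (of_int (2 * n) * pi) * \<i>"
    "h 1 = Ln (F (\<tau> (edge_point 1))) + (of_int (2 * m) * pi) * \<i>"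
    by (metis atLeastAtMost_iff order_refl zero_le_one)
  moreover have "arg_incr (\<lambda>t. F (\<tau> (edge_point t))) = Im (h 1 - h 0)"
    by (rule arg_incr_eq) (use h in auto)
  ultimately show ?thesis
    unfolding winding_defect_def by (intro exI[of _ "m - n"]) (simp add: algebra_simps)
qed

text \<open>The triangle is convex, so a single logarithm \<open>H\<close> serves all three edges.
  The increments of \<open>H\<close> and those of the principal argument are then differences of
  vertex values, and both cancel around the boundary.\<close>

lemma winding_defect_boundary:
  assumes "singular_simplex 2 euclidean \<sigma>"
  shows "winding_defect (singular_face 2 0 \<sigma>) - winding_defect (singular_face 2 1 \<sigma>)
    + winding_defect (singular_face 2 2 \<sigma>) = 0"
proof -
  define T where "T = {p::real\<times>real. 0 \<le> fst p} \<inter> {p. 0 \<le> snd p} \<inter> {p. fst p + snd p \<le> 1}"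
  have "convex T"
    unfolding T_def convex_def by (auto intro!: add_nonneg_nonneg mult_nonneg_nonneg)
       (smt (verit) mult_left_le mult_right_mono distrib_left mult_left_mono)
  have "continuous_on T (\<lambda>p. triangle_point p i)" for i
    unfolding triangle_point_def by (cases "i = 0"; cases "i = 1"; cases "i = 2") (auto intro!: continuous_intros)
  then have "continuous_on T (\<lambda>p. \<sigma> (triangle_point p))"
    by (rule continuous_on_singular_simplex[OF assms]) (auto simp: T_def triangle_point_in)
  then have "continuous_on T (\<lambda>p. F (\<sigma> (triangle_point p)))"
    by (rule continuous_on_compose2[OF contF]) auto
  then obtain H where H: "continuous_on T H" "\<And>p. p \<in> T \<Longrightarrow> F (\<sigma> (triangle_point p)) = exp (H p)"
    using continuous_logarithm_on_contractible[of T "\<lambda>p. F (\<sigma> (triangle_point p))"] F0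
      convex_imp_contractible[OF \<open>convex T\<close>] by metis
  have face: "winding_defect (singular_face 2 k \<sigma>) = Im (H (e 1) - H (e 0))
      - (Im (Ln (F (\<sigma> (triangle_point (e 1))))) - Im (Ln (F (\<sigma> (triangle_point (e 0))))))"
    if e: "continuous_on {0..1} e" "e ` {0..1} \<subseteq> T"
      "\<And>t. t \<in> {0..1} \<Longrightarrow> simplical_face k (edge_point t) = triangle_point (e t)" for k e
  proof -
    have s: "singular_face 2 k \<sigma> (edge_point t) = \<sigma> (triangle_point (e t))" if "t \<in> {0..1}" for t
      using e(3)[OF that] edge_point_in[OF that] by (simp add: singular_face_def)
    have "arg_incr (\<lambda>t. F (singular_face 2 k \<sigma> (edge_point t))) = Im (H (e 1) - H (e 0))"
    proof (rule arg_incr_eq[where h="\<lambda>t. H (e t)"])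
      show "continuous_on {0..1} (\<lambda>t. H (e t))" by (rule continuous_on_compose2[OF H(1) e(1,2)])
      show "F (singular_face 2 k \<sigma> (edge_point t)) = exp (H (e t))" if "t \<in> {0..1}" for t
        using H(2)[of "e t"] e(2) that by (simp only: s) blast
    qed
    then show ?thesis by (simp add: winding_defect_def s)
  qed
  \<comment> \<open>Vertices 0, 1 and 2 are the points (0,0), (1,0) and (0,1). Face \<open>k\<close>
    omits vertex \<open>k\<close>, so faces 0, 1 and 2 run from 1 to 2, from 0 to 2 and from 0 to
    1.\<close>
  have 0: "winding_defect (singular_face 2 0 \<sigma>) = Im (H (0, 1) - H (1, 0))
      - (Im (Ln (F (\<sigma> (triangle_point (0, 1))))) - Im (Ln (F (\<sigma> (triangle_point (1, 0))))))"
    using face[of "\<lambda>t. (1 - t, t)" 0]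
    by (force intro!: continuous_intros simp: T_def simplical_face_def edge_point_def triangle_point_def fun_eq_iff)
  have 1: "winding_defect (singular_face 2 1 \<sigma>) = Im (H (0, 1) - H (0, 0))
      - (Im (Ln (F (\<sigma> (triangle_point (0, 1))))) - Im (Ln (F (\<sigma> (triangle_point (0, 0))))))"
    using face[of "\<lambda>t. (0, t)" 1]
    by (force intro!: continuous_intros simp: T_def simplical_face_def edge_point_def triangle_point_def fun_eq_iff)
  have 2: "winding_defect (singular_face 2 2 \<sigma>) = Im (H (1, 0) - H (0, 0))
      - (Im (Ln (F (\<sigma> (triangle_point (1, 0))))) - Im (Ln (F (\<sigma> (triangle_point (0, 0))))))"
    using face[of "\<lambda>t. (t, 0)" 2]
    by (force intro!: continuous_intros simp: T_def simplical_face_def edge_point_def triangle_point_def fun_eq_iff)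
  show ?thesis unfolding 0 1 2 by simp
qed

end

context cplx_atlas
begin

text \<open>The integral along a path is 1/(2\<pi>q) times the increment of a continuous argument of
  \<open>F\<close>. Splitting the increment into the winding defect and the change of the principal
  argument gives a cochain with values in multiples of 1/q plus the coboundary of a real 0-cochain.
  The former is a cocycle by \<open>winding_defect_boundary\<close>.\<close>

lemma rational_class_dlog_form:
  assumes F: "smooth_function A F" and F0: "\<And>p. F p \<noteq> 0" and q: "q > (0::nat)"
  shows "rational_class A (dlog_form A F (1 / (2 * pi * q)))"
proof -
  note contF = smooth_function_continuous[OF F]
  let ?\<kappa> = "1 / (2 * pi * q)"
  let ?a = "\<lambda>p. ?\<kappa> * Im (Ln (F p))"
  \<comment> \<open>On singular 1-simplices the real number on the right is an integer divided by
    \<open>q\<close>, so a rational representative exists. On other maps the value is arbitrary, but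
    chains never see it.\<close>
  define w where "w \<tau> = (SOME r::rat. of_rat r = ?\<kappa> * winding_defect F \<tau>)" for \<tau>
  have w: "of_rat (w \<tau>) = ?\<kappa> * winding_defect F \<tau>" if \<tau>: "singular_simplex 1 euclidean \<tau>" for \<tau>
  proof -
    obtain n :: int where "winding_defect F \<tau> = 2 * pi * n"
      using winding_defect_int[OF contF F0 \<tau>] by blast
    then have "of_rat (of_int n / of_nat q) = ?\<kappa> * winding_defect F \<tau>"
      using q by (simp add: of_rat_divide)
    then show ?thesis unfolding w_def by (rule someI)
  qed
  \<comment> \<open>The inner function of \<open>j\<close> is the only point of the standard
    0-simplex, so the cochain evaluates the scaled principal argument at a vertex.\<close>
  define \<beta> where "\<beta> = frag_linear (\<lambda>\<tau> :: (nat \<Rightarrow> real) \<Rightarrow> 'm. ?a (\<tau> (\<lambda>j. if j = 0 then 1 else 0)))"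
  have "frag_linear w (chain_boundary 2 a) = 0" if "singular_chain 2 euclidean a" for a
  proof -
    have "Poly_Mapping.keys a \<subseteq> singular_simplex_set 2 euclidean"
      using that by (simp add: singular_chain_def)
    then show ?thesis
    proof (induction a rule: frag_induction)
      case (one \<sigma>)
      then have \<sigma>: "singular_simplex 2 euclidean \<sigma>" by simp
      have face: "singular_simplex 1 euclidean (singular_face 2 k \<sigma>)" if "k \<le> 2" for k
        using singular_simplex_singular_face[OF \<sigma> _ that] by simp
      have "{..2::nat} = {0, 1, 2}" by auto
      then have "chain_boundary 2 (frag_of \<sigma>) = frag_of (singular_face 2 0 \<sigma>)
          - frag_of (singular_face 2 1 \<sigma>) + frag_of (singular_face 2 2 \<sigma>)"
        by (simp add: chain_boundary_of)
      then have "frag_linear w (chain_boundary 2 (frag_of \<sigma>))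
          = w (singular_face 2 0 \<sigma>) - w (singular_face 2 1 \<sigma>) + w (singular_face 2 2 \<sigma>)"
        by (simp add: frag_linear_diff frag_linear_add)
      also have "(of_rat \<dots> :: real) = ?\<kappa> * (winding_defect F (singular_face 2 0 \<sigma>)
          - winding_defect F (singular_face 2 1 \<sigma>) + winding_defect F (singular_face 2 2 \<sigma>))"
        by (simp only: of_rat_add of_rat_diff w[OF face[of 0]] w[OF face[of 1]] w[OF face[of 2]])
           (simp add: algebra_simps diff_divide_distrib add_divide_distrib)
      also have "\<dots> = 0" unfolding winding_defect_boundary[OF contF F0 \<sigma>] by simp
      finally show ?case by simp
    qed (simp_all add: chain_boundary_diff frag_linear_diff)
  qed
  then have "singular_cocycle 1 euclidean (frag_linear w)"
    by (simp add: singular_cocycle_def singular_cochain_def frag_linear_add numeral_2_eq_2)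
  moreover have "singular_cochain 0 euclidean \<beta>"
    by (simp add: singular_cochain_def \<beta>_def frag_linear_add)
  moreover have "path_integral_form A (dlog_form A F ?\<kappa>) \<gamma> =
      of_rat (frag_linear w (frag_of (path_simplex \<gamma>))) + \<beta> (chain_boundary 1 (frag_of (path_simplex \<gamma>)))"
    if \<gamma>: "smooth_path A \<gamma>" for \<gamma>
  proof -
    obtain J where J: "open J" "{0..1} \<subseteq> J" "continuous_on J \<gamma>"
      "\<And>c. c \<in> A \<Longrightarrow> smooth_on {t \<in> J. \<gamma> t \<in> fst c} (snd c \<circ> \<gamma>)"
      using \<gamma> unfolding smooth_path_def by blast
    have edge: "path_simplex \<gamma> (edge_point t) = \<gamma> t" if "t \<in> {0..1}" for t
      using edge_point_in[OF that] by (simp add: path_simplex_def edge_point_def)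
    have cont\<gamma>: "continuous_on {0..1} \<gamma>" using J continuous_on_subset by blast
    have "singular_simplex 1 euclidean (path_simplex \<gamma>)"
    proof -
      have "continuous_map (subtopology (powertop_real UNIV) (standard_simplex 1)) (top_of_set {0..1}) (\<lambda>x. x 1)"
        unfolding continuous_map_in_subtopology
        by (intro conjI continuous_map_from_subtopology continuous_map_product_projection)
           (auto simp: standard_simplex_def)
      moreover have "continuous_map (top_of_set {0..1}) euclidean \<gamma>" using cont\<gamma> by simp
      ultimately have "continuous_map (subtopology (powertop_real UNIV) (standard_simplex 1)) euclidean (\<gamma> \<circ> (\<lambda>x. x 1))"
        by (rule continuous_map_compose)
      then have "continuous_map (subtopology (powertop_real UNIV) (standard_simplex 1)) euclidean (path_simplex \<gamma>)"
        by (rule continuous_map_eq) (auto simp: path_simplex_def)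
      then show ?thesis by (simp add: singular_simplex_def path_simplex_def)
    qed
    note simplex = this
    obtain h where h: "continuous_on {0..1} h" "\<And>t. t \<in> {0..1} \<Longrightarrow> F (\<gamma> t) = exp (h t)"
    proof -
      have "continuous_on {0..1} (\<lambda>t. F (\<gamma> t))"
        by (rule continuous_on_compose2[OF contF cont\<gamma>]) auto
      then show thesis
        using continuous_logarithm_on_contractible[of "{0..1}" "\<lambda>t. F (\<gamma> t)"] F0
          convex_imp_contractible that by (metis convex_real_interval(5))
    qed
    have "((\<lambda>t. let c = (SOME c. c \<in> A \<and> \<gamma> t \<in> fst c)
        in Re (dlog_form A F ?\<kappa> c (snd c (\<gamma> t)) [vector_derivative (snd c \<circ> \<gamma>) (at t)]))
      has_integral (?\<kappa> * Im (h 1) - ?\<kappa> * Im (h 0))) {0..1}"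
    \<comment> \<open>The derivative of \<open>h\<close> is available only for
      \<open>0 < t < 1\<close>, which together with continuity up to the ends suffices. The chart
      chosen by \<open>SOME\<close> may jump with \<open>t\<close>: each derivative is computed with
      \<open>t\<close> fixed, in the chart belonging to it.\<close>
    proof (rule fundamental_theorem_of_calculus_interior)
      show "continuous_on {0..1} (\<lambda>t. ?\<kappa> * Im (h t))" using h(1) by (intro continuous_intros)
      fix t :: real assume t: "t \<in> {0<..<1}"
      define c where "c = (SOME c. c \<in> A \<and> \<gamma> t \<in> fst c)"
      have "\<exists>c. c \<in> A \<and> \<gamma> t \<in> fst c" using chart_exists by blast
      then have c: "c \<in> A" "\<gamma> t \<in> fst c" unfolding c_def by (rule someI2_ex, blast)+
      let ?T = "{s \<in> J. \<gamma> s \<in> fst c}"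
      have "?T = J \<inter> \<gamma> -` fst c" by auto
      then have T: "open ?T" using continuous_open_preimage[OF J(3,1) open_dom[OF c(1)]] by simp
      have tT: "t \<in> ?T" using t J(2) c(2) by auto
      let ?w = "vector_derivative (snd c \<circ> \<gamma>) (at t)" and ?x = "snd c (\<gamma> t)"
      have w: "((snd c \<circ> \<gamma>) has_vector_derivative ?w) (at t)"
        using smooth_on_differentiable[OF J(4)[OF c(1)] tT]
        by (simp add: vector_derivative_works[symmetric])
      have x: "?x \<in> chart_cod c" by (rule snd_in[OF c(2)])
      have "((F \<circ> chart_inv c) has_derivative dir_d (F \<circ> chart_inv c) ?x) (at ?x)"
        unfolding dir_d_def[abs_def]
        by (rule smooth_on_has_derivative[OF _ x]) (use F c(1) in \<open>simp add: smooth_function_def\<close>)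
      then have D: "((F \<circ> chart_inv c) has_derivative dir_d (F \<circ> chart_inv c) ?x) (at ((snd c \<circ> \<gamma>) t))"
        by simp
      have "((\<lambda>s. (F \<circ> chart_inv c) ((snd c \<circ> \<gamma>) s)) has_vector_derivative dir_d (F \<circ> chart_inv c) ?x ?w) (at t)"
        using has_derivative_compose[OF w[unfolded has_vector_derivative_def] D]
          linear_scale[OF has_derivative_linear[OF D]]
        unfolding has_vector_derivative_def by simp
      then have "((\<lambda>s. F (\<gamma> s)) has_vector_derivative dir_d (F \<circ> chart_inv c) ?x ?w) (at t)"
        by (rule has_vector_derivative_transform_within_open[OF _ T tT]) (use c(1) in simp)
      then have "(h has_vector_derivative dir_d (F \<circ> chart_inv c) ?x ?w / F (\<gamma> t)) (at t)"
        using continuous_logarithm_has_derivative[OF h, of t] t by simp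
      from bounded_linear.has_vector_derivative[OF bounded_linear_Im this]
      have "((\<lambda>t. ?\<kappa> * Im (h t)) has_vector_derivative
          ?\<kappa> * Im (dir_d (F \<circ> chart_inv c) ?x ?w / F (\<gamma> t))) (at t)"
        by (rule has_vector_derivative_mult_right)
      then show "((\<lambda>t. ?\<kappa> * Im (h t)) has_vector_derivative
          (let c = (SOME c. c \<in> A \<and> \<gamma> t \<in> fst c)
           in Re (dlog_form A F ?\<kappa> c (snd c (\<gamma> t)) [vector_derivative (snd c \<circ> \<gamma>) (at t)]))) (at t)"
        unfolding Let_def c_def[symmetric]
        by (simp add: dlog_form_chart[OF F F0 c(1) x] c)
    qed simp
    then have "path_integral_form A (dlog_form A F ?\<kappa>) \<gamma> = ?\<kappa> * Im (h 1 - h 0)"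
      unfolding path_integral_form_def by (simp add: integral_unique right_diff_distrib diff_divide_distrib)
    also have "Im (h 1 - h 0) = arg_incr (\<lambda>t. F (path_simplex \<gamma> (edge_point t)))"
      by (rule arg_incr_eq[symmetric]) (use h edge in auto)
    also have "?\<kappa> * \<dots> = of_rat (w (path_simplex \<gamma>)) + (?a (\<gamma> 1) - ?a (\<gamma> 0))"
      unfolding w[OF simplex] winding_defect_def[OF contF F0]
      by (simp add: edge algebra_simps diff_divide_distrib add_divide_distrib)
    also have "?a (\<gamma> 1) - ?a (\<gamma> 0) = \<beta> (chain_boundary 1 (frag_of (path_simplex \<gamma>)))"
    proof -
      have "{..1::nat} = {0, 1}" by auto
      then have "chain_boundary 1 (frag_of (path_simplex \<gamma>)) =
          frag_of (singular_face 1 0 (path_simplex \<gamma>)) - frag_of (singular_face 1 1 (path_simplex \<gamma>))"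
        by (simp add: chain_boundary_of)
      \<comment> \<open>Face 0 omits vertex 0 and is the end point of the path; face 1 is the
        initial point.\<close>
      moreover have "singular_face 1 0 (path_simplex \<gamma>) (\<lambda>j. if j = 0 then 1 else 0) = path_simplex \<gamma> (edge_point 1)"
        "singular_face 1 1 (path_simplex \<gamma>) (\<lambda>j. if j = 0 then 1 else 0) = path_simplex \<gamma> (edge_point 0)"
        by (auto simp: singular_face_def simplical_face_def edge_point_def intro!: arg_cong[of _ _ "path_simplex \<gamma>"])
      ultimately show ?thesis by (simp add: \<beta>_def frag_linear_diff edge)
    qed
    finally show ?thesis by simp
  qed
  ultimately show ?thesis unfolding rational_class_def by blast
qed

end

section \<open>Partitions of unity and approximate gauge functions\<close>

text \<open>\<open>e\<close> is a local solution of de = l t e, so every derivative of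
  \<open>\<rho> * e\<close> is \<open>e\<close> times a coefficient. The coefficients are sorted by
  the order of the derivative falling on \<open>\<rho>\<close>, in preparation for summing over a
  partition of unity.\<close>

lemma (in local_1form) gauge_product:
  assumes N: "open N" "y \<in> N" "N \<subseteq> S" and \<rho>: "smooth_on N \<rho>"
    and e: "\<And>z. z \<in> N \<Longrightarrow> (e has_derivative (\<lambda>u. l * t z u * e z)) (at z)"
    and m: "\<And>z. z \<in> N \<Longrightarrow> m z = \<rho> z * e z"
  shows "dir_d m y u = (dir_d \<rho> y u + l * t y u * \<rho> y) * e y"
    and "dir_d (\<lambda>z. dir_d m z u) y v = (dir_d (\<lambda>z. dir_d \<rho> z u) y v
      + l * (dir_d (\<lambda>z. t z u) y v * \<rho> y + t y u * dir_d \<rho> y v + t y v * dir_d \<rho> y u)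
      + l * l * t y u * t y v * \<rho> y) * e y"
proof -
  have 1: "dir_d m z u = (dir_d \<rho> z u + l * t z u * \<rho> z) * e z" if z: "z \<in> N" for z u
  proof -
    have "((\<lambda>z. \<rho> z * e z) has_derivative (\<lambda>u. \<rho> z * (l * t z u * e z) + dir_d \<rho> z u * e z)) (at z)"
      unfolding dir_d_def by (intro has_derivative_mult e z smooth_on_has_derivative[OF \<rho> z])
    then have "(m has_derivative (\<lambda>u. \<rho> z * (l * t z u * e z) + dir_d \<rho> z u * e z)) (at z)"
      by (rule has_derivative_transform_within_open[OF _ N(1) z]) (simp add: m)
    from frechet_derivative_at[OF this, symmetric] show ?thesis
      by (simp add: dir_d_def algebra_simps)
  qed
  show "dir_d m y u = (dir_d \<rho> y u + l * t y u * \<rho> y) * e y" by (rule 1[OF N(2)])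
  have y: "y \<in> S" using N by blast
  have "((\<lambda>z. (dir_d \<rho> z u + l * t z u * \<rho> z) * e z) has_derivative
     (\<lambda>v. (dir_d \<rho> y u + l * t y u * \<rho> y) * (l * t y v * e y) +
       (dir_d (\<lambda>z. dir_d \<rho> z u) y v + (l * t y u * dir_d \<rho> y v + l * dir_d (\<lambda>z. t z u) y v * \<rho> y)) * e y)) (at y)"
    unfolding dir_d_def
    by (intro has_derivative_mult has_derivative_add has_derivative_mult_right e N(2)
        smooth_on_has_derivative[OF \<rho> N(2)] smooth_on_has_derivative[OF smooth_t y]
        smooth_on_has_derivative[OF smooth_on_frechet_derivative[OF \<rho>] N(2)])
  then have "((\<lambda>z. dir_d m z u) has_derivative
     (\<lambda>v. (dir_d \<rho> y u + l * t y u * \<rho> y) * (l * t y v * e y) +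
       (dir_d (\<lambda>z. dir_d \<rho> z u) y v + (l * t y u * dir_d \<rho> y v + l * dir_d (\<lambda>z. t z u) y v * \<rho> y)) * e y)) (at y)"
    by (rule has_derivative_transform_within_open[OF _ N(1,2)]) (simp add: 1)
  from frechet_derivative_at[OF this, symmetric]
  show "dir_d (\<lambda>z. dir_d m z u) y v = (dir_d (\<lambda>z. dir_d \<rho> z u) y v
      + l * (dir_d (\<lambda>z. t z u) y v * \<rho> y + t y u * dir_d \<rho> y v + t y v * dir_d \<rho> y u)
      + l * l * t y u * t y v * \<rho> y) * e y"
    by (simp add: dir_d_def algebra_simps)
qed

text \<open>Replacing all \<open>E j\<close> by the common value \<open>E0\<close> costs at most
  \<open>\<delta>\<close> times the total weight. With derivatives of a partition of unity as
  weights the comparison sum is zero, so the weighted sum itself is small.\<close>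

lemma weighted_sum_bound:
  fixes a E :: "'i \<Rightarrow> complex"
  assumes near: "\<And>j. j \<in> I \<Longrightarrow> a j = 0 \<or> norm (E j - E0) \<le> \<delta>"
    and C: "(\<Sum>j\<in>I. norm (a j)) \<le> C" and "0 \<le> \<delta>"
  shows "norm ((\<Sum>j\<in>I. a j * E j) - (\<Sum>j\<in>I. a j) * E0) \<le> \<delta> * C"
proof -
  have "(\<Sum>j\<in>I. a j * E j) - (\<Sum>j\<in>I. a j) * E0 = (\<Sum>j\<in>I. a j * (E j - E0))"
    by (simp add: sum_distrib_right sum_subtractf right_diff_distrib)
  also have "norm \<dots> \<le> (\<Sum>j\<in>I. norm (a j) * \<delta>)"
  proof (rule sum_norm_le)
    fix j assume "j \<in> I"
    then show "norm (a j * (E j - E0)) \<le> norm (a j) * \<delta>"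
      using near[of j] by (auto simp: norm_mult intro: mult_left_mono)
  qed
  also have "\<dots> = \<delta> * (\<Sum>j\<in>I. norm (a j))" by (simp add: sum_distrib_left mult.commute)
  also have "\<dots> \<le> \<delta> * C" using C assms(3) by (rule mult_left_mono)
  finally show ?thesis .
qed

text \<open>\<open>F\<close> lies within 1/2 of a unit number, so dividing by it at most doubles a
  norm: this gives the factor 2, and 4 for the square. The extra power of \<open>\<delta>\<close> in
  the quadratic term is absorbed by \<open>\<delta> \<le> 1\<close>.\<close>

lemma log_perturbation_bound:
  fixes F X Y E0 :: complex
  assumes "norm (F - E0) \<le> \<delta>" "norm E0 = 1" "\<delta> \<le> 1/2" "norm X \<le> \<delta> * C" "norm Y \<le> \<delta> * C" "0 \<le> \<delta>" "0 \<le> C"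
  shows "1/2 \<le> norm F" "norm (X / F) \<le> 2 * \<delta> * C" "norm (Y / F - X * X / F\<^sup>2) \<le> \<delta> * (2 * C + 4 * C\<^sup>2)"
proof -
  show F: "1/2 \<le> norm F"
    using norm_triangle_ineq2[of E0 F] assms by (simp add: norm_minus_commute)
  then have F0: "norm F > 0" by linarith
  have div: "norm (Z / F) \<le> 2 * \<delta> * C" if "norm Z \<le> \<delta> * C" for Z
  proof -
    have "norm Z \<le> \<delta> * C * 1" using that by simp
    also have "\<dots> \<le> \<delta> * C * (2 * norm F)" using F assms by (intro mult_left_mono) auto
    finally show ?thesis using F0 by (simp add: norm_divide pos_divide_le_eq mult_ac)
  qed
  show X: "norm (X / F) \<le> 2 * \<delta> * C" using div assms by blast
  have "norm (Y / F - X * X / F\<^sup>2) \<le> norm (Y / F) + norm (X / F) * norm (X / F)"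
    using norm_triangle_ineq4[of "Y / F" "X * X / F\<^sup>2"]
    by (simp add: norm_divide norm_mult power2_eq_square norm_power)
  also have "\<dots> \<le> 2 * \<delta> * C + (2 * \<delta> * C) * (2 * \<delta> * C)"
    using div[OF assms(5)] X assms by (intro add_mono mult_mono) auto
  also have "\<dots> = \<delta> * (2 * C + 4 * C\<^sup>2 * \<delta>)" by (simp add: power2_eq_square algebra_simps)
  also have "\<dots> \<le> \<delta> * (2 * C + 4 * C\<^sup>2 * 1)"
    using assms by (intro mult_left_mono add_left_mono) auto
  finally show "norm (Y / F - X * X / F\<^sup>2) \<le> \<delta> * (2 * C + 4 * C\<^sup>2)" by simp
qed

section \<open>Extension of smooth functions by zero\<close>

context cplx_atlas
begin

lemma smooth_function_sum:
  "(\<And>i. i \<in> I \<Longrightarrow> smooth_function A (f i)) \<Longrightarrow> smooth_function A (\<lambda>p. \<Sum>i\<in>I. f i p)"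
  unfolding smooth_function_def o_def by (intro ballI smooth_on_sum open_cod) auto

lemma smooth_function_divide:
  "smooth_function A f \<Longrightarrow> smooth_function A g \<Longrightarrow> (\<And>p. g p \<noteq> 0) \<Longrightarrow> smooth_function A (\<lambda>p. f p / g p)"
  unfolding smooth_function_def o_def by (intro ballI smooth_on_divide open_cod) auto

lemma closed_chart_inv_image:
  assumes "c \<in> A" "compact K" "K \<subseteq> chart_cod c"
  shows "compact (chart_inv c ` K)" "closed (chart_inv c ` K)"
proof -
  have "continuous_on K (chart_inv c)"
    by (rule continuous_on_subset[OF _ assms(3)]) (use chart_homeo[OF assms(1)] in \<open>simp add: homeomorphism_def\<close>)
  then show "compact (chart_inv c ` K)" using assms(2) by (rule compact_continuous_image)
  then show "closed (chart_inv c ` K)" by (rule compact_imp_closed)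
qed

lemma open_chart_preimage:
  assumes "c \<in> A" "open W"
  shows "open {p \<in> fst c. snd c p \<in> W}"
proof -
  have "continuous_on (fst c) (snd c)" using chart_homeo[OF assms(1)] by (simp add: homeomorphism_def)
  moreover have "{p \<in> fst c. snd c p \<in> W} = fst c \<inter> snd c -` W" by auto
  ultimately show ?thesis using continuous_open_preimage open_dom assms by metis
qed

lemma open_cod_vimage:
  assumes "c \<in> A" "open U"
  shows "open {y \<in> chart_cod c. chart_inv c y \<in> U}"
proof -
  have "continuous_on (chart_cod c) (chart_inv c)" using chart_homeo[OF assms(1)] by (simp add: homeomorphism_def)
  moreover have "{y \<in> chart_cod c. chart_inv c y \<in> U} = chart_cod c \<inter> chart_inv c -` U" by auto
  ultimately show ?thesis using continuous_open_preimage open_cod assms by metis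
qed

text \<open>In any other chart two open sets cover the domain: the points coming from
  \<open>W\<close>, where the function is a composition with a transition map, and those outside the
  image of \<open>K\<close>, where it vanishes. The second set is open because a compact subset of a
  Hausdorff space is closed.\<close>

lemma smooth_function_localized:
  assumes c: "c \<in> A" and W: "open W" "W \<subseteq> chart_cod c" and G: "smooth_on W G"
    and K: "compact K" "K \<subseteq> W" "\<And>x. x \<in> W - K \<Longrightarrow> G x = 0"
  shows "smooth_function A (\<lambda>p. if p \<in> fst c \<and> snd c p \<in> W then G (snd c p) else 0)" (is "smooth_function A ?f")
  unfolding smooth_function_def
proof
  fix c' assume c': "c' \<in> A"
  let ?S = "{y \<in> overlap c' c. transition c' c y \<in> W}"
  let ?T = "{y \<in> chart_cod c'. chart_inv c' y \<in> - chart_inv c ` K}"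
  have oS: "open ?S"
  proof -
    have "?S = overlap c' c \<inter> transition c' c -` W" by auto
    then show ?thesis
      using continuous_open_preimage[OF smooth_on_imp_continuous_on[OF smooth_transition[OF c' c]] open_overlap[OF c' c] W(1)]
      by simp
  qed
  have oT: "open ?T"
    using open_cod_vimage[OF c', of "- chart_inv c ` K"] closed_chart_inv_image(2)[OF c K(1)] K(2) W(2) by auto
  have eqS: "(?f \<circ> chart_inv c') y = G (transition c' c y)" if "y \<in> ?S" for y
    using that overlap_iff[OF c', of y c] by (auto simp: transition_def)
  have sS: "smooth_on ?S (?f \<circ> chart_inv c')"
    by (rule smooth_on_cong[OF oS eqS[symmetric]], assumption,
        rule smooth_on_compose[OF oS W(1) _ G smooth_on_subset[OF smooth_transition[OF c' c]]]) auto
  have "(?f \<circ> chart_inv c') y = 0" if "y \<in> ?T" for y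
  proof (rule ccontr)
    assume "(?f \<circ> chart_inv c') y \<noteq> 0"
    then have p: "chart_inv c' y \<in> fst c" "snd c (chart_inv c' y) \<in> W" "G (snd c (chart_inv c' y)) \<noteq> 0"
      by (auto split: if_splits)
    then have "chart_inv c (snd c (chart_inv c' y)) \<in> chart_inv c ` K" using K(3) by blast
    then show False using that p c by simp
  qed
  then have sT: "smooth_on ?T (?f \<circ> chart_inv c')"
    by (intro smooth_on_cong[OF oT _ smooth_on_const[of _ 0]]) simp
  have "chart_cod c' \<subseteq> ?S \<union> ?T"
  proof
    fix y assume y: "y \<in> chart_cod c'"
    show "y \<in> ?S \<union> ?T"
    proof (cases "chart_inv c' y \<in> chart_inv c ` K")
      case True
      then obtain x where x: "x \<in> K" "chart_inv c' y = chart_inv c x" by blast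
      then have "x \<in> chart_cod c" using K(2) W(2) by blast
      then have "chart_inv c' y \<in> fst c" "snd c (chart_inv c' y) = x"
        using x chart_inv_in[OF c] c by auto
      then show ?thesis using y x K(2) overlap_iff[OF c', of y c] by (auto simp: transition_def)
    qed (use y in auto)
  qed
  then show "smooth_on (chart_cod c') (?f \<circ> chart_inv c')"
    using smooth_on_Un[OF oS oT sS sT] smooth_on_subset by blast
qed

end

text \<open>The small balls already cover, while the charts contain closed balls of twice the
  radius. The margin leaves room for bumps with compact support and for primitives defined on a
  neighbourhood of that support.\<close>

locale chart_cover = cplx_atlas A for A :: "('m::t2_space, 'n::finite) chart set" +
  fixes I :: "'i set" and ch :: "'i \<Rightarrow> ('m, 'n) chart" and ce :: "'i \<Rightarrow> complex^'n" and ra :: "'i \<Rightarrow> real"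
  assumes finite_I: "finite I"
    and ch: "i \<in> I \<Longrightarrow> ch i \<in> A"
    and ra: "i \<in> I \<Longrightarrow> ra i > 0"
    and cball_cod: "i \<in> I \<Longrightarrow> cball (ce i) (2 * ra i) \<subseteq> chart_cod (ch i)"
    and cover: "\<exists>i\<in>I. p \<in> fst (ch i) \<and> snd (ch i) p \<in> ball (ce i) (ra i)"
begin

definition patch :: "'i \<Rightarrow> 'm set" where
  "patch i = {p \<in> fst (ch i). snd (ch i) p \<in> ball (ce i) (2 * ra i)}"

text \<open>A compact set carrying the bump. Working on intersections of cores rather than of
  patches is what makes the differences of primitives take finitely many values.\<close>

definition core :: "'i \<Rightarrow> 'm set" where
  "core i = chart_inv (ch i) ` cball (ce i) (ra i)"

definition bump :: "'i \<Rightarrow> 'm \<Rightarrow> complex" where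
  "bump i p = (if p \<in> patch i then of_real (ball_bump (ce i) (ra i) (snd (ch i) p)) else 0)"

definition rho :: "'i \<Rightarrow> 'm \<Rightarrow> complex" where
  "rho i p = bump i p / (\<Sum>j\<in>I. bump j p)"

lemma cball_ra_subset: "i \<in> I \<Longrightarrow> cball (ce i) (ra i) \<subseteq> ball (ce i) (2 * ra i)"
  using ra[of i] by auto

lemma ball_cod: "i \<in> I \<Longrightarrow> ball (ce i) (2 * ra i) \<subseteq> chart_cod (ch i)"
  using cball_cod[of i] ball_subset_cball[of "ce i" "2 * ra i"] by blast

lemma core_iff:
  assumes i: "i \<in> I"
  shows "p \<in> core i \<longleftrightarrow> p \<in> fst (ch i) \<and> snd (ch i) p \<in> cball (ce i) (ra i)"
proof
  assume "p \<in> core i"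
  then obtain x where x: "x \<in> cball (ce i) (ra i)" "p = chart_inv (ch i) x" by (auto simp: core_def)
  then have "x \<in> chart_cod (ch i)" using cball_ra_subset[OF i] ball_cod[OF i] by blast
  then show "p \<in> fst (ch i) \<and> snd (ch i) p \<in> cball (ce i) (ra i)"
    using x chart_inv_in[OF ch[OF i]] snd_chart_inv[OF ch[OF i]] by simp
next
  assume "p \<in> fst (ch i) \<and> snd (ch i) p \<in> cball (ce i) (ra i)"
  then show "p \<in> core i"
    unfolding core_def using chart_inv_snd[OF ch[OF i], of p] by (metis imageI)
qed

lemma core_subset: "i \<in> I \<Longrightarrow> core i \<subseteq> patch i"
  using core_iff[of i] cball_ra_subset[of i] by (auto simp: patch_def)

lemma compact_core: "i \<in> I \<Longrightarrow> compact (core i)" and closed_core: "i \<in> I \<Longrightarrow> closed (core i)"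
  unfolding core_def using closed_chart_inv_image[OF ch, of i "cball (ce i) (ra i)"]
    ball_cod[of i] cball_ra_subset[of i] by auto

lemma bump_outside: "i \<in> I \<Longrightarrow> p \<notin> core i \<Longrightarrow> bump i p = 0"
  using core_iff[of i p] ball_bump_pos_iff[OF ra, of i "ce i" "snd (ch i) p"]
    ball_bump_nonneg[of "ce i" "ra i" "snd (ch i) p"] by (auto simp: bump_def patch_def)

lemma smooth_localized_bump:
  assumes i: "i \<in> I" and g: "smooth_on (ball (ce i) (2 * ra i)) g"
  shows "smooth_function A (\<lambda>p. bump i p * g (snd (ch i) p))"
proof -
  have "smooth_function A (\<lambda>p. if p \<in> fst (ch i) \<and> snd (ch i) p \<in> ball (ce i) (2 * ra i)
    then of_real (ball_bump (ce i) (ra i) (snd (ch i) p)) * g (snd (ch i) p) else 0)"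
  proof (rule smooth_function_localized[OF ch[OF i] open_ball ball_cod[OF i] _ compact_cball cball_ra_subset[OF i]])
    show "smooth_on (ball (ce i) (2 * ra i)) (\<lambda>x. of_real (ball_bump (ce i) (ra i) x) * g x)"
      by (intro smooth_on_mult smooth_on_of_real g open_ball smooth_on_subset[OF smooth_on_ball_bump]) auto
    show "of_real (ball_bump (ce i) (ra i) x) * g x = 0" if "x \<in> ball (ce i) (2 * ra i) - cball (ce i) (ra i)" for x
      using that ball_bump_pos_iff[OF ra[OF i], of "ce i" x] ball_bump_nonneg[of "ce i" "ra i" x] by auto
  qed
  then show ?thesis
    by (rule back_subst[of "smooth_function A"]) (auto simp: bump_def patch_def fun_eq_iff)
qed

lemma smooth_bump: "i \<in> I \<Longrightarrow> smooth_function A (bump i)"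
  using smooth_localized_bump[OF _ smooth_on_const[of _ 1]] by simp

lemma bump_sum_nonzero: "(\<Sum>j\<in>I. bump j p) \<noteq> 0"
proof -
  obtain i where i: "i \<in> I" "p \<in> fst (ch i)" "snd (ch i) p \<in> ball (ce i) (ra i)" using cover by blast
  have "0 \<le> Re (bump j p)" for j by (simp add: bump_def ball_bump_nonneg)
  moreover have "0 < Re (bump i p)"
    using ball_bump_pos_iff[OF ra[OF i(1)], of "ce i" "snd (ch i) p"] i(2,3) ra[OF i(1)]
    by (simp add: bump_def patch_def)
  ultimately have "0 < (\<Sum>j\<in>I. Re (bump j p))" using finite_I i(1) by (intro sum_pos2[of _ i]) auto
  then have "Re (\<Sum>j\<in>I. bump j p) \<noteq> 0" by simp
  then show ?thesis by (metis zero_complex.simps(1))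
qed

lemma smooth_rho: "i \<in> I \<Longrightarrow> smooth_function A (rho i)"
  unfolding rho_def[abs_def] by (intro smooth_function_divide smooth_function_sum smooth_bump bump_sum_nonzero)

lemma rho_sum: "(\<Sum>i\<in>I. rho i p) = 1"
  using bump_sum_nonzero[of p] by (simp add: rho_def sum_divide_distrib[symmetric])

lemma rho_norm_sum: "(\<Sum>i\<in>I. norm (rho i p)) = 1"
proof -
  define b where "b i = Re (bump i p)" for i
  have b: "bump i p = of_real (b i)" "b i \<ge> 0" for i by (auto simp: b_def bump_def ball_bump_nonneg)
  have r: "rho i p = of_real (b i / sum b I)" for i by (simp add: rho_def b(1))
  have nonneg: "b i / sum b I \<ge> 0" for i using b(2) by (simp add: sum_nonneg)
  have "complex_of_real (\<Sum>i\<in>I. b i / sum b I) = (\<Sum>i\<in>I. rho i p)" by (simp only: r of_real_sum)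
  then have "(\<Sum>i\<in>I. b i / sum b I) = 1" unfolding rho_sum by (simp only: of_real_eq_1_iff)
  moreover have "norm (rho i p) = b i / sum b I" for i unfolding r norm_of_real using nonneg by (rule abs_of_nonneg)
  ultimately show ?thesis by simp
qed

lemma rho_outside: "i \<in> I \<Longrightarrow> p \<notin> core i \<Longrightarrow> rho i p = 0"
  by (simp add: rho_def bump_outside)

end

section \<open>Compactness, approximation and continuity tools\<close>

lemma finite_image_locally_constant:
  assumes "compact K" "\<And>p. p \<in> K \<Longrightarrow> \<exists>U. open U \<and> p \<in> U \<and> (\<forall>p'\<in>U. f p' = f p)"
  shows "finite (f ` K)"
proof -
  obtain U where U: "\<And>p. p \<in> K \<Longrightarrow> open (U p) \<and> p \<in> U p \<and> (\<forall>p'\<in>U p. f p' = f p)"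
    using assms(2) by metis
  obtain D where D: "D \<subseteq> K" "finite D" "K \<subseteq> (\<Union>p\<in>D. U p)"
    by (rule compactE_image[OF assms(1), of K U]) (use U in auto)
  have "f ` K \<subseteq> f ` D"
  proof
    fix y assume "y \<in> f ` K"
    then obtain p where p: "p \<in> K" "y = f p" by blast
    then obtain d where "d \<in> D" "p \<in> U d" using D(3) by blast
    then show "y \<in> f ` D" using U[of d] D(1) p(2) by blast
  qed
  then show ?thesis using D(2) finite_surj by blast
qed

lemma dir_d_sum:
  "(\<And>i. i \<in> I \<Longrightarrow> f i differentiable (at x)) \<Longrightarrow> dir_d (\<lambda>y. \<Sum>i\<in>I. f i y) x u = (\<Sum>i\<in>I. dir_d (f i) x u)"
  unfolding dir_d_def
  by (subst frechet_derivative_at[symmetric, OF has_derivative_sum[of I f "\<lambda>i. frechet_derivative (f i) (at x)"]])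
     (auto simp: frechet_derivative_works)

lemma dir_d_cong:
  "open S \<Longrightarrow> x \<in> S \<Longrightarrow> (\<And>y. y \<in> S \<Longrightarrow> f y = g y) \<Longrightarrow> dir_d f x u = dir_d g x u"
  unfolding dir_d_def by (subst frechet_derivative_cong_open[of S x f g]) auto

lemma dir_d_eq_0: "open S \<Longrightarrow> x \<in> S \<Longrightarrow> (\<And>y. y \<in> S \<Longrightarrow> f y = 0) \<Longrightarrow> dir_d f x u = 0"
  using dir_d_cong[of S x f "\<lambda>y. 0" u] by (simp add: dir_d_def)

lemma norm_exp_i_diff_int:
  fixes x :: real and n :: int
  shows "norm (exp (\<i> * of_real (2 * pi * x)) - 1) \<le> 2 * pi * \<bar>x - of_int n\<bar>"
proof -
  have "exp (\<i> * of_real (2 * pi * x)) = exp (\<i> * of_real (2 * pi * (x - of_int n)))"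
    by (subst exp_eq) (auto simp: algebra_simps intro!: exI[of _ n])
  then have "norm (exp (\<i> * of_real (2 * pi * x)) - 1) = 2 * \<bar>sin (pi * (x - of_int n))\<bar>"
    using dist_exp_i_1[of "2 * pi * (x - of_int n)"] by simp
  also have "\<dots> \<le> 2 * \<bar>pi * (x - of_int n)\<bar>" using abs_sin_x_le_abs_x by (intro mult_left_mono) auto
  finally show ?thesis by (simp add: abs_mult)
qed

lemma simultaneous_approximation:
  fixes C :: "real set" and N :: nat
  assumes "finite C" "N > 0"
  shows "\<exists>q::nat. q > 0 \<and> (\<forall>x\<in>C. \<exists>n::int. \<bar>real q * x - of_int n\<bar> < 1 / real N)"
proof -
  obtain f and k :: nat where C: "C = f ` {i. i < k}"
    using finite_imp_nat_seg_image_inj_on[OF assms(1)] by metis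
  obtain q p where q: "0 < q" "\<And>i. i < k \<Longrightarrow> \<bar>of_int q * f i - of_int (p i)\<bar> < 1 / real N"
    using Dirichlet_approx_simult[OF assms(2), of k f] by metis
  have "\<exists>n::int. \<bar>real (nat q) * x - of_int n\<bar> < 1 / real N" if "x \<in> C" for x
    using that q C by auto
  then show ?thesis using q(1) by (intro exI[of _ "nat q"]) simp
qed

lemma compact_product_sphere_bounded:
  fixes g :: "'a::metric_space \<Rightarrow> 'b::euclidean_space \<Rightarrow> complex"
  assumes "compact K" "continuous_on (S \<times> UNIV) (\<lambda>p. g (fst p) (snd p))" "K \<subseteq> S"
  shows "\<exists>B. \<forall>x u. x \<in> K \<longrightarrow> norm u = 1 \<longrightarrow> norm (g x u) \<le> B"
proof -
  have "continuous_on (K \<times> sphere 0 1) (\<lambda>p. g (fst p) (snd p))"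
    by (rule continuous_on_subset[OF assms(2)]) (use assms(3) in auto)
  then have "bounded ((\<lambda>p. g (fst p) (snd p)) ` (K \<times> sphere 0 1))"
    using assms(1) by (intro compact_imp_bounded compact_continuous_image compact_Times) auto
  then obtain B where B: "\<And>p. p \<in> K \<times> sphere 0 1 \<Longrightarrow> norm (g (fst p) (snd p)) \<le> B"
    unfolding bounded_iff by blast
  have "norm (g x u) \<le> B" if "x \<in> K" "norm u = 1" for x u
    using B[of "(x, u)"] that by auto
  then show ?thesis by blast
qed

lemma compact_product_sphere_positive:
  fixes g :: "'a::metric_space \<Rightarrow> 'b::euclidean_space \<Rightarrow> real"
  assumes "compact K" "continuous_on (S \<times> UNIV) (\<lambda>p. g (fst p) (snd p))" "K \<subseteq> S"
    and pos: "\<And>x u. x \<in> K \<Longrightarrow> u \<noteq> 0 \<Longrightarrow> g x u > 0"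
  shows "\<exists>m>0. \<forall>x u. x \<in> K \<longrightarrow> norm u = 1 \<longrightarrow> m \<le> g x u"
proof (cases "K = {}")
  case False
  have "continuous_on (K \<times> sphere 0 1) (\<lambda>p. g (fst p) (snd p))"
    by (rule continuous_on_subset[OF assms(2)]) (use assms(3) in auto)
  moreover have "K \<times> sphere (0::'b) 1 \<noteq> {}" using False by auto
  moreover have "compact (K \<times> sphere (0::'b) 1)" using assms(1) by (intro compact_Times) auto
  ultimately have "\<exists>p\<in>K \<times> sphere 0 1. \<forall>p'\<in>K \<times> sphere 0 1. g (fst p) (snd p) \<le> g (fst p') (snd p')"
    by (intro continuous_attains_inf)
  then obtain p where p: "p \<in> K \<times> sphere 0 1" "\<forall>p'\<in>K \<times> sphere 0 1. g (fst p) (snd p) \<le> g (fst p') (snd p')"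
    by blast
  have "0 < g (fst p) (snd p)" using p(1) by (intro pos) auto
  moreover have "g (fst p) (snd p) \<le> g x u" if "x \<in> K" "norm u = 1" for x u
    using p(2) that by auto
  ultimately show ?thesis by blast
qed (auto intro: exI[of _ 1])

text \<open>\<open>continuous_on_linear_slot\<close> is applied once per argument. \<open>L\<close>
  is minus multiplication by \<open>\<i>\<close> for the Hermitian quadratic form and the identity
  for the second derivative.\<close>

lemma continuous_on_bilinear_diagonal:
  fixes b :: "'x::topological_space \<Rightarrow> 'a::euclidean_space \<Rightarrow> 'a \<Rightarrow> 'b::real_normed_vector"
  assumes "\<And>x v. x \<in> S \<Longrightarrow> linear (\<lambda>u. b x u v)" "\<And>x u. x \<in> S \<Longrightarrow> linear (\<lambda>v. b x u v)"
    and "\<And>u v. continuous_on S (\<lambda>x. b x u v)" and L: "linear L"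
  shows "continuous_on (S \<times> UNIV) (\<lambda>p. b (fst p) (L (snd p)) (snd p))"
proof -
  have "continuous_on (S \<times> UNIV) (\<lambda>p. b (fst p) (snd p) v)" for v
    using continuous_on_linear_slot[of S "\<lambda>x u. b x u v"] assms by blast
  then have "continuous_on ((S \<times> UNIV) \<times> UNIV) (\<lambda>r. b (fst (fst r)) (snd (fst r)) (snd r))"
    using continuous_on_linear_slot[of "S \<times> UNIV" "\<lambda>p v. b (fst p) (snd p) v"] assms by auto
  moreover have "bounded_linear L" using L linear_conv_bounded_linear by blast
  then have "continuous_on (S \<times> UNIV) (\<lambda>p. L (snd p))"
    by (rule bounded_linear.continuous_on) (intro continuous_intros)
  then have "continuous_on (S \<times> UNIV) (\<lambda>p. ((fst p, L (snd p)), snd p))"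
    by (intro continuous_on_Pair continuous_on_fst continuous_on_snd continuous_on_id)
  ultimately have "continuous_on (S \<times> UNIV) (\<lambda>p. (\<lambda>r. b (fst (fst r)) (snd (fst r)) (snd r)) ((fst p, L (snd p)), snd p))"
    by (rule continuous_on_compose2) auto
  then show ?thesis by simp
qed

lemma (in cplx_atlas) jac_inverse:
  assumes cc: "c \<in> A" "c' \<in> A" and x: "x \<in> overlap c c'"
  shows "jac c' c (transition c c' x) (jac c c' x u) = u"
proof -
  have "((\<lambda>y. transition c' c (transition c c' y)) has_derivative (\<lambda>u. jac c' c (transition c c' x) (jac c c' x u))) (at x)"
    by (rule has_derivative_compose[OF has_derivative_transition[OF cc x]
          has_derivative_transition[OF cc(2,1) transition_in[OF cc x]]])
  moreover have "transition c' c (transition c c' y) = y" if "y \<in> overlap c c'" for y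
    using that by (auto simp: overlap_def transition_app[OF cc] transition_app[OF cc(2,1)])
  ultimately have "((\<lambda>y. y) has_derivative (\<lambda>u. jac c' c (transition c c' x) (jac c c' x u))) (at x)"
    by (rule has_derivative_transform_within_open[OF _ open_overlap[OF cc] x])
  from has_derivative_unique[OF this has_derivative_ident] show ?thesis by metis
qed

section \<open>Local primitives of the Lee form and the glued function\<close>

locale gauge_cover = chart_cover A I ch ce ra
  for A :: "('m::t2_space, 'n::finite) chart set" and I :: "'i set" and ch ce ra +
  fixes \<theta> :: "('m, 'n) tensor" and pr :: "'i \<Rightarrow> complex^'n \<Rightarrow> real"
  assumes closed_\<theta>: "closed_real_1form A \<theta>"
    and pr: "i \<in> I \<Longrightarrow> x \<in> ball (ce i) (2 * ra i) \<Longrightarrow> (pr i has_derivative (\<lambda>u. Re (\<theta> (ch i) x [u]))) (at x)"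
begin

lemma cov_\<theta>: "covariant_tensor A 1 \<theta>"
  using closed_\<theta> by (simp add: closed_real_1form_def differential_form_def)

lemma real_\<theta>: "of_real (Re (\<theta> c x vs)) = \<theta> c x vs"
  using closed_\<theta> unfolding closed_real_1form_def real_tensor_def by (metis of_real_Re)

lemma smooth_pr: "i \<in> I \<Longrightarrow> smooth_on (ball (ce i) (2 * ra i)) (pr i)"
  by (rule smooth_onI_derivative[OF open_ball pr])
     (auto intro: smooth_on_Re smooth_on_subset[OF covariant_tensor_1D(2)[OF cov_\<theta> ch] ball_cod])

text \<open>Meaningful on \<open>patch i\<close> only. Elsewhere the value is arbitrary, but there
  \<open>rho i\<close> vanishes; \<open>gauge\<close> still has norm 1 everywhere.\<close>

definition prim :: "'i \<Rightarrow> 'm \<Rightarrow> real" where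
  "prim i p = pr i (snd (ch i) p)"

definition gauge :: "nat \<Rightarrow> 'i \<Rightarrow> 'm \<Rightarrow> complex" where
  "gauge q i p = exp (\<i> * of_real (2 * pi * q * prim i p))"

definition cutoff_gauge :: "nat \<Rightarrow> 'i \<Rightarrow> 'm \<Rightarrow> complex" where
  "cutoff_gauge q i p = rho i p * gauge q i p"

definition total_gauge :: "nat \<Rightarrow> 'm \<Rightarrow> complex" where
  "total_gauge q p = (\<Sum>i\<in>I. cutoff_gauge q i p)"

lemma smooth_cutoff_gauge:
  assumes "i \<in> I"
  shows "smooth_function A (cutoff_gauge q i)"
proof -
  have "smooth_on (ball (ce i) (2 * ra i)) (\<lambda>x. exp (\<i> * of_real (2 * pi * q * pr i x)))"
    by (intro smooth_on_exp smooth_on_mult smooth_on_of_real smooth_on_const smooth_pr assms open_ball)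
  from smooth_localized_bump[OF assms this]
  have "smooth_function A (\<lambda>p. bump i p * gauge q i p)" by (simp add: gauge_def prim_def)
  then have "smooth_function A (\<lambda>p. (bump i p * gauge q i p) / (\<Sum>j\<in>I. bump j p))"
    by (intro smooth_function_divide smooth_function_sum smooth_bump bump_sum_nonzero)
  then show ?thesis by (simp add: cutoff_gauge_def[abs_def] rho_def)
qed

lemma smooth_total_gauge: "smooth_function A (total_gauge q)"
  unfolding total_gauge_def[abs_def] by (intro smooth_function_sum smooth_cutoff_gauge)

text \<open>Both functions are primitives of the same form, so after passing to the chart of
  \<open>i\<close> their difference has zero derivative. It is constant on a small ball, which is
  convex; the overlap itself need not be connected.\<close>

lemma prim_diff_locally_constant:
  assumes ij: "i \<in> I" "j \<in> I" and p: "p \<in> patch i" "p \<in> patch j"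
  shows "\<exists>U. open U \<and> p \<in> U \<and> (\<forall>p'\<in>U. prim i p' - prim j p' = prim i p - prim j p)"
proof -
  note cc = ch[OF ij(1)] ch[OF ij(2)]
  let ?\<tau> = "transition (ch i) (ch j)" and ?O = "overlap (ch i) (ch j)"
  let ?W = "ball (ce i) (2 * ra i) \<inter> (?O \<inter> ?\<tau> -` ball (ce j) (2 * ra j))"
  have "open ?W"
    by (rule open_Int[OF open_ball],
        rule continuous_open_preimage[OF smooth_on_imp_continuous_on[OF smooth_transition[OF cc]] open_overlap[OF cc] open_ball])
  moreover have "snd (ch i) p \<in> ?W"
    using p by (auto simp: patch_def transition_app[OF cc] overlap_def)
  ultimately obtain s where s: "s > 0" "ball (snd (ch i) p) s \<subseteq> ?W" using open_contains_ball by metis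
  have D: "((\<lambda>z. pr i z - pr j (?\<tau> z)) has_derivative (\<lambda>u. 0)) (at z within ball (snd (ch i) p) s)"
    if "z \<in> ball (snd (ch i) p) s" for z
  proof -
    have z: "z \<in> ball (ce i) (2 * ra i)" "z \<in> ?O" "?\<tau> z \<in> ball (ce j) (2 * ra j)" using that s(2) by auto
    have "((\<lambda>z. pr i z - pr j (?\<tau> z)) has_derivative
        (\<lambda>u. Re (\<theta> (ch i) z [u]) - Re (\<theta> (ch j) (?\<tau> z) [jac (ch i) (ch j) z u]))) (at z)"
      by (intro has_derivative_diff pr ij z has_derivative_compose[OF has_derivative_transition[OF cc z(2)] pr[OF ij(2) z(3)]])
    then show ?thesis
      using covariant_tensor_1D(3)[OF cov_\<theta> cc z(2)] by (simp add: has_derivative_at_withinI)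
  qed
  let ?U = "{p' \<in> fst (ch i). snd (ch i) p' \<in> ball (snd (ch i) p) s}"
  have "prim i p' - prim j p' = prim i p - prim j p" if p': "p' \<in> ?U" for p'
  proof -
    have "snd (ch i) p' \<in> ?O" using p' s(2) by auto
    then have e: "?\<tau> (snd (ch i) q) = snd (ch j) q" if "q \<in> {p, p'}" for q
      using that p p' by (auto simp: transition_app[OF cc] patch_def)
    have "pr i (snd (ch i) p') - pr j (?\<tau> (snd (ch i) p')) = pr i (snd (ch i) p) - pr j (?\<tau> (snd (ch i) p))"
      using p' s(1) by (intro has_derivative_zero_unique[OF convex_ball D]) auto
    then show ?thesis by (simp add: prim_def e)
  qed
  moreover have "open ?U" by (rule open_chart_preimage[OF cc(1) open_ball])
  moreover have "p \<in> ?U" using p s(1) by (auto simp: patch_def)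
  ultimately show ?thesis by blast
qed

text \<open>Overlaps of patches could have infinitely many components, so local constancy alone
  would not give a finite set; compactness of the intersected cores does.\<close>

lemma finite_prim_diff: "finite (\<Union>i\<in>I. \<Union>j\<in>I. (\<lambda>p. prim i p - prim j p) ` (core i \<inter> core j))"
proof (intro finite_UN_I finite_I finite_image_locally_constant)
  fix i j assume ij: "i \<in> I" "j \<in> I"
  show "compact (core i \<inter> core j)" using ij compact_core closed_core by (intro compact_Int_closed)
  fix p assume "p \<in> core i \<inter> core j"
  then show "\<exists>U. open U \<and> p \<in> U \<and> (\<forall>p'\<in>U. prim i p' - prim j p' = prim i p - prim j p)"
    using core_subset ij by (intro prim_diff_locally_constant) auto
qed

lemma norm_gauge [simp]: "norm (gauge q i p) = 1"
  by (simp add: gauge_def)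

lemma gauges_almost_agree:
  assumes "N > 0"
  obtains q where "q > 0" "\<And>i j p. i \<in> I \<Longrightarrow> j \<in> I \<Longrightarrow> p \<in> core i \<Longrightarrow> p \<in> core j \<Longrightarrow>
    norm (gauge q j p - gauge q i p) \<le> 2 * pi / real N"
proof -
  define C where "C = (\<Union>i\<in>I. \<Union>j\<in>I. (\<lambda>p. prim i p - prim j p) ` (core i \<inter> core j))"
  have "finite C" unfolding C_def by (rule finite_prim_diff)
  from simultaneous_approximation[OF this assms]
  obtain q where q: "q > 0" "\<forall>x\<in>C. \<exists>n::int. \<bar>real q * x - of_int n\<bar> < 1 / real N" by blast
  have "norm (gauge q j p - gauge q i p) \<le> 2 * pi / real N"
    if ij: "i \<in> I" "j \<in> I" "p \<in> core i" "p \<in> core j" for i j p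
  proof -
    let ?x = "real q * (prim j p - prim i p)"
    obtain n :: int where n: "\<bar>?x - of_int n\<bar> < 1 / real N" 
    proof -
      have "prim j p - prim i p \<in> C" using ij by (auto simp: C_def)
      then show thesis using q(2) that by blast
    qed
    \<comment> \<open>The ratio of two gauges depends only on the difference of the primitives, one
      of the finitely many numbers in \<open>C\<close>.\<close>
    have "gauge q j p = exp (\<i> * of_real (2 * pi * ?x)) * gauge q i p"
      unfolding gauge_def exp_add[symmetric] by (simp add: algebra_simps)
    then have "gauge q j p - gauge q i p = (exp (\<i> * of_real (2 * pi * ?x)) - 1) * gauge q i p"
      by (simp add: algebra_simps)
    then have "norm (gauge q j p - gauge q i p) = norm (exp (\<i> * of_real (2 * pi * ?x)) - 1)"
      by (simp only: norm_mult norm_gauge mult_1_right)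
    also have "\<dots> \<le> 2 * pi * \<bar>?x - of_int n\<bar>" by (rule norm_exp_i_diff_int)
    also have "\<dots> \<le> 2 * pi * (1 / real N)" using n by (intro mult_left_mono) auto
    finally show ?thesis by simp
  qed
  then show thesis using that q(1) by blast
qed

end

section \<open>The perturbed Lee form\<close>

context gauge_cover
begin

lemma smooth_chart_rho: "c \<in> A \<Longrightarrow> j \<in> I \<Longrightarrow> smooth_on (chart_cod c) (rho j \<circ> chart_inv c)"
  and smooth_chart_cutoff_gauge: "c \<in> A \<Longrightarrow> j \<in> I \<Longrightarrow> smooth_on (chart_cod c) (cutoff_gauge q j \<circ> chart_inv c)"
  using smooth_rho smooth_cutoff_gauge unfolding smooth_function_def by blast+

section \<open>Derivatives of the glued function in a chart\<close>

context
  fixes c y assumes c: "c \<in> A" and y: "y \<in> chart_cod c"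
begin

text \<open>\<open>core j\<close> is closed, so a point outside it has a neighbourhood on which
  \<open>rho j\<close> vanishes identically. A gauge therefore enters a derivative at a point only
  if that point lies in its core, where the gauges are known to nearly agree.\<close>

lemma rho_derivative_outside:
  assumes j: "j \<in> I" and "chart_inv c y \<notin> core j"
  shows "dir_d (rho j \<circ> chart_inv c) y u = 0" "dir_d (\<lambda>z. dir_d (rho j \<circ> chart_inv c) z u) y v = 0"
    and "dir_d (cutoff_gauge q j \<circ> chart_inv c) y u = 0"
    and "dir_d (\<lambda>z. dir_d (cutoff_gauge q j \<circ> chart_inv c) z u) y v = 0"
proof -
  let ?N = "{z \<in> chart_cod c. chart_inv c z \<in> - core j}"
  have N: "open ?N" "y \<in> ?N"
    using open_cod_vimage[OF c open_Compl[OF closed_core[OF j]]] assms(2) y by blast+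
  have 0: "(rho j \<circ> chart_inv c) z = 0" "(cutoff_gauge q j \<circ> chart_inv c) z = 0" if "z \<in> ?N" for z
    using that rho_outside[OF j] by (auto simp: cutoff_gauge_def)
  have 1: "dir_d (rho j \<circ> chart_inv c) z u = 0" "dir_d (cutoff_gauge q j \<circ> chart_inv c) z u = 0" if "z \<in> ?N" for z
    by (rule dir_d_eq_0[OF N(1) that 0(1)], assumption, rule dir_d_eq_0[OF N(1) that 0(2)], assumption)
  show "dir_d (rho j \<circ> chart_inv c) y u = 0" "dir_d (cutoff_gauge q j \<circ> chart_inv c) y u = 0"
    using 1 N(2) by blast+
  show "dir_d (\<lambda>z. dir_d (rho j \<circ> chart_inv c) z u) y v = 0"
    by (rule dir_d_eq_0[OF N]) (rule 1)
  show "dir_d (\<lambda>z. dir_d (cutoff_gauge q j \<circ> chart_inv c) z u) y v = 0"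
    by (rule dir_d_eq_0[OF N]) (rule 1)
qed

text \<open>Inside the patch the gauge solves the equation of \<open>gauge_product\<close>. Outside
  it the gauge need not be differentiable, but all derivatives of the cut-off product and of
  \<open>rho j\<close> are zero there, so the same formula holds.\<close>

lemma cutoff_gauge_derivative:
  fixes q :: nat
  assumes j: "j \<in> I"
  defines "\<rho> \<equiv> rho j \<circ> chart_inv c" and "m \<equiv> cutoff_gauge q j \<circ> chart_inv c"
    and "l \<equiv> \<i> * of_real (2 * pi * q)" and "t \<equiv> \<lambda>x u. \<theta> c x [u]" and "E \<equiv> gauge q j (chart_inv c y)"
  shows "dir_d m y u = (dir_d \<rho> y u + l * t y u * \<rho> y) * E"
    and "dir_d (\<lambda>z. dir_d m z u) y v = (dir_d (\<lambda>z. dir_d \<rho> z u) y v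
      + l * (dir_d (\<lambda>z. t z u) y v * \<rho> y + t y u * dir_d \<rho> y v + t y v * dir_d \<rho> y u)
      + l * l * t y u * t y v * \<rho> y) * E"
proof -
  interpret t: local_1form "chart_cod c" t unfolding t_def by (rule local_1form_chart[OF closed_\<theta> c])
  have "dir_d m y u = (dir_d \<rho> y u + l * t y u * \<rho> y) * E \<and>
    dir_d (\<lambda>z. dir_d m z u) y v = (dir_d (\<lambda>z. dir_d \<rho> z u) y v
      + l * (dir_d (\<lambda>z. t z u) y v * \<rho> y + t y u * dir_d \<rho> y v + t y v * dir_d \<rho> y u)
      + l * l * t y u * t y v * \<rho> y) * E"
  proof (cases "chart_inv c y \<in> patch j")
    case True
    note cc = c ch[OF j]
    let ?\<tau> = "transition c (ch j)" and ?O = "overlap c (ch j)"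
    let ?N = "?O \<inter> ?\<tau> -` ball (ce j) (2 * ra j)"
    have N: "open ?N"
      by (rule continuous_open_preimage[OF smooth_on_imp_continuous_on[OF smooth_transition[OF cc]] open_overlap[OF cc] open_ball])
    have yN: "y \<in> ?N"
      using True overlap_iff[OF c, of y "ch j"] y by (auto simp: patch_def transition_def)
    have Ncod: "?N \<subseteq> chart_cod c" using overlap_subset by blast
    have "smooth_on (chart_cod c) \<rho>" unfolding \<rho>_def by (rule smooth_chart_rho[OF c j])
    then have sm: "smooth_on ?N \<rho>" using Ncod smooth_on_subset by blast
    let ?e = "\<lambda>z. gauge q j (chart_inv c z)"
    have e: "(?e has_derivative (\<lambda>u. l * t z u * ?e z)) (at z)" if z: "z \<in> ?N" for z
    proof -
      have "((\<lambda>z. pr j (?\<tau> z)) has_derivative (\<lambda>u. Re (\<theta> (ch j) (?\<tau> z) [jac c (ch j) z u]))) (at z)"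
        by (rule has_derivative_compose[OF has_derivative_transition[OF cc] pr[OF j]]) (use z in auto)
      also have "(\<lambda>u. Re (\<theta> (ch j) (?\<tau> z) [jac c (ch j) z u])) = (\<lambda>u. Re (t z u))"
        using covariant_tensor_1D(3)[OF cov_\<theta> cc] z by (simp add: t_def)
      finally have "((\<lambda>z. l * of_real (pr j (?\<tau> z))) has_derivative (\<lambda>u. l * of_real (Re (t z u)))) (at z)"
        by (intro has_derivative_mult_right has_derivative_of_real)
      then have "((\<lambda>z. l * of_real (pr j (?\<tau> z))) has_derivative (\<lambda>u. l * t z u)) (at z)"
        by (simp add: t_def real_\<theta>)
      moreover have "(exp has_derivative (\<lambda>w. exp (l * of_real (pr j (?\<tau> z))) * w)) (at (l * of_real (pr j (?\<tau> z))))"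
        using DERIV_exp by (simp add: has_field_derivative_def)
      ultimately have "((\<lambda>z. exp (l * of_real (pr j (?\<tau> z)))) has_derivative
          (\<lambda>u. exp (l * of_real (pr j (?\<tau> z))) * (l * t z u))) (at z)"
        by (rule has_derivative_compose)
      moreover have "?e z = exp (l * of_real (pr j (?\<tau> z)))" for z
        by (simp add: gauge_def prim_def l_def transition_def mult.assoc)
      ultimately show ?thesis by (simp only: mult.commute)
    qed
    have m: "m z = \<rho> z * ?e z" for z by (simp add: m_def \<rho>_def cutoff_gauge_def)
    show ?thesis
      using t.gauge_product[OF N yN Ncod sm e m] unfolding E_def by blast
  next
    case False
    then have out: "chart_inv c y \<notin> core j" using core_subset[OF j] by blast
    then have "\<rho> y = 0" by (simp add: \<rho>_def rho_outside[OF j])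
    then show ?thesis
      using rho_derivative_outside[OF j out] by (simp add: \<rho>_def m_def)
  qed
  then show "dir_d m y u = (dir_d \<rho> y u + l * t y u * \<rho> y) * E"
    and "dir_d (\<lambda>z. dir_d m z u) y v = (dir_d (\<lambda>z. dir_d \<rho> z u) y v
      + l * (dir_d (\<lambda>z. t z u) y v * \<rho> y + t y u * dir_d \<rho> y v + t y v * dir_d \<rho> y u)
      + l * l * t y u * t y v * \<rho> y) * E"
    by blast+
qed

lemma rho_derivative_sum:
  "(\<Sum>j\<in>I. dir_d (rho j \<circ> chart_inv c) y u) = 0"
  "(\<Sum>j\<in>I. dir_d (\<lambda>z. dir_d (rho j \<circ> chart_inv c) z u) y v) = 0"
proof -
  have 1: "(\<Sum>j\<in>I. dir_d (rho j \<circ> chart_inv c) z u) = 0" if z: "z \<in> chart_cod c" for z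
  proof -
    have "(\<Sum>j\<in>I. dir_d (rho j \<circ> chart_inv c) z u) = dir_d (\<lambda>z. \<Sum>j\<in>I. (rho j \<circ> chart_inv c) z) z u"
      by (rule dir_d_sum[symmetric]) (rule smooth_on_differentiable[OF smooth_chart_rho[OF c] z])
    also have "\<dots> = 0" by (simp add: rho_sum dir_d_def)
    finally show ?thesis .
  qed
  show "(\<Sum>j\<in>I. dir_d (rho j \<circ> chart_inv c) y u) = 0" by (rule 1[OF y])
  have "(\<Sum>j\<in>I. dir_d (\<lambda>z. dir_d (rho j \<circ> chart_inv c) z u) y v)
      = dir_d (\<lambda>z. \<Sum>j\<in>I. dir_d (rho j \<circ> chart_inv c) z u) y v"
    by (rule dir_d_sum[symmetric], unfold dir_d_def,
        rule smooth_on_differentiable[OF smooth_on_frechet_derivative[OF smooth_chart_rho[OF c]] y])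
  also have "\<dots> = 0" by (rule dir_d_eq_0[OF open_cod[OF c] y 1])
  finally show "(\<Sum>j\<in>I. dir_d (\<lambda>z. dir_d (rho j \<circ> chart_inv c) z u) y v) = 0" .
qed

text \<open>The terms in which \<open>rho\<close> is not differentiated recombine into
  \<open>F\<close> itself; \<open>X\<close> and \<open>Y\<close> collect its first and second
  derivatives.\<close>

lemma total_gauge_derivative:
  fixes q :: nat
  defines "F \<equiv> total_gauge q \<circ> chart_inv c"
    and "l \<equiv> \<i> * of_real (2 * pi * q)" and "t \<equiv> \<lambda>x u. \<theta> c x [u]"
    and "X \<equiv> \<lambda>u. \<Sum>j\<in>I. dir_d (rho j \<circ> chart_inv c) y u * gauge q j (chart_inv c y)"
    and "Y \<equiv> \<lambda>u v. \<Sum>j\<in>I. dir_d (\<lambda>z. dir_d (rho j \<circ> chart_inv c) z u) y v * gauge q j (chart_inv c y)"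
  shows "dir_d F y u = X u + l * t y u * F y"
    and "dir_d (\<lambda>z. dir_d F z u) y v = Y u v + l * (dir_d (\<lambda>z. t z u) y v * F y + t y u * X v + t y v * X u)
      + l * l * t y u * t y v * F y"
proof -
  let ?m = "\<lambda>j. cutoff_gauge q j \<circ> chart_inv c" and ?\<rho> = "\<lambda>j. rho j \<circ> chart_inv c"
  let ?E = "\<lambda>j. gauge q j (chart_inv c y)"
  have F: "F = (\<lambda>z. \<Sum>j\<in>I. ?m j z)" by (simp add: F_def total_gauge_def fun_eq_iff)
  have Fy: "F y = (\<Sum>j\<in>I. ?\<rho> j y * ?E j)" by (simp add: F_def total_gauge_def cutoff_gauge_def)
  have 1: "dir_d F z u = (\<Sum>j\<in>I. dir_d (?m j) z u)" if z: "z \<in> chart_cod c" for z u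
    unfolding F by (rule dir_d_sum) (rule smooth_on_differentiable[OF smooth_chart_cutoff_gauge[OF c] z])
  have "dir_d F y u = (\<Sum>j\<in>I. (dir_d (?\<rho> j) y u + l * t y u * ?\<rho> j y) * ?E j)"
    unfolding 1[OF y] l_def t_def by (intro sum.cong refl cutoff_gauge_derivative(1))
  also have "\<dots> = X u + l * t y u * F y"
    by (simp add: X_def Fy sum.distrib sum_distrib_left algebra_simps)
  finally show "dir_d F y u = X u + l * t y u * F y" .
  have "dir_d (\<lambda>z. dir_d F z u) y v = dir_d (\<lambda>z. \<Sum>j\<in>I. dir_d (?m j) z u) y v"
    by (rule dir_d_cong[OF open_cod[OF c] y 1])
  also have "\<dots> = (\<Sum>j\<in>I. dir_d (\<lambda>z. dir_d (?m j) z u) y v)"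
    by (rule dir_d_sum, unfold dir_d_def,
        rule smooth_on_differentiable[OF smooth_on_frechet_derivative[OF smooth_chart_cutoff_gauge[OF c]] y])
  also have "\<dots> = (\<Sum>j\<in>I. (dir_d (\<lambda>z. dir_d (?\<rho> j) z u) y v
      + l * (dir_d (\<lambda>z. t z u) y v * ?\<rho> j y + t y u * dir_d (?\<rho> j) y v + t y v * dir_d (?\<rho> j) y u)
      + l * l * t y u * t y v * ?\<rho> j y) * ?E j)"
    unfolding l_def t_def by (intro sum.cong refl cutoff_gauge_derivative(2))
  also have "\<dots> = Y u v + l * (dir_d (\<lambda>z. t z u) y v * F y + t y u * X v + t y v * X u)
      + l * l * t y u * t y v * F y"
    by (simp add: X_def Y_def Fy sum.distrib sum_distrib_left algebra_simps)
  finally show "dir_d (\<lambda>z. dir_d F z u) y v = Y u v + l * (dir_d (\<lambda>z. t z u) y v * F y + t y u * X v + t y v * X u)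
      + l * l * t y u * t y v * F y" .
qed

text \<open>\<open>\<kappa>\<close> is normalised so that the exact part of dF / F returns \<theta>.
  In the derivative of dF / F the terms with \<open>l * l\<close> and the products of
  \<open>l\<close> with \<open>X\<close> occur in both the second derivative over \<open>F\<close>
  and the product of first derivatives over \<open>F\<^sup>2\<close>, and cancel. Neither error has
  a factor growing with \<open>q\<close>.\<close>

lemma dlog_form_total_gauge:
  fixes q :: nat
  assumes nz: "\<And>p. total_gauge q p \<noteq> 0" and q: "q > 0"
  defines "F \<equiv> total_gauge q (chart_inv c y)" and "\<kappa> \<equiv> 1 / (2 * pi * q)"
    and "X \<equiv> \<lambda>u. \<Sum>j\<in>I. dir_d (rho j \<circ> chart_inv c) y u * gauge q j (chart_inv c y)"
    and "Y \<equiv> \<lambda>u v. \<Sum>j\<in>I. dir_d (\<lambda>z. dir_d (rho j \<circ> chart_inv c) z u) y v * gauge q j (chart_inv c y)"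
  shows "dlog_form A (total_gauge q) \<kappa> c y [u] = \<theta> c y [u] + of_real (\<kappa> * Im (X u / F))"
    and "dir_d (\<lambda>z. dlog_form A (total_gauge q) \<kappa> c z [u]) y v =
      dir_d (\<lambda>z. \<theta> c z [u]) y v + of_real (\<kappa> * Im (Y u v / F - X u * X v / F\<^sup>2))"
proof -
  let ?F = "total_gauge q \<circ> chart_inv c" and ?l = "\<i> * of_real (2 * pi * q)"
  have F0: "F \<noteq> 0" and FF: "?F y = F" using nz by (auto simp: F_def)
  have D: "dir_d ?F y u = X u + ?l * \<theta> c y [u] * F"
    "dir_d (\<lambda>z. dir_d ?F z u) y v = Y u v
      + ?l * (dir_d (\<lambda>z. \<theta> c z [u]) y v * F + \<theta> c y [u] * X v + \<theta> c y [v] * X u)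
      + ?l * ?l * \<theta> c y [u] * \<theta> c y [v] * F" for u v
    using total_gauge_derivative[of q] unfolding X_def Y_def FF by blast+
  have \<kappa>: "\<kappa> * (2 * pi * q) = 1" using q by (simp add: \<kappa>_def)
  have real_Im: "of_real (\<kappa> * Im (?l * w)) = w" if "of_real (Re w) = w" for w
  proof -
    have "\<kappa> * Im (?l * w) = \<kappa> * (2 * pi * q) * Re w" by simp
    then show ?thesis using that by (simp only: \<kappa>) simp
  qed
  have real_d: "of_real (Re (dir_d (\<lambda>z. \<theta> c z [u]) y v)) = dir_d (\<lambda>z. \<theta> c z [u]) y v"
  proof -
    have d: "((\<lambda>z. \<theta> c z [u]) has_derivative dir_d (\<lambda>z. \<theta> c z [u]) y) (at y)"
      unfolding dir_d_def[abs_def]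
      by (rule smooth_on_has_derivative[OF covariant_tensor_1D(2)[OF cov_\<theta> c] y])
    have "((\<lambda>z. complex_of_real (Re (\<theta> c z [u]))) has_derivative (\<lambda>v. complex_of_real (Re (dir_d (\<lambda>z. \<theta> c z [u]) y v)))) (at y)"
      by (intro has_derivative_of_real has_derivative_Re d)
    then have "((\<lambda>z. \<theta> c z [u]) has_derivative (\<lambda>v. of_real (Re (dir_d (\<lambda>z. \<theta> c z [u]) y v)))) (at y)"
      by (simp only: real_\<theta>)
    from has_derivative_unique[OF this d] show ?thesis by metis
  qed
  have "dir_d ?F y u / F = ?l * \<theta> c y [u] + X u / F"
    using D(1)[of u] F0 by (simp add: field_simps)
  then show "dlog_form A (total_gauge q) \<kappa> c y [u] = \<theta> c y [u] + of_real (\<kappa> * Im (X u / F))"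
    unfolding dlog_form_chart[OF smooth_total_gauge nz c y] F_def[symmetric]
    using real_Im[OF real_\<theta>, of c y "[u]"] by (simp only: plus_complex.simps(2) distrib_left of_real_add)
  have "dir_d (\<lambda>z. dir_d ?F z u) y v / F - dir_d ?F y u * dir_d ?F y v / F\<^sup>2 =
      ?l * dir_d (\<lambda>z. \<theta> c z [u]) y v + (Y u v / F - X u * X v / F\<^sup>2)"
    unfolding D using F0 by (simp add: field_simps power2_eq_square)
  moreover have "dir_d (\<lambda>z. dlog_form A (total_gauge q) \<kappa> c z [u]) y v =
      of_real (\<kappa> * Im (dir_d (\<lambda>z. dir_d ?F z u) y v / F - dir_d ?F y u * dir_d ?F y v / F\<^sup>2))"
    using dlog_form_derivative[OF smooth_total_gauge nz c y refl, THEN frechet_derivative_at, symmetric, of \<kappa> u]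
    unfolding FF by (simp add: dir_d_def)
  ultimately show "dir_d (\<lambda>z. dlog_form A (total_gauge q) \<kappa> c z [u]) y v =
      dir_d (\<lambda>z. \<theta> c z [u]) y v + of_real (\<kappa> * Im (Y u v / F - X u * X v / F\<^sup>2))"
    using real_Im[OF real_d] by (simp only: plus_complex.simps(2) distrib_left of_real_add)
qed

end

text \<open>At \<open>p\<close> the glued function is a weighted average of gauges with nonnegative
  weights summing to 1, and only gauges whose core contains \<open>p\<close> take part.\<close>

lemma total_gauge_near:
  assumes i: "i \<in> I" "p \<in> core i" and \<delta>: "0 \<le> \<delta>"
    and agree: "\<And>j. j \<in> I \<Longrightarrow> p \<in> core j \<Longrightarrow> norm (gauge q j p - gauge q i p) \<le> \<delta>"
  shows "norm (total_gauge q p - gauge q i p) \<le> \<delta>"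
proof -
  have "norm ((\<Sum>j\<in>I. rho j p * gauge q j p) - (\<Sum>j\<in>I. rho j p) * gauge q i p) \<le> \<delta> * 1"
    using agree rho_outside rho_norm_sum \<delta> by (intro weighted_sum_bound) auto
  then show ?thesis by (simp add: rho_sum total_gauge_def cutoff_gauge_def)
qed

text \<open>The bound does not involve \<open>q\<close>, which is chosen after \<open>B\<close> and \<open>C\<close>.\<close>

lemma twisted_hessian_perturbation:
  fixes q :: nat
  assumes c: "c \<in> A" and y: "y \<in> chart_cod c" and i: "i \<in> I" "chart_inv c y \<in> core i"
    and nz: "\<And>p. total_gauge q p \<noteq> 0" and q: "q > 0" and \<delta>: "0 \<le> \<delta>" "\<delta> \<le> 1/2"
    and agree: "\<And>j. j \<in> I \<Longrightarrow> chart_inv c y \<in> core j \<Longrightarrow>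
      norm (gauge q j (chart_inv c y) - gauge q i (chart_inv c y)) \<le> \<delta>"
    and \<phi>: "smooth_on (chart_cod c) \<phi>"
    and B: "norm (\<phi> y) \<le> B" "norm (dir_d \<phi> y u) \<le> B" "norm (\<theta> c y [u]) \<le> B"
    and C: "(\<Sum>j\<in>I. norm (dir_d (rho j \<circ> chart_inv c) y u)) \<le> C"
      "(\<Sum>j\<in>I. norm (dir_d (\<lambda>z. dir_d (rho j \<circ> chart_inv c) z u) y u)) \<le> C"
  defines "t \<equiv> \<lambda>x u. \<theta> c x [u]" and "t' \<equiv> \<lambda>x u. dlog_form A (total_gauge q) (1 / (2 * pi * q)) c x [u]"
  shows "norm (tw t' u (tw t' u \<phi>) y - tw t u (tw t u \<phi>) y)
    \<le> \<delta> * ((2 * C + 4 * C\<^sup>2) * B + 4 * C * (B + B\<^sup>2) + 4 * C\<^sup>2 * B)"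
proof -
  interpret t: local_1form "chart_cod c" t unfolding t_def by (rule local_1form_chart[OF closed_\<theta> c])
  interpret t': local_1form "chart_cod c" t'
    unfolding t'_def by (rule local_1form_chart[OF closed_dlog_form[OF smooth_total_gauge nz] c])
  let ?p = "chart_inv c y" and ?\<kappa> = "1 / (2 * pi * q)"
  define F where "F = total_gauge q ?p"
  define X where "X = (\<Sum>j\<in>I. dir_d (rho j \<circ> chart_inv c) y u * gauge q j ?p)"
  define Y where "Y = (\<Sum>j\<in>I. dir_d (\<lambda>z. dir_d (rho j \<circ> chart_inv c) z u) y u * gauge q j ?p)"
  have C0: "0 \<le> C" using C(1) by (meson norm_ge_zero order_trans sum_nonneg)
  have B0: "0 \<le> B" using B(1) norm_ge_zero order_trans by blast
  have near: "dir_d (rho j \<circ> chart_inv c) y u = 0 \<or> norm (gauge q j ?p - gauge q i ?p) \<le> \<delta>"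
    "dir_d (\<lambda>z. dir_d (rho j \<circ> chart_inv c) z u) y u = 0 \<or> norm (gauge q j ?p - gauge q i ?p) \<le> \<delta>"
    if "j \<in> I" for j
    using agree[OF that] rho_derivative_outside(1,2)[OF c y that] by blast+
  have "norm (X - (\<Sum>j\<in>I. dir_d (rho j \<circ> chart_inv c) y u) * gauge q i ?p) \<le> \<delta> * C"
    unfolding X_def by (rule weighted_sum_bound[OF near(1) C(1) \<delta>(1)])
  \<comment> \<open>The comparison sum vanishes since the derivatives of a partition of unity sum to
    zero; the same is used for \<open>Y\<close>.\<close>
  then have X: "norm X \<le> \<delta> * C" by (simp add: rho_derivative_sum[OF c y])
  have "norm (Y - (\<Sum>j\<in>I. dir_d (\<lambda>z. dir_d (rho j \<circ> chart_inv c) z u) y u) * gauge q i ?p) \<le> \<delta> * C"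
    unfolding Y_def by (rule weighted_sum_bound[OF near(2) C(2) \<delta>(1)])
  then have Y: "norm Y \<le> \<delta> * C" by (simp add: rho_derivative_sum[OF c y])
  have F: "norm (F - gauge q i ?p) \<le> \<delta>"
    unfolding F_def by (rule total_gauge_near[OF i \<delta>(1) agree])
  note bounds = log_perturbation_bound[OF F norm_gauge \<delta>(2) X Y \<delta>(1) C0]
  define \<epsilon> where "\<epsilon> = complex_of_real (?\<kappa> * Im (X / F))"
  define \<eta> where "\<eta> = complex_of_real (?\<kappa> * Im (Y / F - X * X / F\<^sup>2))"
  have te: "t' y u = t y u + \<epsilon>" "dir_d (\<lambda>z. t' z u) y u = dir_d (\<lambda>z. t z u) y u + \<eta>"
    using dlog_form_total_gauge[OF c y nz q] unfolding t_def t'_def \<epsilon>_def \<eta>_def X_def Y_def F_def by blast+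
  \<comment> \<open>Uniformity in \<open>q\<close>: the normalising factor is at most 1 because
    \<open>2 * pi * q\<close> is at least 1.\<close>
  have \<kappa>: "0 \<le> ?\<kappa>" "?\<kappa> \<le> 1"
  proof -
    have "1 \<le> 2 * pi * real q" using pi_ge_two q mult_mono[of 1 "2 * pi" 1 "real q"] by simp
    then show "?\<kappa> \<le> 1" by (simp add: divide_le_eq)
  qed (use pi_gt_zero in simp)
  have small: "norm (complex_of_real (?\<kappa> * Im w)) \<le> norm w" for w
  proof -
    have "norm (complex_of_real (?\<kappa> * Im w)) = ?\<kappa> * \<bar>Im w\<bar>"
      using \<kappa>(1) by (simp only: norm_of_real abs_mult abs_of_nonneg)
    also have "\<dots> \<le> 1 * norm w" using \<kappa> abs_Im_le_cmod by (intro mult_mono) auto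
    finally show ?thesis by simp
  qed
  have \<epsilon>: "norm \<epsilon> \<le> 2 * \<delta> * C" unfolding \<epsilon>_def using small bounds(2) order_trans by blast
  have \<eta>: "norm \<eta> \<le> \<delta> * (2 * C + 4 * C\<^sup>2)" unfolding \<eta>_def using small bounds(3) order_trans by blast
  \<comment> \<open>By \<open>tw_twice\<close> the second twisted derivative is polynomial in the
    1-form and affine in its derivative. Replacing these by values shifted by \<epsilon> and \<eta>
    leaves exactly four terms, and no derivative of \<phi> of order two.\<close>
  have "tw t' u (tw t' u \<phi>) y - tw t u (tw t u \<phi>) y =
      - (\<eta> * \<phi> y) - 2 * \<epsilon> * dir_d \<phi> y u + 2 * \<epsilon> * (t y u * \<phi> y) + \<epsilon> * \<epsilon> * \<phi> y"
    unfolding t.tw_twice[OF \<phi> y] t'.tw_twice[OF \<phi> y] te by (simp add: algebra_simps)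
  also have "norm \<dots> \<le> norm (\<eta> * \<phi> y) + norm (2 * \<epsilon> * dir_d \<phi> y u) + norm (2 * \<epsilon> * (t y u * \<phi> y)) + norm (\<epsilon> * \<epsilon> * \<phi> y)"
    by (intro norm_triangle_mono norm_triangle_le_diff) (simp_all add: order_refl)
  also have "\<dots> = norm \<eta> * norm (\<phi> y) + 2 * norm \<epsilon> * norm (dir_d \<phi> y u)
      + 2 * norm \<epsilon> * (norm (t y u) * norm (\<phi> y)) + norm \<epsilon> * norm \<epsilon> * norm (\<phi> y)"
    by (simp add: norm_mult)
  also have "\<dots> \<le> (\<delta> * (2 * C + 4 * C\<^sup>2)) * B + 2 * (2 * \<delta> * C) * B
      + 2 * (2 * \<delta> * C) * (B * B) + (2 * \<delta> * C) * (2 * \<delta> * C) * B"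
    using \<epsilon> \<eta> B B0 C0 \<delta> by (intro add_mono mult_mono) (auto simp: t_def)
  also have "\<dots> = \<delta> * ((2 * C + 4 * C\<^sup>2) * B + 4 * C * (B + B\<^sup>2) + 4 * C\<^sup>2 * B * \<delta>)"
    by (simp add: algebra_simps power2_eq_square)
  also have "\<dots> \<le> \<delta> * ((2 * C + 4 * C\<^sup>2) * B + 4 * C * (B + B\<^sup>2) + 4 * C\<^sup>2 * B * 1)"
    using \<delta> B0 C0 by (intro mult_left_mono add_left_mono) auto
  finally show ?thesis by simp
qed

end

section \<open>Existence of the covers\<close>

definition imag_part :: "('m \<Rightarrow> complex) \<Rightarrow> 'm \<Rightarrow> complex" where
  "imag_part f p = \<i> * of_real (Im (f p))"

lemma (in cplx_atlas) smooth_imag_part: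
  assumes "smooth_function A f"
  shows "smooth_function A (imag_part f)"
  using assms unfolding smooth_function_def o_def imag_part_def
  by (intro ballI smooth_on_mult smooth_on_const smooth_on_of_real smooth_on_Im open_cod) auto

lemma (in cplx_atlas) exists_chart_cover:
  assumes "compact (UNIV :: 'm set)"
  shows "\<exists>(I :: 'm set) ch ce ra. chart_cover A I ch ce ra"
proof -
  have "\<exists>c r. c \<in> A \<and> p \<in> fst c \<and> r > 0 \<and> cball (snd c p) (2 * r) \<subseteq> chart_cod c" for p
  proof -
    obtain c where c: "c \<in> A" "p \<in> fst c" using chart_exists by blast
    obtain s where "s > 0" "cball (snd c p) s \<subseteq> chart_cod c"
      using open_cod[OF c(1)] snd_in[OF c(2)] open_contains_cball by metis
    \<comment> \<open>Half the radius is recorded, because the locale requires the doubled closed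
      ball to lie in the chart.\<close>
    then show ?thesis using c by (intro exI[of _ c] exI[of _ "s / 2"]) auto
  qed
  then obtain ch ra where cr: "\<And>p. ch p \<in> A" "\<And>p. p \<in> fst (ch p)" "\<And>p. ra p > (0::real)"
    "\<And>p. cball (snd (ch p) p) (2 * ra p) \<subseteq> chart_cod (ch p)" by metis
  let ?U = "\<lambda>i. {p \<in> fst (ch i). snd (ch i) p \<in> ball (snd (ch i) i) (ra i)}"
  have "open (?U i)" for i by (rule open_chart_preimage[OF cr(1) open_ball])
  moreover have "UNIV \<subseteq> (\<Union>i. ?U i)" using cr(2,3) by auto
  ultimately obtain I where I: "finite I" "UNIV \<subseteq> (\<Union>i\<in>I. ?U i)"
    by (rule compactE_image[OF assms, of UNIV ?U]) 
  have "chart_cover A I ch (\<lambda>i. snd (ch i) i) ra"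
    using I cr by unfold_locales auto
  then show ?thesis by blast
qed

text \<open>The doubled balls are where the Poincare lemma is applied; the real part turns the
  complex-valued tensor into the real form it represents.\<close>

lemma (in chart_cover) exists_gauge_cover:
  assumes \<theta>: "closed_real_1form A \<theta>"
  shows "\<exists>pr. gauge_cover A I ch ce ra \<theta> pr"
proof -
  have "\<exists>f. \<forall>x\<in>ball (ce i) (2 * ra i). (f has_derivative (\<lambda>u. Re (\<theta> (ch i) x [u]))) (at x)" if i: "i \<in> I" for i
  proof (rule closed_form_has_primitive)
    interpret t: local_1form "chart_cod (ch i)" "\<lambda>x u. \<theta> (ch i) x [u]"
      by (rule local_1form_chart[OF \<theta> ch[OF i]])
    note sub = ball_cod[OF i]
    show "linear (\<lambda>u. Re (\<theta> (ch i) x [u]))" if "x \<in> ball (ce i) (2 * ra i)" for x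
    proof -
      have "linear (\<lambda>u. \<theta> (ch i) x [u])" using t.lin_t sub that by blast
      then show ?thesis by (auto simp: linear_iff)
    qed
    show "smooth_on (ball (ce i) (2 * ra i)) (\<lambda>x. Re (\<theta> (ch i) x [v]))" for v
      by (intro smooth_on_Re open_ball smooth_on_subset[OF t.smooth_t sub])
    fix x u v assume "x \<in> ball (ce i) (2 * ra i)"
    then have x: "x \<in> chart_cod (ch i)" using sub by blast
    have "frechet_derivative (\<lambda>y. Re (\<theta> (ch i) y [u])) (at x) = (\<lambda>v. Re (frechet_derivative (\<lambda>y. \<theta> (ch i) y [u]) (at x) v))" for u
      by (rule frechet_derivative_at[symmetric], rule has_derivative_Re, rule smooth_on_has_derivative[OF t.smooth_t x])
    then show "frechet_derivative (\<lambda>y. Re (\<theta> (ch i) y [u])) (at x) v = frechet_derivative (\<lambda>y. Re (\<theta> (ch i) y [v])) (at x) u"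
      using t.closed_t[OF x, of u v] by simp
  qed
  then obtain pr where "\<And>i x. i \<in> I \<Longrightarrow> x \<in> ball (ce i) (2 * ra i) \<Longrightarrow>
      (pr i has_derivative (\<lambda>u. Re (\<theta> (ch i) x [u]))) (at x)" by metis
  then show ?thesis using \<theta> chart_cover_axioms
    by (intro exI[of _ pr] gauge_cover.intro gauge_cover_axioms.intro) auto
qed

section \<open>Positivity of the perturbed form\<close>

context gauge_cover
begin

definition perturbed :: "nat \<Rightarrow> ('m, 'n) tensor" where
  "perturbed q = dlog_form A (total_gauge q) (1 / (2 * pi * q))"

lemma continuous_on_dir_d:
  assumes "smooth_on S h"
  shows "continuous_on (S \<times> UNIV) (\<lambda>p. dir_d h (fst p) (snd p))"
  unfolding dir_d_def
  by (intro continuous_on_linear_slot linear_frechet_derivative smooth_on_imp_continuous_on smooth_on_frechet_derivative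
      smooth_on_differentiable[OF assms] assms)

lemma continuous_on_dir_d2:
  assumes S: "open S" and h: "smooth_on S h"
  shows "continuous_on (S \<times> UNIV) (\<lambda>p. dir_d (\<lambda>z. dir_d h z (snd p)) (fst p) (snd p))"
proof -
  note h' = smooth_on_frechet_derivative[OF h]
  have "continuous_on (S \<times> UNIV) (\<lambda>p. frechet_derivative (\<lambda>z. frechet_derivative h (at z) (id (snd p))) (at (fst p)) (snd p))"
  proof (rule continuous_on_bilinear_diagonal)
    show "linear (\<lambda>u. frechet_derivative (\<lambda>z. frechet_derivative h (at z) u) (at x) v)" if "x \<in> S" for x v
      by (rule frechet_derivative_linear_slot[OF S that])
         (auto intro: linear_frechet_derivative smooth_on_differentiable[OF h] smooth_on_differentiable[OF h' that])
    show "linear (\<lambda>v. frechet_derivative (\<lambda>z. frechet_derivative h (at z) u) (at x) v)" if "x \<in> S" for x u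
      by (intro linear_frechet_derivative smooth_on_differentiable[OF h' that])
    show "continuous_on S (\<lambda>x. frechet_derivative (\<lambda>z. frechet_derivative h (at z) u) (at x) v)" for u v
      by (intro smooth_on_imp_continuous_on smooth_on_frechet_derivative h)
  qed (rule linear_id)
  then show ?thesis by (simp add: dir_d_def)
qed

context
  fixes f assumes f: "smooth_function A f"
    and pos: "\<And>c x u. c \<in> A \<Longrightarrow> x \<in> chart_cod c \<Longrightarrow> u \<noteq> 0 \<Longrightarrow> Re (bc_form A \<theta> f c x [- (\<i> *s u), u]) > 0"
begin

text \<open>\<open>m\<close> is the minimum of the original Hermitian form on unit vectors over a
  closed ball, positive by compactness, and \<open>K\<close> is the constant of the perturbation
  estimate. Both are fixed before \<open>q\<close> and \<open>\<delta>\<close>, as the later choice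
  demands.\<close>

lemma uniform_lower_bound:
  assumes i: "i \<in> I"
  shows "\<exists>m K. 0 < m \<and> (\<forall>q \<delta> y u. q > 0 \<longrightarrow> (\<forall>p. total_gauge q p \<noteq> 0) \<longrightarrow> 0 \<le> \<delta> \<longrightarrow> \<delta> \<le> 1/2 \<longrightarrow>
    (\<forall>j p. j \<in> I \<longrightarrow> p \<in> core i \<longrightarrow> p \<in> core j \<longrightarrow> norm (gauge q j p - gauge q i p) \<le> \<delta>) \<longrightarrow>
    y \<in> cball (ce i) (ra i) \<longrightarrow> norm u = 1 \<longrightarrow>
    m - \<delta> * K \<le> Re (bc_form A (perturbed q) (imag_part f) (ch i) y [- (\<i> *s u), u]))"
proof -
  let ?c = "ch i" and ?K = "cball (ce i) (ra i)"
  let ?S = "chart_cod ?c"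
  note c = ch[OF i]
  have sub: "?K \<subseteq> ?S" using cball_ra_subset[OF i] ball_cod[OF i] by blast
  interpret t: local_1form ?S "\<lambda>x u. \<theta> ?c x [u]" by (rule local_1form_chart[OF closed_\<theta> c])
  define h where "h = f \<circ> chart_inv ?c"
  have h: "smooth_on ?S h" using f c by (simp add: h_def smooth_function_def)
  define \<phi> where "\<phi> = (\<lambda>y. complex_of_real (Im (h y)))"
  have \<phi>: "smooth_on ?S \<phi>" unfolding \<phi>_def by (intro smooth_on_of_real smooth_on_Im h open_cod c)
  have bc: "bc_form A \<theta> f ?c x [- (\<i> *s u), u] = t.bc h x (- (\<i> *s u)) u" if "x \<in> ?S" for x u
    unfolding h_def by (rule bc_form_chart(1)[OF closed_\<theta> f c that])
  have "continuous_on (?S \<times> UNIV) (\<lambda>p. t.bc h (fst p) (- (\<i> *s snd p)) (snd p))"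
    by (rule continuous_on_bilinear_diagonal[where b="t.bc h"])
       (auto intro: t.linear_bc1[OF h] t.linear_bc2[OF h] smooth_on_imp_continuous_on[OF t.smooth_bc[OF h]]
         linear_compose_neg linear_imaginary_smult)
  then have "continuous_on (?S \<times> UNIV) (\<lambda>p. Re (t.bc h (fst p) (- (\<i> *s snd p)) (snd p)))"
    by (rule continuous_on_Re)
  moreover have "Re (t.bc h x (- (\<i> *s u)) u) > 0" if "x \<in> ?K" "u \<noteq> 0" for x u
    using pos[OF c, of x u] bc[of x u] sub that by auto
  ultimately obtain m where m: "m > 0" "\<And>x u. x \<in> ?K \<Longrightarrow> norm u = 1 \<Longrightarrow> m \<le> Re (t.bc h x (- (\<i> *s u)) u)"
    using compact_product_sphere_positive[OF compact_cball _ sub, of "\<lambda>x u. Re (t.bc h x (- (\<i> *s u)) u)"] by blast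
  let ?\<rho> = "\<lambda>j. rho j \<circ> chart_inv ?c"
  have "continuous_on (?S \<times> UNIV) (\<lambda>p. complex_of_real (norm (\<phi> (fst p)) + norm (dir_d \<phi> (fst p) (snd p)) + norm (\<theta> ?c (fst p) [snd p])))"
  proof -
    have "continuous_on (?S \<times> (UNIV :: (complex^'n) set)) (\<lambda>p. \<phi> (fst p))"
      by (rule continuous_on_compose2[OF smooth_on_imp_continuous_on[OF \<phi>]]) (auto intro: continuous_intros)
    moreover have "continuous_on (?S \<times> UNIV) (\<lambda>p. \<theta> ?c (fst p) [snd p])"
      by (rule continuous_on_linear_slot[where \<theta>="\<lambda>x u. \<theta> ?c x [u]"])
         (auto intro: t.lin_t smooth_on_imp_continuous_on[OF t.smooth_t])
    ultimately show ?thesis using continuous_on_dir_d[OF \<phi>] by (intro continuous_intros)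
  qed
  from compact_product_sphere_bounded[OF compact_cball this sub]
  obtain B where B: "\<And>x u. x \<in> ?K \<Longrightarrow> norm u = 1 \<Longrightarrow>
      norm (complex_of_real (norm (\<phi> x) + norm (dir_d \<phi> x u) + norm (\<theta> ?c x [u]))) \<le> B"
    by blast
  have "continuous_on (?S \<times> UNIV) (\<lambda>p. complex_of_real ((\<Sum>j\<in>I. norm (dir_d (?\<rho> j) (fst p) (snd p)))
      + (\<Sum>j\<in>I. norm (dir_d (\<lambda>z. dir_d (?\<rho> j) z (snd p)) (fst p) (snd p)))))"
    by (intro continuous_intros continuous_on_dir_d continuous_on_dir_d2 open_cod c smooth_chart_rho)
  from compact_product_sphere_bounded[OF compact_cball this sub]
  obtain C where C: "\<And>x u. x \<in> ?K \<Longrightarrow> norm u = 1 \<Longrightarrow>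
      norm (complex_of_real ((\<Sum>j\<in>I. norm (dir_d (?\<rho> j) x u)) + (\<Sum>j\<in>I. norm (dir_d (\<lambda>z. dir_d (?\<rho> j) z u) x u)))) \<le> C"
    by blast
  let ?L = "(2 * C + 4 * C\<^sup>2) * B + 4 * C * (B + B\<^sup>2) + 4 * C\<^sup>2 * B"
  have "m - \<delta> * ?L \<le> Re (bc_form A (perturbed q) (imag_part f) ?c y [- (\<i> *s u), u])"
    if q: "q > 0" "\<forall>p. total_gauge q p \<noteq> 0" and \<delta>: "0 \<le> \<delta>" "\<delta> \<le> 1/2"
      and agree: "\<forall>j p. j \<in> I \<longrightarrow> p \<in> core i \<longrightarrow> p \<in> core j \<longrightarrow> norm (gauge q j p - gauge q i p) \<le> \<delta>"
      and y: "y \<in> ?K" and u: "norm u = 1" for q \<delta> y u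
  proof -
    let ?t = "\<lambda>x u. \<theta> ?c x [u]" and ?t' = "\<lambda>x u. perturbed q ?c x [u]"
    have closed': "closed_real_1form A (perturbed q)"
      unfolding perturbed_def by (rule closed_dlog_form[OF smooth_total_gauge]) (use q(2) in blast)
    interpret t': local_1form ?S ?t' by (rule local_1form_chart[OF closed' c])
    have yS: "y \<in> ?S" using y sub by blast
    have core: "chart_inv ?c y \<in> core i" using y by (simp add: core_def)
    have D: "norm (tw ?t' v (tw ?t' v \<phi>) y - tw ?t v (tw ?t v \<phi>) y) \<le> \<delta> * ?L" if v: "norm v = 1" for v
      unfolding perturbed_def
    proof (rule twisted_hessian_perturbation[OF c yS i core _ q(1) \<delta> _ \<phi>])
      show "norm (\<phi> y) \<le> B" "norm (dir_d \<phi> y v) \<le> B" "norm (\<theta> ?c y [v]) \<le> B"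
        using B[OF y v] unfolding norm_of_real by (smt (verit) norm_ge_zero)+
      have "0 \<le> (\<Sum>j\<in>I. norm (dir_d (?\<rho> j) y v))" "0 \<le> (\<Sum>j\<in>I. norm (dir_d (\<lambda>z. dir_d (?\<rho> j) z v) y v))"
        by (intro sum_nonneg norm_ge_zero)+
      then show "(\<Sum>j\<in>I. norm (dir_d (?\<rho> j) y v)) \<le> C" "(\<Sum>j\<in>I. norm (dir_d (\<lambda>z. dir_d (?\<rho> j) z v) y v)) \<le> C"
        using C[OF y v] unfolding norm_of_real by linarith+
    qed (use q(2) agree core in auto)
    let ?H = "\<lambda>t. tw t u (tw t u \<phi>) y + tw t (\<i> *s u) (tw t (\<i> *s u) \<phi>) y"
    \<comment> \<open>The directions \<open>u\<close> and \<open>\<i> *s u\<close> are both unit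
      vectors and contribute \<open>\<delta> * ?L\<close> each; the factor 1/2 of
      \<open>bc_metric_Re\<close> brings the loss back to \<open>\<delta> * ?L\<close>.\<close>
    have "norm (?H ?t' - ?H ?t) \<le> \<delta> * ?L + \<delta> * ?L"
      using norm_triangle_mono[OF D[OF u] D[of "\<i> *s u"]] u by (simp add: algebra_simps)
    then have "Re (?H ?t) / 2 - \<delta> * ?L \<le> Re (?H ?t') / 2"
      using abs_Re_le_cmod[of "?H ?t' - ?H ?t"] by (simp only: minus_complex.simps)
    moreover have "Re (?H ?t) / 2 = Re (t.bc h y (- (\<i> *s u)) u)"
      by (rule t.bc_metric_Re[OF h yS \<phi>_def, symmetric])
    moreover have "Re (?H ?t') / 2 = Re (bc_form A (perturbed q) (imag_part f) ?c y [- (\<i> *s u), u])"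
      unfolding bc_form_chart(1)[OF closed' smooth_imag_part[OF f] c yS]
      by (rule t'.bc_metric_Re[symmetric, OF _ yS])
         (use smooth_imag_part[OF f] c in \<open>auto simp: smooth_function_def \<phi>_def h_def imag_part_def\<close>)
    ultimately show ?thesis using m(2)[OF y u] by linarith
  qed
  then show ?thesis using m(1) by blast
qed

text \<open>Estimates are made for unit vectors in finitely many balls. The small balls cover, so
  any point can be moved into one of them by a transition map, whose Jacobian is injective, and the
  form is homogeneous of degree two in the vector.\<close>

lemma bc_form_positive_extend:
  assumes closed': "closed_real_1form A \<theta>'" and k: "smooth_function A k"
    and pos: "\<And>i y u. i \<in> I \<Longrightarrow> y \<in> cball (ce i) (ra i) \<Longrightarrow> norm u = 1 \<Longrightarrow> Re (bc_form A \<theta>' k (ch i) y [- (\<i> *s u), u]) > 0"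
    and c: "c \<in> A" "x \<in> chart_cod c" "u \<noteq> 0"
  shows "Re (bc_form A \<theta>' k c x [- (\<i> *s u), u]) > 0"
proof -
  obtain i where i: "i \<in> I" "chart_inv c x \<in> fst (ch i)" "snd (ch i) (chart_inv c x) \<in> ball (ce i) (ra i)"
    using cover by blast
  note cc = c(1) ch[OF i(1)]
  have x: "x \<in> overlap c (ch i)" using overlap_iff[OF c(1)] c i by blast
  define z where "z = transition c (ch i) x"
  have z: "z \<in> cball (ce i) (ra i)" using i(3) by (simp add: z_def transition_def)
  have zS: "z \<in> chart_cod (ch i)" using z cball_ra_subset[OF i(1)] ball_cod[OF i(1)] by blast
  interpret t: local_1form "chart_cod (ch i)" "\<lambda>x u. \<theta>' (ch i) x [u]" by (rule local_1form_chart[OF closed' cc(2)])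
  have h: "smooth_on (chart_cod (ch i)) (k \<circ> chart_inv (ch i))" using k cc(2) by (simp add: smooth_function_def)
  define w where "w = jac c (ch i) x u"
  have lj: "linear (jac (ch i) c z)"
    using linear_jac[OF cc(2,1)] transition_in[OF cc x] by (simp add: z_def)
  have w0: "w \<noteq> 0"
  proof
    assume "w = 0"
    then have "jac (ch i) c z 0 = u" using jac_inverse[OF cc x, of u] by (simp add: w_def z_def)
    then show False using c(3) linear_0[OF lj] by simp
  qed
  \<comment> \<open>Normalisation for the hypothesis on unit vectors; it is legitimate because
    invertibility of the Jacobian gives \<open>w \<noteq> 0\<close>.\<close>
  define v where "v = (1 / norm w) *\<^sub>R w"
  have v: "norm v = 1" "w = norm w *\<^sub>R v" using w0 by (auto simp: v_def)
  have "bc_form A \<theta>' k c x [- (\<i> *s u), u] = bc_form A \<theta>' k (ch i) z [- (\<i> *s w), w]"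
    using bc_form_pullback[OF closed' k cc x, of "- (\<i> *s u)" u] linear_neg[OF linear_jac[OF cc x]]
    by (simp add: z_def w_def jac_imaginary[OF cc x])
  also have "\<dots> = t.bc (k \<circ> chart_inv (ch i)) z (- (\<i> *s w)) w"
    by (rule bc_form_chart(1)[OF closed' k cc(2) zS])
  also have "- (\<i> *s w) = norm w *\<^sub>R - (\<i> *s v)"
    by (subst v(2)) (simp add: imaginary_smult_scaleR)
  also have "t.bc (k \<circ> chart_inv (ch i)) z (norm w *\<^sub>R - (\<i> *s v)) w =
      norm w *\<^sub>R norm w *\<^sub>R t.bc (k \<circ> chart_inv (ch i)) z (- (\<i> *s v)) v"
    unfolding linear_scale[OF t.linear_bc1[OF h zS]]
    by (subst (2) v(2)) (simp add: linear_scale[OF t.linear_bc2[OF h zS]])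
  also have "t.bc (k \<circ> chart_inv (ch i)) z (- (\<i> *s v)) v = bc_form A \<theta>' k (ch i) z [- (\<i> *s v), v]"
    by (rule bc_form_chart(1)[OF closed' k cc(2) zS, symmetric])
  finally show ?thesis using pos[OF i(1) z v(1)] w0 by (simp add: zero_less_mult_iff)
qed

text \<open>The bounds \<open>m i\<close> and \<open>K i\<close> come with the cover, then
  \<open>N\<close> is taken large enough for all finitely many \<open>i\<close>, and only then is
  \<open>q\<close> obtained from \<open>N\<close>. This order is possible because the constants do
  not see \<open>q\<close>.\<close>

lemma exists_perturbation:
  "\<exists>q>0. (\<forall>p. total_gauge q p \<noteq> 0) \<and> lck_form A (bc_form A (perturbed q) (imag_part f)) (perturbed q)"
proof -
  obtain m K where mK: "\<And>i. i \<in> I \<Longrightarrow> 0 < m i" "\<And>i q \<delta> y u. i \<in> I \<Longrightarrow> q > 0 \<Longrightarrow> (\<forall>p. total_gauge q p \<noteq> 0) \<Longrightarrow>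
      0 \<le> \<delta> \<Longrightarrow> \<delta> \<le> 1/2 \<Longrightarrow>
      (\<forall>j p. j \<in> I \<longrightarrow> p \<in> core i \<longrightarrow> p \<in> core j \<longrightarrow> norm (gauge q j p - gauge q i p) \<le> \<delta>) \<Longrightarrow>
      y \<in> cball (ce i) (ra i) \<Longrightarrow> norm u = 1 \<Longrightarrow>
      m i - \<delta> * K i \<le> Re (bc_form A (perturbed q) (imag_part f) (ch i) y [- (\<i> *s u), u])"
    using uniform_lower_bound by metis
  have lim: "(\<lambda>N. 2 * pi / real N * k) \<longlonglongrightarrow> 0" for k
    using tendsto_mult_left_zero[OF tendsto_divide_0[OF tendsto_const filterlim_at_top_imp_at_infinity[OF filterlim_real_sequentially]]]
    by blast
  have "\<forall>\<^sub>F N in sequentially. \<forall>i\<in>I. 2 * pi / real N * K i < m i"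
    using order_tendstoD(2)[OF lim] mK(1) finite_I by (intro eventually_ball_finite) auto
  \<comment> \<open>The bound 1/2 serves two purposes: it is a hypothesis of the perturbation
    estimate, and it keeps \<open>total_gauge q\<close> away from zero.\<close>
  moreover have "\<forall>\<^sub>F N in sequentially. 2 * pi / real N * 1 < 1/2"
    by (rule order_tendstoD(2)[OF lim]) simp
  ultimately have "\<forall>\<^sub>F N in sequentially. N > 0 \<and> 2 * pi / real N * 1 < 1/2 \<and> (\<forall>i\<in>I. 2 * pi / real N * K i < m i)"
    by (intro eventually_conj eventually_gt_at_top)
  then obtain N where N: "N > 0" "2 * pi / real N < 1/2" "\<And>i. i \<in> I \<Longrightarrow> 2 * pi / real N * K i < m i"
    unfolding eventually_sequentially by auto
  let ?\<delta> = "2 * pi / real N"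
  have \<delta>: "0 \<le> ?\<delta>" "?\<delta> \<le> 1/2" using N by auto
  obtain q where q: "q > 0" "\<And>i j p. i \<in> I \<Longrightarrow> j \<in> I \<Longrightarrow> p \<in> core i \<Longrightarrow> p \<in> core j \<Longrightarrow>
      norm (gauge q j p - gauge q i p) \<le> ?\<delta>"
    using gauges_almost_agree[OF N(1)] by blast
  \<comment> \<open>The glued function lies within 1/2 of a gauge, which has norm 1.\<close>
  have nz: "total_gauge q p \<noteq> 0" for p
  proof
    assume 0: "total_gauge q p = 0"
    obtain i where "i \<in> I" "p \<in> fst (ch i)" "snd (ch i) p \<in> ball (ce i) (ra i)" using cover by blast
    then have i: "i \<in> I" "p \<in> core i" using core_iff[of i p] by auto
    have "norm (total_gauge q p - gauge q i p) \<le> ?\<delta>"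
      by (rule total_gauge_near[OF i \<delta>(1)]) (use q(2) i in blast)
    then show False using \<delta>(2) by (simp add: 0)
  qed
  have closed': "closed_real_1form A (perturbed q)"
    unfolding perturbed_def by (rule closed_dlog_form[OF smooth_total_gauge nz])
  have "lck_form A (bc_form A (perturbed q) (imag_part f)) (perturbed q)"
  proof (rule lck_form_bc_form[OF closed' smooth_imag_part[OF f]])
    show "Re (imag_part f p) = 0" for p by (simp add: imag_part_def)
    show "0 < Re (bc_form A (perturbed q) (imag_part f) c x [- (\<i> *s u), u])"
      if "c \<in> A" "x \<in> chart_cod c" "u \<noteq> 0" for c x u
    proof (rule bc_form_positive_extend[OF closed' smooth_imag_part[OF f] _ that])
      fix i y u assume a: "i \<in> I" "y \<in> cball (ce i) (ra i)" "norm (u :: complex^'n) = 1"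
      have "m i - ?\<delta> * K i \<le> Re (bc_form A (perturbed q) (imag_part f) (ch i) y [- (\<i> *s u), u])"
        using q a nz by (intro mK(2) \<delta>) auto
      then show "0 < Re (bc_form A (perturbed q) (imag_part f) (ch i) y [- (\<i> *s u), u])"
        using N(3)[OF a(1)] by linarith
    qed
  qed
  then show ?thesis using q(1) nz by blast
qed

end

end

theorem theorem1p4:
  fixes A :: "('m::{t2_space, second_countable_topology}, 'n::finite) chart set"
    and \<omega> \<theta> :: "('m, 'n) tensor"
  assumes "complex_atlas A"
    and "connected (UNIV :: 'm set)"
    and "compact (UNIV :: 'm set)"
    and "lck_form A \<omega> \<theta>"
    and "bott_chern_class A \<theta> \<omega> = bott_chern_class A \<theta> zero_tensor"
  shows "\<exists>\<omega>' \<theta>'. lck_form A \<omega>' \<theta>' \<and>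
           bott_chern_class A \<theta>' \<omega>' = bott_chern_class A \<theta>' zero_tensor \<and>
           rational_class A \<theta>'"
proof -
  interpret cplx_atlas A by unfold_locales (rule assms(1))
  obtain g where g: "hermitian_metric A g" "\<omega> = fundamental_form g" and closed: "closed_real_1form A \<theta>"
    using assms(4) by (auto simp: lck_form_def)
  obtain f where f: "smooth_function A f" "\<omega> = bc_form A \<theta> f"
    using bott_chern_class_zeroD[OF closed assms(5)] .
  \<comment> \<open>Inserting -Iu into \<omega>(X,Y) = g(IX,Y) returns g(u,u), so positivity of the
    given metric becomes a statement about the potential \<open>f\<close>.\<close>
  have pos: "Re (bc_form A \<theta> f c x [- (\<i> *s u), u]) > 0" if "c \<in> A" "x \<in> chart_cod c" "u \<noteq> 0" for c x u
  proof -
    have "bc_form A \<theta> f c x [- (\<i> *s u), u] = g c x [u, u]"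
      using linear_neg[OF linear_imaginary_smult, of "\<i> *s u"]
      by (simp add: f(2)[symmetric] g(2) fundamental_form_def)
    then show ?thesis using g(1) that by (simp add: hermitian_metric_def)
  qed
  obtain I :: "'m set" and ch ce ra where "chart_cover A I ch ce ra"
    using exists_chart_cover[OF assms(3)] by blast
  then obtain pr where "gauge_cover A I ch ce ra \<theta> pr"
    using chart_cover.exists_gauge_cover closed by blast
  then interpret G: gauge_cover A I ch ce ra \<theta> pr .
  obtain q where q: "q > 0" "\<forall>p. G.total_gauge q p \<noteq> 0"
    "lck_form A (bc_form A (G.perturbed q) (imag_part f)) (G.perturbed q)"
    using G.exists_perturbation[OF f(1) pos] by blast
  have "closed_real_1form A (G.perturbed q)" using q(3) by (simp add: lck_form_def)
  then have "bott_chern_class A (G.perturbed q) (bc_form A (G.perturbed q) (imag_part f))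
      = bott_chern_class A (G.perturbed q) zero_tensor"
    by (rule bott_chern_class_bc_form) (rule smooth_imag_part[OF f(1)])
  moreover have "rational_class A (G.perturbed q)"
    unfolding G.perturbed_def
    by (rule rational_class_dlog_form[OF G.smooth_total_gauge _ q(1)]) (use q(2) in blast)
  ultimately show ?thesis using q(3) by blast
qed

end
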